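(* Let $\mathfrak t$ be a Lie algebroid over $M$ and $\mathfrak g\subset J^1\mathfrak t$ an infinitesimal geometric structure on $\mathfrak t$ whose image $\mathfrak t_1\subset\mathfrak t$ has constant rank. Let $\mathfrak g_1:=\mathfrak g\cap J^1\mathfrak t_1$ be the elementary reduction of $\mathfrak g$. Then: (1) if $\mathfrak g_1$ has constant rank, then it is a reduction of $\mathfrak g$; (2) if $\mathfrak g$ is surjective, then $\mathfrak g_1=\mathfrak g$; (3) conversely, if $\mathfrak g_1=\mathfrak g$, then $\mathfrak g$ is contained in $J^1\mathfrak t_1$ and is surjective as an infinitesimal geometric structure on $\mathfrak t_1$.
   Context: Everything is $C^\infty$. $J^1\mathfrak t$ is the bundle of 1-jets of sections of the Lie algebroid $\mathfrak t$; it is a Lie algebroid with anchor $J^1\mathfrak t\to\mathfrak t\xrightarrow{\#}TM$ and the unique bracket with $[J^1X,J^1Y]=J^1[X,Y]$, where $J^1X$ is the prolongation of a section $X$. A subalgebroid is a constant-rank subbundle whose sections are closed under the bracket. An infinitesimal geometric structure on $\mathfrak t$ is a subalgebroid $\mathfrak g\subset J^1\mathfrak t$. Its image is $\mathfrak t_1:=a(\mathfrak g)$, where $a\colon\mathfrak g\to\mathfrak t$ is the restriction of the projection $J^1\mathfrak t\to\mathfrak t$; when of constant rank, $\mathfrak t_1$ is a subalgebroid of $\mathfrak t$. $\mathfrak g$ is surjective (as a structure on $\mathfrak t$) if $a(\mathfrak g)=\mathfrak t$. A symmetry of $\mathfrak g$ is a section $W$ of $\mathfrak t$ such that $J^1W$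 is a section of $\mathfrak g$. A reduction of $\mathfrak g$ is a subalgebroid $\mathfrak g'\subset\mathfrak g$ with the same symmetries as $\mathfrak g$. *)

theory Defs
  imports "HOL-Analysis.Analysis" "HOL-Library.Function_Algebras"
begin

section \<open>Functions into a real vector space\<close>

instantiation "fun" :: (type, real_vector) real_vector
begin

definition scaleR_fun :: "real \<Rightarrow> ('a \<Rightarrow> 'b) \<Rightarrow> 'a \<Rightarrow> 'b"
  where "scaleR_fun c f = (\<lambda>x. c *\<^sub>R f x)"

instance
  by standard (simp_all add: scaleR_fun_def fun_eq_iff scaleR_add_left scaleR_add_right)

end


section \<open>Smooth manifolds\<close>

primrec Ck_on :: "nat \<Rightarrow> ('a::real_normed_vector \<Rightarrow> 'b::real_normed_vector) \<Rightarrow> 'a set \<Rightarrow> bool"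
  where
    "Ck_on 0 f S \<longleftrightarrow> continuous_on S f"
  | "Ck_on (Suc k) f S \<longleftrightarrow> (\<forall>x\<in>S. f differentiable (at x)) \<and>
       (\<forall>v. Ck_on k (\<lambda>x. frechet_derivative f (at x) v) S)"

text \<open>
  Only used for open sets \<open>S\<close> in finite-dimensional spaces, where continuity of all iterated
  directional derivatives is the usual \<open>C\<^sup>\<infinity>\<close> condition.
\<close>

definition smooth_on :: "'a set \<Rightarrow> ('a::real_normed_vector \<Rightarrow> 'b::real_normed_vector) \<Rightarrow> bool"
  where "smooth_on S f \<longleftrightarrow> (\<forall>k. Ck_on k f S)"

text \<open>
  A chart is a pair \<open>(V, \<phi>)\<close> of an open domain and a coordinate map (irrelevant outside \<open>V\<close>).
  The manifold is the whole type \<open>'m\<close>. The model space \<open>'e\<close> is an arbitrary finite-dimensional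
  inner product space; \<open>euclidean_space\<close> would exclude dimension \<open>0\<close>, hence Lie algebras (Lie
  algebroids over a point).
\<close>

type_synonym ('m, 'e) chart = "'m set \<times> ('m \<Rightarrow> 'e)"

definition smooth_atlas ::
    "('m::{t2_space,second_countable_topology}, 'e::real_inner) chart set \<Rightarrow> bool"
  where
    "smooth_atlas A \<longleftrightarrow>
       (\<exists>B::'e set. finite B \<and> span B = UNIV) \<and>
       (\<Union>(V, \<phi>)\<in>A. V) = UNIV \<and>
       (\<forall>(V, \<phi>)\<in>A. open V \<and> open (\<phi> ` V) \<and> homeomorphism V (\<phi> ` V) \<phi> (inv_into V \<phi>)) \<and>
       (\<forall>(V, \<phi>)\<in>A. \<forall>(W, \<psi>)\<in>A. smooth_on (\<phi> ` (V \<inter> W)) (\<lambda>y. \<psi> (inv_into V \<phi> y)))"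

definition smooth_fun_on ::
    "('m, 'e::real_inner) chart set \<Rightarrow> 'm set \<Rightarrow> ('m \<Rightarrow> real) \<Rightarrow> bool"
  where
    "smooth_fun_on A U f \<longleftrightarrow>
       (\<forall>(V, \<phi>)\<in>A. smooth_on (\<phi> ` (U \<inter> V)) (\<lambda>y. f (inv_into V \<phi> y)))"

text \<open>
  Tangent vectors are derivations at \<open>x\<close> of the algebra of smooth functions on the manifold.
  The value \<open>0\<close> on non-smooth functions only makes the representation unique.
\<close>

definition tangent_space ::
    "('m, 'e::real_inner) chart set \<Rightarrow> 'm \<Rightarrow> (('m \<Rightarrow> real) \<Rightarrow> real) set"
  where
    "tangent_space A x = {v.
       (\<forall>f g. smooth_fun_on A UNIV f \<and> smooth_fun_on A UNIV g \<longrightarrow>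
          v (\<lambda>y. f y + g y) = v f + v g \<and>
          v (\<lambda>y. f y * g y) = f x * v g + g x * v f) \<and>
       (\<forall>c f. smooth_fun_on A UNIV f \<longrightarrow> v (\<lambda>y. c * f y) = c * v f) \<and>
       (\<forall>f. \<not> smooth_fun_on A UNIV f \<longrightarrow> v f = 0)}"


section \<open>Vector bundles\<close>

text \<open>
  A vector bundle is given by its fibres, realised as linear subspaces of one ambient real vector
  space \<open>'v\<close>, and by a set of local trivialisations. The ambient space carries no topology and only
  supplies the linear structure of the individual fibres; the smooth structure comes from the
  trivialisations alone. A trivialisation over \<open>U\<close> is recorded by its local frame, i.e. by a
  finite set \<open>\<Phi>\<close> of local sections (irrelevant outside \<open>U\<close>) forming a basis of each fibre over \<open>U\<close>.
\<close>

type_synonym ('m, 'v) frame = "'m set \<times> ('m \<Rightarrow> 'v) set"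

record ('m, 'v) vbundle =
  fib :: "'m \<Rightarrow> 'v set"
  frames :: "('m, 'v) frame set"

definition is_frame ::
    "('m::topological_space \<Rightarrow> 'v::real_vector set) \<Rightarrow> 'm set \<Rightarrow> ('m \<Rightarrow> 'v) set \<Rightarrow> bool"
  where
    "is_frame F U \<Phi> \<longleftrightarrow> open U \<and> finite \<Phi> \<and>
       (\<forall>x\<in>U. inj_on (\<lambda>b. b x) \<Phi> \<and> independent ((\<lambda>b. b x) ` \<Phi>) \<and> span ((\<lambda>b. b x) ` \<Phi>) = F x)"

definition coef :: "('m \<Rightarrow> 'v::real_vector) set \<Rightarrow> 'm \<Rightarrow> 'v \<Rightarrow> ('m \<Rightarrow> 'v) \<Rightarrow> real"
  where "coef \<Phi> x v b = representation ((\<lambda>b. b x) ` \<Phi>) v (b x)"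

definition smooth_section_on ::
    "('m, 'e::real_inner) chart set \<Rightarrow> ('m, 'v::real_vector, 'z) vbundle_scheme \<Rightarrow> 'm set \<Rightarrow>
     ('m \<Rightarrow> 'v) \<Rightarrow> bool"
  where
    "smooth_section_on A E U s \<longleftrightarrow>
       (\<forall>x\<in>U. s x \<in> fib E x) \<and>
       (\<forall>(W, \<Phi>)\<in>frames E. \<forall>b\<in>\<Phi>. smooth_fun_on A (U \<inter> W) (\<lambda>x. coef \<Phi> x (s x) b))"

definition sections ::
    "('m, 'e::real_inner) chart set \<Rightarrow> ('m, 'v::real_vector, 'z) vbundle_scheme \<Rightarrow> ('m \<Rightarrow> 'v) set"
  where "sections A E = {s. smooth_section_on A E UNIV s}"

definition constant_rank :: "('m \<Rightarrow> 'v::real_vector set) \<Rightarrow> bool"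
  where "constant_rank F \<longleftrightarrow> (\<exists>k. \<forall>x. dim (F x) = k)"

definition vector_bundle ::
    "('m::{t2_space,second_countable_topology}, 'e::real_inner) chart set \<Rightarrow>
     ('m, 'v::real_vector, 'z) vbundle_scheme \<Rightarrow> bool"
  where
    "vector_bundle A E \<longleftrightarrow>
       smooth_atlas A \<and>
       (\<forall>x. subspace (fib E x)) \<and> constant_rank (fib E) \<and>
       (\<Union>(U, \<Phi>)\<in>frames E. U) = UNIV \<and>
       (\<forall>(U, \<Phi>)\<in>frames E. is_frame (fib E) U \<Phi>) \<and>
       (\<forall>(U, \<Phi>)\<in>frames E. \<forall>b\<in>\<Phi>. smooth_section_on A E U b)"

definition sub_frames ::
    "('m::topological_space, 'e::real_inner) chart set \<Rightarrow>
     ('m, 'v::real_vector, 'z) vbundle_scheme \<Rightarrow> ('m \<Rightarrow> 'v set) \<Rightarrow> ('m, 'v) frame set"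
  where
    "sub_frames A E F = {(U, \<Phi>). is_frame F U \<Phi> \<and> (\<forall>b\<in>\<Phi>. smooth_section_on A E U b)}"

definition subbundle ::
    "('m::topological_space, 'e::real_inner) chart set \<Rightarrow>
     ('m, 'v::real_vector, 'z) vbundle_scheme \<Rightarrow> ('m \<Rightarrow> 'v set) \<Rightarrow> bool"
  where
    "subbundle A E F \<longleftrightarrow>
       (\<forall>x. subspace (F x) \<and> F x \<subseteq> fib E x) \<and> constant_rank F \<and>
       (\<Union>(U, \<Phi>)\<in>sub_frames A E F. U) = UNIV"


section \<open>Lie algebroids\<close>

text \<open>The values of the bracket outside the space of smooth sections are irrelevant.\<close>

record ('m, 'v) lie_algebroid = "('m, 'v) vbundle" +
  bracket :: "('m \<Rightarrow> 'v) \<Rightarrow> ('m \<Rightarrow> 'v) \<Rightarrow> 'm \<Rightarrow> 'v"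
  anchor :: "'m \<Rightarrow> 'v \<Rightarrow> ('m \<Rightarrow> real) \<Rightarrow> real"

definition lie_algebroid ::
    "('m::{t2_space,second_countable_topology}, 'e::real_inner) chart set \<Rightarrow>
     ('m, 'v::real_vector) lie_algebroid \<Rightarrow> bool"
  where
    "lie_algebroid A L \<longleftrightarrow>
       vector_bundle A L \<and>
       (\<forall>x. \<forall>u\<in>fib L x. anchor L x u \<in> tangent_space A x) \<and>
       (\<forall>x. \<forall>u\<in>fib L x. \<forall>v\<in>fib L x. anchor L x (u + v) = anchor L x u + anchor L x v) \<and>
       (\<forall>x. \<forall>u\<in>fib L x. \<forall>c. anchor L x (c *\<^sub>R u) = c *\<^sub>R anchor L x u) \<and>
       (\<forall>X\<in>sections A L. \<forall>f. smooth_fun_on A UNIV f \<longrightarrow>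
          smooth_fun_on A UNIV (\<lambda>x. anchor L x (X x) f)) \<and>
       (\<forall>X\<in>sections A L. \<forall>Y\<in>sections A L. bracket L X Y \<in> sections A L) \<and>
       (\<forall>X\<in>sections A L. \<forall>Y\<in>sections A L. \<forall>Z\<in>sections A L.
          bracket L (X + Y) Z = bracket L X Z + bracket L Y Z) \<and>
       (\<forall>X\<in>sections A L. \<forall>Y\<in>sections A L. \<forall>c. bracket L (c *\<^sub>R X) Y = c *\<^sub>R bracket L X Y) \<and>
       (\<forall>X\<in>sections A L. \<forall>Y\<in>sections A L. bracket L X Y = - bracket L Y X) \<and>
       (\<forall>X\<in>sections A L. \<forall>Y\<in>sections A L. \<forall>Z\<in>sections A L.
          bracket L X (bracket L Y Z) + bracket L Y (bracket L Z X) + bracket L Z (bracket L X Y)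
          = 0) \<and>
       (\<forall>X\<in>sections A L. \<forall>Y\<in>sections A L. \<forall>f. smooth_fun_on A UNIV f \<longrightarrow>
          bracket L X (\<lambda>x. f x *\<^sub>R Y x) =
            (\<lambda>x. f x *\<^sub>R bracket L X Y x + anchor L x (X x) f *\<^sub>R Y x))"

definition subalgebroid ::
    "('m::{t2_space,second_countable_topology}, 'e::real_inner) chart set \<Rightarrow>
     ('m, 'v::real_vector) lie_algebroid \<Rightarrow> ('m \<Rightarrow> 'v set) \<Rightarrow> bool"
  where
    "subalgebroid A L F \<longleftrightarrow>
       subbundle A L F \<and>
       (\<forall>X\<in>sections A L. \<forall>Y\<in>sections A L.
          (\<forall>x. X x \<in> F x) \<and> (\<forall>x. Y x \<in> F x) \<longrightarrow> (\<forall>x. bracket L X Y x \<in> F x))"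

text \<open>A subalgebroid \<open>F\<close> of \<open>L\<close>, regarded as a Lie algebroid in its own right.\<close>

definition restrict_algebroid ::
    "('m::topological_space, 'e::real_inner) chart set \<Rightarrow>
     ('m, 'v::real_vector) lie_algebroid \<Rightarrow> ('m \<Rightarrow> 'v set) \<Rightarrow> ('m, 'v) lie_algebroid"
  where "restrict_algebroid A L F = L\<lparr>fib := F, frames := sub_frames A L F\<rparr>"


section \<open>First jets of sections\<close>

text \<open>
  The 1-jet of a section \<open>s\<close> at \<open>x\<close> consists of the value \<open>s x\<close> and of the first derivative of
  \<open>s\<close> in every coordinate system around \<open>x\<close> (a chart \<open>(V, \<phi>)\<close> together with a local frame
  \<open>(U, \<Phi>)\<close>): if \<open>s = (\<Sum>b\<in>\<Phi>. s\<^sub>b b)\<close> near \<open>x\<close>, this derivative sends a coordinate vector \<open>w\<close>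
  to \<open>\<Sum>b\<in>\<Phi>. D(s\<^sub>b \<circ> \<phi>\<inverse>)(\<phi> x)(w) b(x)\<close>. Thus two sections have the same jet at \<open>x\<close> iff they
  agree to first order there, and the vector space structure is the usual one. Recording
  all coordinate systems at once avoids choosing one. The projection of jets onto values is \<open>fst\<close>.
\<close>

type_synonym ('m, 'e, 'v) jet =
  "'v \<times> (('m, 'e) chart \<times> ('m, 'v) frame \<Rightarrow> 'e \<Rightarrow> 'v)"

definition jet ::
    "('m, 'e::real_inner) chart set \<Rightarrow> ('m, 'v::real_vector, 'z) vbundle_scheme \<Rightarrow> 'm \<Rightarrow>
     ('m \<Rightarrow> 'v) \<Rightarrow> ('m, 'e, 'v) jet"
  where
    "jet A E x s = (s x, \<lambda>((V, \<phi>), (U, \<Phi>)) w.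
       if (V, \<phi>) \<in> A \<and> (U, \<Phi>) \<in> frames E \<and> x \<in> V \<inter> U
       then \<Sum>b\<in>\<Phi>. frechet_derivative
              (\<lambda>y. coef \<Phi> (inv_into V \<phi> y) (s (inv_into V \<phi> y)) b) (at (\<phi> x)) w *\<^sub>R b x
       else 0)"

definition jet_fib ::
    "('m, 'e::real_inner) chart set \<Rightarrow> ('m, 'v::real_vector, 'z) vbundle_scheme \<Rightarrow> 'm \<Rightarrow>
     ('m, 'e, 'v) jet set"
  where "jet_fib A E x = jet A E x ` sections A E"

text \<open>A local section of the jet bundle is smooth if all its jet coordinates are.\<close>

definition jet_smooth_on ::
    "('m, 'e::real_inner) chart set \<Rightarrow> ('m, 'v::real_vector, 'z) vbundle_scheme \<Rightarrow> 'm set \<Rightarrow>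
     ('m \<Rightarrow> ('m, 'e, 'v) jet) \<Rightarrow> bool"
  where
    "jet_smooth_on A E U \<sigma> \<longleftrightarrow>
       (\<forall>x\<in>U. \<sigma> x \<in> jet_fib A E x) \<and>
       smooth_section_on A E U (\<lambda>x. fst (\<sigma> x)) \<and>
       (\<forall>(V, \<phi>)\<in>A. \<forall>(W, \<Phi>)\<in>frames E. \<forall>b\<in>\<Phi>. \<forall>w.
          smooth_fun_on A (U \<inter> V \<inter> W) (\<lambda>x. coef \<Phi> x (snd (\<sigma> x) ((V, \<phi>), (W, \<Phi>)) w) b))"

definition jet_frames ::
    "('m::topological_space, 'e::real_inner) chart set \<Rightarrow>
     ('m, 'v::real_vector, 'z) vbundle_scheme \<Rightarrow> ('m, ('m, 'e, 'v) jet) frame set"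
  where
    "jet_frames A E = {(U, \<Psi>). is_frame (jet_fib A E) U \<Psi> \<and> (\<forall>\<sigma>\<in>\<Psi>. jet_smooth_on A E U \<sigma>)}"

text \<open>
  \<open>J\<close> is the jet bundle of \<open>L\<close> with its Lie algebroid structure. The last conjunct determines the
  bracket on smooth sections uniquely, because prolongations \<open>\<lambda>x. jet A L x X\<close> locally generate
  the sections of the jet bundle over the smooth functions.
\<close>

definition jet_algebroid ::
    "('m::{t2_space,second_countable_topology}, 'e::real_inner) chart set \<Rightarrow>
     ('m, 'v::real_vector) lie_algebroid \<Rightarrow> ('m, ('m, 'e, 'v) jet) lie_algebroid \<Rightarrow> bool"
  where
    "jet_algebroid A L J \<longleftrightarrow>
       lie_algebroid A J \<and> fib J = jet_fib A L \<and> frames J = jet_frames A L \<and>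
       (\<forall>x. \<forall>j\<in>fib J x. anchor J x j = anchor L x (fst j)) \<and>
       (\<forall>X\<in>sections A L. \<forall>Y\<in>sections A L.
          bracket J (\<lambda>x. jet A L x X) (\<lambda>x. jet A L x Y) = (\<lambda>x. jet A L x (bracket L X Y)))"


section \<open>Infinitesimal geometric structures\<close>

text \<open>The existential quantifier over \<open>J\<close> is harmless: \<open>J\<close> exists and is essentially unique.\<close>

definition inf_geom_structure ::
    "('m::{t2_space,second_countable_topology}, 'e::real_inner) chart set \<Rightarrow>
     ('m, 'v::real_vector) lie_algebroid \<Rightarrow> ('m \<Rightarrow> ('m, 'e, 'v) jet set) \<Rightarrow> bool"
  where
    "inf_geom_structure A L g \<longleftrightarrow>
       lie_algebroid A L \<and> (\<exists>J. jet_algebroid A L J \<and> subalgebroid A J g)"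

definition image_of :: "('m \<Rightarrow> ('m, 'e, 'v) jet set) \<Rightarrow> 'm \<Rightarrow> 'v set"
  where "image_of g x = fst ` g x"

definition surjective_structure ::
    "('m, 'v) lie_algebroid \<Rightarrow> ('m \<Rightarrow> ('m, 'e, 'v) jet set) \<Rightarrow> bool"
  where "surjective_structure L g \<longleftrightarrow> image_of g = fib L"

definition symmetries ::
    "('m::topological_space, 'e::real_inner) chart set \<Rightarrow>
     ('m, 'v::real_vector) lie_algebroid \<Rightarrow> ('m \<Rightarrow> ('m, 'e, 'v) jet set) \<Rightarrow> ('m \<Rightarrow> 'v) set"
  where
    "symmetries A L g =
       {W \<in> sections A L. jet_smooth_on A L UNIV (\<lambda>x. jet A L x W) \<and> (\<forall>x. jet A L x W \<in> g x)}"

definition is_reduction ::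
    "('m::{t2_space,second_countable_topology}, 'e::real_inner) chart set \<Rightarrow>
     ('m, 'v::real_vector) lie_algebroid \<Rightarrow> ('m \<Rightarrow> ('m, 'e, 'v) jet set) \<Rightarrow>
     ('m \<Rightarrow> ('m, 'e, 'v) jet set) \<Rightarrow> bool"
  where
    "is_reduction A L g g' \<longleftrightarrow>
       inf_geom_structure A L g' \<and> (\<forall>x. g' x \<subseteq> g x) \<and> symmetries A L g' = symmetries A L g"

text \<open>
  For a subalgebroid \<open>L1\<close> of \<open>L\<close>, the jet bundle of \<open>L1\<close> is regarded as a subbundle of the jet
  bundle of \<open>L\<close> via \<open>jet A L1 x s \<mapsto> jet A L x s\<close>. The first definition is the image of this
  inclusion, the second one the preimage of \<open>g\<close>.
\<close>

definition sub_jets ::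
    "('m, 'e::real_inner) chart set \<Rightarrow> ('m, 'v::real_vector) lie_algebroid \<Rightarrow>
     ('m, 'v) lie_algebroid \<Rightarrow> 'm \<Rightarrow> ('m, 'e, 'v) jet set"
  where "sub_jets A L L1 x = jet A L x ` sections A L1"

definition pullback_to_sub ::
    "('m, 'e::real_inner) chart set \<Rightarrow> ('m, 'v::real_vector) lie_algebroid \<Rightarrow>
     ('m, 'v) lie_algebroid \<Rightarrow> ('m \<Rightarrow> ('m, 'e, 'v) jet set) \<Rightarrow> 'm \<Rightarrow> ('m, 'e, 'v) jet set"
  where "pullback_to_sub A L L1 g x = {jet A L1 x s | s. s \<in> sections A L1 \<and> jet A L x s \<in> g x}"

definition image_algebroid ::
    "('m::topological_space, 'e::real_inner) chart set \<Rightarrow>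
     ('m, 'v::real_vector) lie_algebroid \<Rightarrow> ('m \<Rightarrow> ('m, 'e, 'v) jet set) \<Rightarrow>
     ('m, 'v) lie_algebroid"
  where "image_algebroid A L g = restrict_algebroid A L (image_of g)"

definition elementary_reduction ::
    "('m::topological_space, 'e::real_inner) chart set \<Rightarrow>
     ('m, 'v::real_vector) lie_algebroid \<Rightarrow> ('m \<Rightarrow> ('m, 'e, 'v) jet set) \<Rightarrow>
     'm \<Rightarrow> ('m, 'e, 'v) jet set"
  where "elementary_reduction A L g x = g x \<inter> sub_jets A L (image_algebroid A L g) x"

end

theory Submission
  imports Defs
begin

text \<open>
  A section of \<open>\<tt>\<^sub>1\<close> lifts locally to \<open>\<gg>\<close>, and the projection of jets to values preserves brackets; hence
  \<open>\<tt>\<^sub>1\<close> is a subalgebroid. Its jets form a subbundle \<open>J\<^sup>1\<tt>\<^sub>1\<close> of \<open>J\<^sup>1\<tt>\<close> that is locally framed by prolongations,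
  so by the Leibniz rule \<open>J\<^sup>1\<tt>\<^sub>1\<close> is closed under the bracket. The intersection of two subbundles is the kernel
  of a bundle map, so \<open>\<gg> \<inter> J\<^sup>1\<tt>\<^sub>1\<close> is a subbundle, hence a subalgebroid, as soon as it has constant rank.
  Every symmetry of \<open>\<gg>\<close> takes its values in \<open>\<tt>\<^sub>1\<close>, so its prolongation lies in \<open>J\<^sup>1\<tt>\<^sub>1\<close>.
  For the converse statement the Lie algebroid structure of \<open>J\<^sup>1\<tt>\<^sub>1\<close> is obtained by restricting that of \<open>J\<^sup>1\<tt>\<close>.

  Jets are handled through first-order vanishing: the jet of a section vanishes at a point iff its
  coefficients with respect to any one smooth frame vanish there to first order. Linear algebra with
  smooth coefficients is reduced to the Gram-Schmidt process, which avoids determinants.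
\<close>

section \<open>Functions of class \<open>C\<^sup>k\<close>\<close>

text \<open>Two features of the setting shape the proof. Brackets are controlled only on global
  sections and \<open>jet_fib\<close> consists of jets of global sections, whereas frames are local.
  Local constructions are therefore multiplied by a bump function, and the factor is removed again
  by the Leibniz rule: its error term is a multiple of the value of the section at the point in
  question. Secondly, \<open>jet\<close> records derivatives in the frames of a given bundle, so the
  jets of one section in \<open>L\<close> and in the image algebroid are different objects of the
  same type. They are compared through flatness of coefficients, a condition that does not depend on
  the frame. Constant rank of the intersection enters as follows. Near a point the rank of a bundle
  map cannot drop, and a constant kernel dimension prevents it from rising; a maximal independent
  subfamily of images at one point thus stays maximal nearby, and the kernel is framed with one
  index set. The model space is merely an inner product space with a finite spanning set, so
  coordinates are taken in an orthonormal basis that is first constructed.\<close>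

lemma Ck_on_cong:
  assumes "open S" "\<And>x. x \<in> S \<Longrightarrow> f x = g x" "Ck_on k f S"
  shows "Ck_on k g S"
  using assms(2,3)
proof (induction k arbitrary: f g)
  case 0
  then show ?case by (simp add: continuous_on_eq)
next
  case (Suc k)
  have D: "(g has_derivative frechet_derivative f (at x)) (at x)" if "x \<in> S" for x
  proof (rule has_derivative_transform_within_open[OF _ assms(1) that])
    show "(f has_derivative frechet_derivative f (at x)) (at x)"
      using Suc.prems(2) that frechet_derivative_works by auto
  qed (use Suc.prems(1) in auto)
  have "frechet_derivative f (at x) v = frechet_derivative g (at x) v" if "x \<in> S" for x v
    using frechet_derivative_at[OF D[OF that]] by simp
  then have "Ck_on k (\<lambda>x. frechet_derivative g (at x) v) S" for v
    using Suc.IH[of "\<lambda>x. frechet_derivative f (at x) v" "\<lambda>x. frechet_derivative g (at x) v"] Suc.prems(2)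
    by simp
  then show ?case using D by (auto simp: differentiable_def)
qed

lemma Ck_on_subset: "Ck_on k f S \<Longrightarrow> T \<subseteq> S \<Longrightarrow> Ck_on k f T"
  by (induction k arbitrary: f) (auto intro: continuous_on_subset)

text \<open>Differentiability is a condition in the full filter \<open>at x\<close>, hence
  pointwise; at level 0, continuity on an open \<open>T\<close> gives \<open>isCont\<close> at its
  points. So \<open>T\<close> may reach outside \<open>S\<close>.\<close>

lemma Ck_on_local:
  assumes "\<And>x. x \<in> S \<Longrightarrow> \<exists>T. open T \<and> x \<in> T \<and> Ck_on k f T"
  shows "Ck_on k f S"
  using assms
proof (induction k arbitrary: f)
  case 0
  then have "isCont f x" if "x \<in> S" for x
    using that continuous_on_eq_continuous_at by (metis Ck_on.simps(1))
  then show ?case by (simp add: continuous_at_imp_continuous_on)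
next
  case (Suc k)
  have "\<exists>T. open T \<and> x \<in> T \<and> Ck_on k (\<lambda>x. frechet_derivative f (at x) v) T" if "x \<in> S" for x v
    using Suc.prems[OF that] by auto
  then have "Ck_on k (\<lambda>x. frechet_derivative f (at x) v) S" for v by (rule Suc.IH)
  then show ?case using Suc.prems by fastforce
qed

text \<open>By uniqueness of derivatives any explicit formula \<open>f'\<close> may stand for
  \<open>frechet_derivative\<close>. The inductions on \<open>k\<close> for sums, products,
  compositions and special functions each supply such a formula.\<close>

lemma Ck_on_SucI:
  assumes "open S" "\<And>x. x \<in> S \<Longrightarrow> (f has_derivative f' x) (at x)"
    "\<And>v. Ck_on k (\<lambda>x. f' x v) S"
  shows "Ck_on (Suc k) f S"
proof -
  have "f' x v = frechet_derivative f (at x) v" if "x \<in> S" for x v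
    using frechet_derivative_at[OF assms(2)[OF that]] by simp
  then have "Ck_on k (\<lambda>x. frechet_derivative f (at x) v) S" for v
    using Ck_on_cong[OF assms(1) _ assms(3)[of v]] by simp
  then show ?thesis using assms(2) by (auto simp: differentiable_def)
qed

lemma Ck_on_SucD:
  assumes "Ck_on (Suc k) f S"
  shows "x \<in> S \<Longrightarrow> (f has_derivative frechet_derivative f (at x)) (at x)"
    and "Ck_on k (\<lambda>x. frechet_derivative f (at x) v) S"
  using assms frechet_derivative_works by auto

lemma Ck_on_Suc_imp: "Ck_on (Suc k) f S \<Longrightarrow> Ck_on k f S"
proof (induction k arbitrary: f)
  case 0
  then show ?case
    by (auto intro!: continuous_at_imp_continuous_on differentiable_imp_continuous_within)
next
  case (Suc k)
  then show ?case by (metis Ck_on.simps(2))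
qed

lemma Ck_on_le: "Ck_on k f S \<Longrightarrow> j \<le> k \<Longrightarrow> Ck_on j f S"
  by (induction k) (auto simp: le_Suc_eq dest: Ck_on_Suc_imp simp del: Ck_on.simps)

lemma Ck_on_continuous: "Ck_on k f S \<Longrightarrow> continuous_on S f"
  using Ck_on_le[of k f S 0] by simp

lemma Ck_on_const: "open S \<Longrightarrow> Ck_on k (\<lambda>x. c) S"
proof (induction k arbitrary: c)
  case (Suc k)
  show ?case
    by (rule Ck_on_SucI[OF Suc.prems has_derivative_const]) (rule Suc.IH[OF Suc.prems])
qed simp

lemma Ck_on_bounded_linear: "open S \<Longrightarrow> bounded_linear f \<Longrightarrow> Ck_on k f S"
proof (cases k)
  case 0
  assume "open S" "bounded_linear f"
  then show ?thesis using 0 by (simp add: linear_continuous_on)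
next
  case (Suc j)
  assume "open S" "bounded_linear f"
  then show ?thesis unfolding Suc
    by (intro Ck_on_SucI[where f'="\<lambda>x. f"]) (auto intro: bounded_linear_imp_has_derivative Ck_on_const)
qed

lemma Ck_on_add:
  "open S \<Longrightarrow> Ck_on k f S \<Longrightarrow> Ck_on k g S \<Longrightarrow> Ck_on k (\<lambda>x. f x + g x) S"
proof (induction k arbitrary: f g)
  case 0
  then show ?case by (auto intro: continuous_on_add)
next
  case (Suc k)
  show ?case
    by (rule Ck_on_SucI[OF Suc.prems(1) has_derivative_add])
       (use Suc in \<open>auto intro!: Suc.IH dest: Ck_on_SucD simp del: Ck_on.simps\<close>)
qed

lemma Ck_on_bilinear:
  assumes "bounded_bilinear B"
  shows "open S \<Longrightarrow> Ck_on k f S \<Longrightarrow> Ck_on k g S \<Longrightarrow> Ck_on k (\<lambda>x. B (f x) (g x)) S"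
proof (induction k arbitrary: f g)
  case 0
  then show ?case by (auto intro: bounded_bilinear.continuous_on[OF assms])
next
  case (Suc k)
  show ?case
  proof (rule Ck_on_SucI[OF Suc.prems(1)])
    show "((\<lambda>x. B (f x) (g x)) has_derivative (\<lambda>v. B (f x) (frechet_derivative g (at x) v) +
        B (frechet_derivative f (at x) v) (g x))) (at x)" if "x \<in> S" for x
      by (intro bounded_bilinear.FDERIV[OF assms] Ck_on_SucD(1)[OF Suc.prems(2) that]
          Ck_on_SucD(1)[OF Suc.prems(3) that])
    show "Ck_on k (\<lambda>x. B (f x) (frechet_derivative g (at x) v) + B (frechet_derivative f (at x) v) (g x)) S" for v
      by (intro Ck_on_add Suc.IH Suc.prems(1) Ck_on_SucD(2)[OF Suc.prems(2)]
          Ck_on_SucD(2)[OF Suc.prems(3)] Ck_on_Suc_imp[OF Suc.prems(2)] Ck_on_Suc_imp[OF Suc.prems(3)])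
  qed
qed

lemma Ck_on_sum:
  assumes "open S" "finite I" "\<And>i. i \<in> I \<Longrightarrow> Ck_on k (f i) S"
  shows "Ck_on k (\<lambda>x. \<Sum>i\<in>I. f i x) S"
  using assms(2,3) by (induction I rule: finite_induct) (auto intro: Ck_on_const Ck_on_add assms(1))

section \<open>Orthonormal coordinates and the chain rule\<close>

text \<open>Plays the role of \<open>Basis\<close> in a model space that is only known to be a
  \<open>real_inner\<close> type with a finite spanning set; the empty set qualifies in dimension
  0.\<close>

definition orthonormal_basis :: "'a::real_inner set \<Rightarrow> bool"
  where "orthonormal_basis B \<longleftrightarrow> finite B \<and> (\<forall>b\<in>B. \<forall>c\<in>B. b \<bullet> c = (if b = c then 1 else 0)) \<and>
    (\<forall>v. v = (\<Sum>b\<in>B. (v \<bullet> b) *\<^sub>R b))"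

lemma orthonormal_basis_exists:
  assumes "\<exists>B::'a::real_inner set. finite B \<and> span B = UNIV"
  shows "\<exists>B::'a set. orthonormal_basis B"
proof -
  obtain B :: "'a set" where "finite B" "span B = UNIV" using assms by blast
  then obtain C :: "'a set" where C: "finite C" "span C = UNIV" "pairwise orthogonal C"
    using basis_orthogonal[of B] by metis
  \<comment> \<open>An orthogonal spanning set may contain 0, which cannot be normalised.\<close>
  define D where "D = (\<lambda>c. c /\<^sub>R norm c) ` (C - {0})"
  have fD: "finite D" using C(1) D_def by simp
  have on: "b \<bullet> c = (if b = c then 1 else 0)" if bD: "b \<in> D" and cD: "c \<in> D" for b c
  proof -
    obtain b' c' where bc: "b' \<in> C" "c' \<in> C" "b' \<noteq> 0" "c' \<noteq> 0"
      "b = b' /\<^sub>R norm b'" "c = c' /\<^sub>R norm c'"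
      using bD cD unfolding D_def by blast
    show ?thesis
    proof (cases "b' = c'")
      case True
      then show ?thesis using bc by (simp add: power2_norm_eq_inner[symmetric] power2_eq_square)
    next
      case False
      then have "b' \<bullet> c' = 0" using C(3) bc by (auto simp: pairwise_def orthogonal_def)
      then have "b \<bullet> c = 0" using bc by simp
      moreover have "b \<noteq> 0" using bc by simp
      ultimately have "b \<bullet> c = 0" "b \<noteq> c" by (metis inner_eq_zero_iff)+
      then show ?thesis by simp
    qed
  qed
  have "C \<subseteq> span D"
  proof
    fix c assume c: "c \<in> C"
    show "c \<in> span D"
    proof (cases "c = 0")
      case False
      then have "c /\<^sub>R norm c \<in> span D" using c D_def by (intro span_base) auto
      then have "norm c *\<^sub>R (c /\<^sub>R norm c) \<in> span D" by (rule span_scale)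
      then show ?thesis using False by simp
    qed (simp add: span_zero)
  qed
  then have sD: "span D = UNIV" using C(2) by (metis span_minimal subspace_span top.extremum_uniqueI)
  have "v = (\<Sum>b\<in>D. (v \<bullet> b) *\<^sub>R b)" for v
  proof -
    have "v \<in> span D" using sD by simp
    then obtain u where u: "v = (\<Sum>b\<in>D. u b *\<^sub>R b)" using span_finite[OF fD] by auto
    have "v \<bullet> c = u c" if "c \<in> D" for c
    proof -
      have "v \<bullet> c = (\<Sum>b\<in>D. u b * (b \<bullet> c))" by (simp add: u inner_sum_left)
      also have "\<dots> = (\<Sum>b\<in>D. if b = c then u b else 0)"
        by (rule sum.cong) (auto simp: on that)
      finally show ?thesis using fD that by simp
    qed
    then show ?thesis using u by simp
  qed
  then show ?thesis using fD on unfolding orthonormal_basis_def by blast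
qed

text \<open>The derivative of \<open>g\<close> at \<open>f x\<close> is taken in a direction that
  itself moves with \<open>x\<close>, so the induction hypothesis does not apply to it directly.
  Expanding that direction in an orthonormal basis leaves derivatives of \<open>g\<close> in fixed
  directions, each composed with \<open>f\<close>, and scalar coefficients.\<close>

lemma Ck_on_compose:
  fixes f :: "'a::real_normed_vector \<Rightarrow> 'b::real_inner" and g :: "'b \<Rightarrow> 'c::real_normed_vector"
  assumes B: "orthonormal_basis (B :: 'b set)" and S: "open S"
  shows "Ck_on k f S \<Longrightarrow> Ck_on k g T \<Longrightarrow> f ` S \<subseteq> T \<Longrightarrow> Ck_on k (\<lambda>x. g (f x)) S"
proof (induction k arbitrary: f g)
  case 0
  then show ?case by (auto intro: continuous_on_compose2)
next
  case (Suc k)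
  have fB: "finite B" using B by (simp add: orthonormal_basis_def)
  let ?f' = "\<lambda>x. frechet_derivative f (at x)" and ?g' = "\<lambda>y. frechet_derivative g (at y)"
  show ?case
  proof (rule Ck_on_SucI[OF S])
    fix x assume x: "x \<in> S"
    have df: "(f has_derivative ?f' x) (at x)" using Ck_on_SucD(1)[OF Suc.prems(1) x] .
    have dg: "(g has_derivative ?g' (f x)) (at (f x))"
      using Ck_on_SucD(1)[OF Suc.prems(2)] x Suc.prems(3) by blast
    have "?g' (f x) (?f' x v) = (\<Sum>b\<in>B. (?f' x v \<bullet> b) *\<^sub>R ?g' (f x) b)" for v
    proof -
      have l: "linear (?g' (f x))" using dg has_derivative_linear by blast
      have "?f' x v = (\<Sum>b\<in>B. (?f' x v \<bullet> b) *\<^sub>R b)" using B by (simp add: orthonormal_basis_def)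
      then have "?g' (f x) (?f' x v) = ?g' (f x) (\<Sum>b\<in>B. (?f' x v \<bullet> b) *\<^sub>R b)" by simp
      then show ?thesis by (simp add: linear_sum[OF l] linear_cmul[OF l])
    qed
    then show "((\<lambda>x. g (f x)) has_derivative (\<lambda>v. \<Sum>b\<in>B. (?f' x v \<bullet> b) *\<^sub>R ?g' (f x) b)) (at x)"
      using has_derivative_compose[OF df dg] by simp
  next
    fix v
    have "Ck_on k (\<lambda>x. ?g' (f x) b) S" for b
      by (rule Suc.IH[OF _ _ Suc.prems(3)])
         (use Suc.prems Ck_on_SucD(2) Ck_on_Suc_imp in blast)+
    moreover have "Ck_on k (\<lambda>x. ?f' x v \<bullet> b) S" for b
      by (rule Ck_on_bilinear[OF bounded_bilinear_inner S])
         (use Suc.prems Ck_on_SucD(2) Ck_on_const[OF S] in blast)+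
    ultimately show "Ck_on k (\<lambda>x. \<Sum>b\<in>B. (?f' x v \<bullet> b) *\<^sub>R ?g' (f x) b) S"
      by (intro Ck_on_sum[OF S fB] Ck_on_bilinear[OF bounded_bilinear_scaleR S]) auto
  qed
qed

section \<open>Reciprocals and flat exponentials\<close>

lemma orthonormal_basis_real: "orthonormal_basis {1::real}"
  by (simp add: orthonormal_basis_def)

text \<open>The derivative is a product of two reciprocals and a constant, so the induction needs
  only stability under products.\<close>

lemma Ck_on_inverse: "Ck_on k (inverse :: real \<Rightarrow> real) (- {0})"
proof (induction k)
  case (Suc k)
  show ?case
  proof (rule Ck_on_SucI)
    show "(inverse has_derivative (\<lambda>v. - (inverse x * v * inverse x))) (at x)" if "x \<in> - {0}" for x :: real
      using that by (intro Deriv.has_derivative_inverse') auto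
    show "Ck_on k (\<lambda>x. - (inverse x * v * inverse x)) (- {0})" for v :: real
    proof -
      have "Ck_on k (\<lambda>x. (inverse x * inverse x) * (- v)) (- {0})"
        by (intro Ck_on_bilinear[OF bounded_bilinear_mult] Suc Ck_on_const) auto
      then show ?thesis by (simp add: algebra_simps)
    qed
  qed auto
qed (auto intro: continuous_on_inverse)

text \<open>All negative powers of \<open>t\<close> are included because the family is then closed under
  differentiation.\<close>

definition flat_exp :: "nat \<Rightarrow> real \<Rightarrow> real"
  where "flat_exp n t = (if t \<le> 0 then 0 else inverse t ^ n * exp (- inverse t))"

text \<open>From the right substitute s = 1/t: the exponential of s outgrows every power of s. From
  the left the function is identically 0.\<close>

lemma flat_exp_tendsto_0: "(flat_exp n \<longlongrightarrow> 0) (at 0)"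
proof -
  have "((\<lambda>t. inverse t ^ n / exp (inverse t)) \<longlongrightarrow> (0::real)) (at_right 0)"
    using filterlim_compose[OF tendsto_power_div_exp_0 filterlim_inverse_at_top_right] .
  moreover have "eventually (\<lambda>t::real. inverse t ^ n / exp (inverse t) = flat_exp n t) (at_right 0)"
    by (auto simp: eventually_at_filter flat_exp_def exp_minus field_simps)
  ultimately have r: "(flat_exp n \<longlongrightarrow> 0) (at_right 0)" by (rule Lim_transform_eventually)
  have "eventually (\<lambda>t::real. 0 = flat_exp n t) (at_left 0)"
    by (auto simp: eventually_at_filter flat_exp_def)
  then have "(flat_exp n \<longlongrightarrow> 0) (at_left 0)" using Lim_transform_eventually tendsto_const by blast
  then show ?thesis using r filterlim_at_split by blast
qed

text \<open>For t > 0 this is the product rule; at 0 the difference quotient of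
  \<open>flat_exp n\<close> is \<open>flat_exp (n + 1)\<close>, which tends to 0 from both
  sides.\<close>

lemma flat_exp_has_derivative:
  "(flat_exp n has_real_derivative flat_exp (n + 2) t - real n * flat_exp (n + 1) t) (at t)"
proof -
  consider "t < 0" | "t = 0" | "t > 0" by linarith
  then show ?thesis
  proof cases
    case 1
    have "(flat_exp n has_real_derivative 0) (at t)"
      by (rule has_field_derivative_transform_within_open[OF DERIV_const, where S="{..<0}"])
         (use 1 in \<open>auto simp: flat_exp_def\<close>)
    then show ?thesis using 1 by (simp add: flat_exp_def)
  next
    case 2
    have "(\<lambda>h. (flat_exp n (0 + h) - flat_exp n 0) / h) = flat_exp (n + 1)"
      by (auto simp: flat_exp_def fun_eq_iff field_simps)
    then have "(flat_exp n has_real_derivative 0) (at 0)"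
      using flat_exp_tendsto_0[of "n + 1"] unfolding DERIV_def by simp
    then show ?thesis using 2 by (simp add: flat_exp_def)
  next
    case 3
    have "((\<lambda>t. inverse t ^ n * exp (- inverse t)) has_real_derivative
        flat_exp (n + 2) t - real n * flat_exp (n + 1) t) (at t)"
    proof -
      have "((\<lambda>t. inverse t ^ n) has_real_derivative - (real n * inverse t ^ (n + 1))) (at t)"
      proof -
        have "real n * (- (inverse t ^ Suc (Suc 0)) * inverse t ^ (n - Suc 0)) = - (real n * inverse t ^ (n + 1))"
          by (cases n) simp_all
        moreover have "t \<noteq> 0" using 3 by simp
        ultimately show ?thesis using DERIV_power[OF DERIV_inverse, of t n] by (metis)
      qed
      moreover have "((\<lambda>t. exp (- inverse t)) has_real_derivative exp (- inverse t) * inverse t ^ 2) (at t)"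
        using 3 by (auto intro!: derivative_eq_intros simp: power2_eq_square)
      ultimately have "((\<lambda>t. inverse t ^ n * exp (- inverse t)) has_real_derivative
          - (real n * inverse t ^ (n + 1)) * exp (- inverse t) +
          exp (- inverse t) * inverse t ^ 2 * inverse t ^ n) (at t)"
        by (rule DERIV_mult)
      then show ?thesis using 3 by (simp add: flat_exp_def power2_eq_square ac_simps)
    qed
    then show ?thesis
      by (rule has_field_derivative_transform_within_open[of _ _ _ "{0<..}"])
         (use 3 in \<open>auto simp: flat_exp_def\<close>)
  qed
qed

lemma Ck_on_flat_exp: "Ck_on k (flat_exp n) UNIV"
proof (induction k arbitrary: n)
  case 0
  have "isCont (flat_exp n) t" for t using DERIV_isCont flat_exp_has_derivative by blast
  then show ?case by (simp add: continuous_at_imp_continuous_on)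
next
  case (Suc k)
  show ?case
  proof (rule Ck_on_SucI)
    show "(flat_exp n has_derivative (*) (flat_exp (n + 2) t - real n * flat_exp (n + 1) t)) (at t)" for t
      using flat_exp_has_derivative by (simp add: has_field_derivative_def)
    show "Ck_on k (\<lambda>t. (flat_exp (n + 2) t - real n * flat_exp (n + 1) t) * v) UNIV" for v
    proof -
      have "Ck_on k (\<lambda>t. (flat_exp (n + 2) t + (- real n) * flat_exp (n + 1) t) * v) UNIV"
        by (intro Ck_on_bilinear[OF bounded_bilinear_mult] Ck_on_add Ck_on_const Suc) auto
      then show ?thesis by simp
    qed
  qed simp
qed

section \<open>Smooth functions on manifolds\<close>

text \<open>The ball is a closed subset of a box, and the box is a continuous image of a product of
  intervals, built one basis vector at a time. Cauchy-Schwarz with unit basis vectors bounds the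
  coordinates by the radius.\<close>

lemma compact_cball_orthonormal_basis:
  assumes B: "orthonormal_basis (B :: 'e::real_inner set)"
  shows "compact (cball (c::'e) r)"
proof -
  have fB: "finite B" using B by (simp add: orthonormal_basis_def)
  have "compact {v. \<exists>u. (\<forall>b\<in>F. \<bar>u b\<bar> \<le> r) \<and> v = c + (\<Sum>b\<in>F. u b *\<^sub>R b)}" (is "compact (?K F)")
    if "finite F" for F
    using that
  proof (induction F rule: finite_induct)
    case (insert a F)
    have "?K (insert a F) = (\<lambda>(t, v). t *\<^sub>R a + v) ` ({-r..r} \<times> ?K F)" (is "_ = ?R")
    proof
      show "?K (insert a F) \<subseteq> ?R"
      proof
        fix v assume "v \<in> ?K (insert a F)"
        then obtain u where u: "\<forall>b\<in>insert a F. \<bar>u b\<bar> \<le> r" "v = c + (\<Sum>b\<in>insert a F. u b *\<^sub>R b)" by auto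
        have "v = (\<lambda>(t, v). t *\<^sub>R a + v) (u a, c + (\<Sum>b\<in>F. u b *\<^sub>R b))"
          using insert u(2) by (simp add: algebra_simps)
        moreover have "(u a, c + (\<Sum>b\<in>F. u b *\<^sub>R b)) \<in> {-r..r} \<times> ?K F"
          using u(1) by (auto simp: abs_le_iff)
        ultimately show "v \<in> ?R" by (rule image_eqI)
      qed
      show "?R \<subseteq> ?K (insert a F)"
      proof
        fix v assume "v \<in> ?R"
        then obtain t u where u: "\<forall>b\<in>F. \<bar>u b\<bar> \<le> r" "t \<in> {-r..r}" "v = t *\<^sub>R a + (c + (\<Sum>b\<in>F. u b *\<^sub>R b))"
          by auto
        have "(\<Sum>b\<in>F. (u(a := t)) b *\<^sub>R b) = (\<Sum>b\<in>F. u b *\<^sub>R b)"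
          using insert by (intro sum.cong) auto
        then have "v = c + (\<Sum>b\<in>insert a F. (u(a := t)) b *\<^sub>R b)"
          using insert u(3) by (simp add: algebra_simps)
        moreover have "\<forall>b\<in>insert a F. \<bar>(u(a := t)) b\<bar> \<le> r" using u by (auto simp: abs_le_iff)
        ultimately show "v \<in> ?K (insert a F)" by blast
      qed
    qed
    moreover have "compact ?R"
      using insert.IH
      by (intro compact_continuous_image compact_Times)
         (auto intro!: continuous_intros simp: case_prod_unfold)
    ultimately show ?case by simp
  qed auto
  then have "compact (?K B)" using fB by blast
  moreover have "cball c r \<subseteq> ?K B"
  proof
    fix v assume "v \<in> cball c r"
    then have le: "norm (v - c) \<le> r" by (simp add: dist_norm norm_minus_commute)
    have "\<bar>(v - c) \<bullet> b\<bar> \<le> r" if "b \<in> B" for b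
    proof -
      have "norm b = 1" using B that by (simp add: orthonormal_basis_def norm_eq_sqrt_inner)
      then show ?thesis using Cauchy_Schwarz_ineq2[of "v - c" b] le by simp
    qed
    moreover have "v = c + (\<Sum>b\<in>B. ((v - c) \<bullet> b) *\<^sub>R b)"
    proof -
      have "v - c = (\<Sum>b\<in>B. ((v - c) \<bullet> b) *\<^sub>R b)"
        using B unfolding orthonormal_basis_def by blast
      then show ?thesis by (metis add.commute diff_add_cancel)
    qed
    ultimately show "v \<in> ?K B" by blast
  qed
  ultimately show ?thesis
    using compact_Int_closed[of "?K B" "cball c r"] by (simp add: Int_absorb1)
qed

definition chart_deriv :: "('m, 'e::real_inner) chart \<Rightarrow> ('m \<Rightarrow> real) \<Rightarrow> 'm \<Rightarrow> 'e \<Rightarrow> real"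
  where "chart_deriv c f x w =
    frechet_derivative (\<lambda>y. f (inv_into (fst c) (snd c) y)) (at (snd c x)) w"

text \<open>The 1-jet of a function vanishes at \<open>p\<close>. Quantifying over all charts around
  \<open>p\<close> makes the notion independent of the chart from the outset;
  \<open>flat_atI\<close> shows that checking one chart suffices.\<close>

definition flat_at :: "('m, 'e::real_inner) chart set \<Rightarrow> 'm \<Rightarrow> ('m \<Rightarrow> real) \<Rightarrow> bool"
  where "flat_at A p f \<longleftrightarrow> (\<forall>(V, \<phi>)\<in>A. p \<in> V \<longrightarrow>
    f p = 0 \<and> ((\<lambda>y. f (inv_into V \<phi> y)) has_derivative (\<lambda>_. 0)) (at (\<phi> p)))"

locale smooth_manifold =
  fixes A :: "('m::{t2_space,second_countable_topology}, 'e::real_inner) chart set"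
  assumes atlas: "smooth_atlas A"
begin

lemma model_basis: "\<exists>B::'e set. orthonormal_basis B"
  using atlas orthonormal_basis_exists by (auto simp: smooth_atlas_def)

lemma chart_around:
  obtains V \<phi> where "(V, \<phi>) \<in> A" "x \<in> V"
proof -
  have "x \<in> (\<Union>(V, \<phi>)\<in>A. V)" using atlas by (simp add: smooth_atlas_def)
  then show ?thesis using that by auto
qed

lemma chart:
  assumes "(V, \<phi>) \<in> A"
  shows chart_open: "open V" and chart_image_open: "open (\<phi> ` V)"
    and chart_homeo: "homeomorphism V (\<phi> ` V) \<phi> (inv_into V \<phi>)"
  using atlas assms by (auto simp: smooth_atlas_def)

lemma chart_inv [simp]:
  assumes "(V, \<phi>) \<in> A" "x \<in> V"
  shows "inv_into V \<phi> (\<phi> x) = x"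
  using chart_homeo[OF assms(1)] assms(2) by (simp add: homeomorphism_def)

lemma chart_inv_image:
  assumes "(V, \<phi>) \<in> A" "y \<in> \<phi> ` (U \<inter> V)"
  shows "inv_into V \<phi> y \<in> U \<inter> V" "\<phi> (inv_into V \<phi> y) = y"
  using assms by auto

lemma chart_image_open_Int:
  assumes "(V, \<phi>) \<in> A" "open U"
  shows "open (\<phi> ` (U \<inter> V))"
proof -
  have "openin (top_of_set V) (U \<inter> V)" using openin_open_Int[OF assms(2), of V] by (simp add: Int_commute)
  from homeomorphism_imp_open_map[OF chart_homeo[OF assms(1)] this]
  show ?thesis using chart_image_open[OF assms(1)] openin_open_trans by blast
qed

lemma chart_preimage_open:
  assumes "(V, \<phi>) \<in> A" "open T" "T \<subseteq> \<phi> ` V"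
  shows "open (inv_into V \<phi> ` T)"
proof -
  have "openin (top_of_set (\<phi> ` V)) T" using assms by (metis open_subset)
  from homeomorphism_imp_open_map[OF homeomorphism_symD[OF chart_homeo[OF assms(1)]] this]
  show ?thesis using chart_open[OF assms(1)] openin_open_trans by blast
qed

lemma transition_Ck:
  assumes "(V, \<phi>) \<in> A" "(W, \<psi>) \<in> A"
  shows "Ck_on k (\<lambda>y. \<psi> (inv_into V \<phi> y)) (\<phi> ` (V \<inter> W))"
  using atlas assms by (fastforce simp: smooth_atlas_def smooth_on_def)

lemma smooth_fun_Ck:
  assumes "smooth_fun_on A U f" "(V, \<phi>) \<in> A"
  shows "Ck_on k (\<lambda>y. f (inv_into V \<phi> y)) (\<phi> ` (U \<inter> V))"
  using assms by (fastforce simp: smooth_fun_on_def smooth_on_def)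

lemma smooth_funI:
  assumes "\<And>V \<phi> k. (V, \<phi>) \<in> A \<Longrightarrow> Ck_on k (\<lambda>y. f (inv_into V \<phi> y)) (\<phi> ` (U \<inter> V))"
  shows "smooth_fun_on A U f"
  using assms by (auto simp: smooth_fun_on_def smooth_on_def)

lemma smooth_fun_cong:
  assumes "open U" "smooth_fun_on A U f" "\<And>x. x \<in> U \<Longrightarrow> f x = g x"
  shows "smooth_fun_on A U g"
proof (rule smooth_funI)
  fix V \<phi> k assume V: "(V, \<phi>) \<in> A"
  show "Ck_on k (\<lambda>y. g (inv_into V \<phi> y)) (\<phi> ` (U \<inter> V))"
    by (rule Ck_on_cong[OF chart_image_open_Int[OF V assms(1)] _ smooth_fun_Ck[OF assms(2) V]])
       (use V assms(3) in auto)
qed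

lemma smooth_fun_subset:
  assumes "smooth_fun_on A U f" "T \<subseteq> U"
  shows "smooth_fun_on A T f"
  by (rule smooth_funI, rule Ck_on_subset[OF smooth_fun_Ck[OF assms(1)]]) (use assms in auto)

lemma smooth_fun_local:
  assumes "\<And>p. p \<in> U \<Longrightarrow> \<exists>T. open T \<and> p \<in> T \<and> smooth_fun_on A T f"
  shows "smooth_fun_on A U f"
proof (rule smooth_funI, rule Ck_on_local)
  fix V \<phi> k y assume V: "(V, \<phi>) \<in> A" and "y \<in> \<phi> ` (U \<inter> V)"
  then obtain x where x: "x \<in> U" "x \<in> V" "y = \<phi> x" by auto
  obtain T where T: "open T" "x \<in> T" "smooth_fun_on A T f" using assms[OF x(1)] by auto
  show "\<exists>S. open S \<and> y \<in> S \<and> Ck_on k (\<lambda>y. f (inv_into V \<phi> y)) S"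
    by (rule exI[of _ "\<phi> ` (T \<inter> V)"])
       (use x T chart_image_open_Int[OF V] smooth_fun_Ck[OF T(3) V] in auto)
qed

lemma smooth_fun_const: "open U \<Longrightarrow> smooth_fun_on A U (\<lambda>x. c)"
  by (rule smooth_funI) (intro Ck_on_const chart_image_open_Int)

lemma smooth_fun_add:
  "open U \<Longrightarrow> smooth_fun_on A U f \<Longrightarrow> smooth_fun_on A U g \<Longrightarrow> smooth_fun_on A U (\<lambda>x. f x + g x)"
  by (rule smooth_funI) (intro Ck_on_add chart_image_open_Int smooth_fun_Ck)

lemma smooth_fun_mult:
  "open U \<Longrightarrow> smooth_fun_on A U f \<Longrightarrow> smooth_fun_on A U g \<Longrightarrow> smooth_fun_on A U (\<lambda>x. f x * g x)"
  by (rule smooth_funI) (intro Ck_on_bilinear[OF bounded_bilinear_mult] chart_image_open_Int smooth_fun_Ck)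

lemma smooth_fun_minus: "open U \<Longrightarrow> smooth_fun_on A U f \<Longrightarrow> smooth_fun_on A U (\<lambda>x. - f x)"
  using smooth_fun_mult[of U "\<lambda>x. - 1" f] smooth_fun_const[of U "- 1"] by simp

lemma smooth_fun_diff:
  "open U \<Longrightarrow> smooth_fun_on A U f \<Longrightarrow> smooth_fun_on A U g \<Longrightarrow> smooth_fun_on A U (\<lambda>x. f x - g x)"
  using smooth_fun_add[of U f "\<lambda>x. - g x"] smooth_fun_minus[of U g] by simp

lemma smooth_fun_sum:
  assumes "open U" "\<And>i. i \<in> I \<Longrightarrow> smooth_fun_on A U (f i)"
  shows "smooth_fun_on A U (\<lambda>x. \<Sum>i\<in>I. f i x)"
  using assms(2)
proof (induction I rule: infinite_finite_induct)
  case (insert i I)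
  have "smooth_fun_on A U (\<lambda>x. f i x + (\<Sum>i\<in>I. f i x))"
    by (rule smooth_fun_add[OF assms(1)]) (simp_all add: insert.IH insert.prems)
  then show ?case using insert(1,2) by simp
qed (simp_all only: sum.infinite sum.empty smooth_fun_const[OF assms(1)] simp_thms)

lemma smooth_fun_compose:
  fixes h :: "real \<Rightarrow> real"
  assumes "open U" "smooth_fun_on A U f" "\<And>k. Ck_on k h T" "f ` U \<subseteq> T"
  shows "smooth_fun_on A U (\<lambda>x. h (f x))"
proof (rule smooth_funI)
  fix V \<phi> k assume V: "(V, \<phi>) \<in> A"
  have "(\<lambda>y. f (inv_into V \<phi> y)) ` \<phi> ` (U \<inter> V) \<subseteq> T"
    using assms(4) chart_inv[OF V] by auto
  then show "Ck_on k (\<lambda>y. h (f (inv_into V \<phi> y))) (\<phi> ` (U \<inter> V))"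
    by (rule Ck_on_compose[OF orthonormal_basis_real chart_image_open_Int[OF V assms(1)]
          smooth_fun_Ck[OF assms(2) V] assms(3)])
qed

lemma smooth_fun_divide:
  assumes "open U" "smooth_fun_on A U f" "smooth_fun_on A U g" "\<And>x. x \<in> U \<Longrightarrow> g x \<noteq> 0"
  shows "smooth_fun_on A U (\<lambda>x. f x / g x)"
proof -
  have "smooth_fun_on A U (\<lambda>x. inverse (g x))"
    by (rule smooth_fun_compose[OF assms(1,3) Ck_on_inverse]) (use assms(4) in auto)
  from smooth_fun_mult[OF assms(1,2) this] show ?thesis by (simp add: divide_inverse)
qed

text \<open>Any other coordinate expression arises by composing \<open>h\<close> with a transition
  map, so smoothness read in a single chart is enough.\<close>

lemma smooth_fun_chart:
  fixes h :: "'e \<Rightarrow> real"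
  assumes V: "(V, \<phi>) \<in> A" and U: "open U" "U \<subseteq> V"
    and h: "\<And>k. Ck_on k h (\<phi> ` U)" and eq: "\<And>x. x \<in> U \<Longrightarrow> f x = h (\<phi> x)"
  shows "smooth_fun_on A U f"
proof (rule smooth_fun_cong[OF U(1)])
  show "smooth_fun_on A U (\<lambda>x. h (\<phi> x))"
  proof (rule smooth_funI)
    fix W \<psi> k assume W: "(W, \<psi>) \<in> A"
    obtain B :: "'e set" where B: "orthonormal_basis B" using model_basis by auto
    have "Ck_on k (\<lambda>y. \<phi> (inv_into W \<psi> y)) (\<psi> ` (U \<inter> W))"
      by (rule Ck_on_subset[OF transition_Ck[OF W V]]) (use U in auto)
    then show "Ck_on k (\<lambda>y. h (\<phi> (inv_into W \<psi> y))) (\<psi> ` (U \<inter> W))"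
      by (rule Ck_on_compose[OF B chart_image_open_Int[OF W U(1)] _ h])
         (use W in auto)
  qed
qed (simp add: eq)

lemma smooth_fun_continuous:
  assumes "open U" "smooth_fun_on A U f"
  shows "continuous_on U f"
proof (rule continuous_at_imp_continuous_on, rule ballI)
  fix x assume x: "x \<in> U"
  obtain V \<phi> where V: "(V, \<phi>) \<in> A" "x \<in> V" by (rule chart_around)
  have "continuous_on (\<phi> ` (U \<inter> V)) (\<lambda>y. f (inv_into V \<phi> y))"
    using Ck_on_continuous[OF smooth_fun_Ck[OF assms(2) V(1)]] .
  moreover have "continuous_on (U \<inter> V) \<phi>"
    using chart_homeo[OF V(1)] by (auto simp: homeomorphism_def intro: continuous_on_subset)
  ultimately have "continuous_on (U \<inter> V) (\<lambda>x. f (inv_into V \<phi> (\<phi> x)))"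
    by (rule continuous_on_compose2) auto
  then have "continuous_on (U \<inter> V) f"
    by (rule continuous_on_eq) (simp add: V)
  then show "isCont f x"
    using x V chart_open[OF V(1)] assms(1) by (simp add: continuous_on_eq_continuous_at open_Int)
qed

lemma chart_deriv_has_derivative:
  assumes "(V, \<phi>) \<in> A" "smooth_fun_on A U f" "x \<in> U" "x \<in> V"
  shows "((\<lambda>y. f (inv_into V \<phi> y)) has_derivative chart_deriv (V, \<phi>) f x) (at (\<phi> x))"
proof -
  have "\<phi> x \<in> \<phi> ` (U \<inter> V)" using assms(3,4) by blast
  from Ck_on_SucD(1)[OF smooth_fun_Ck[OF assms(2,1)] this]
  show ?thesis by (simp add: chart_deriv_def[abs_def])
qed

lemma chart_deriv_eqI:
  assumes "((\<lambda>y. f (inv_into V \<phi> y)) has_derivative D) (at (\<phi> x))"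
  shows "chart_deriv (V, \<phi>) f x = D"
  using frechet_derivative_at[OF assms] by (simp add: chart_deriv_def fun_eq_iff)

lemma chart_deriv_smooth:
  assumes V: "(V, \<phi>) \<in> A" and U: "open U" "smooth_fun_on A U f"
  shows "smooth_fun_on A (U \<inter> V) (\<lambda>x. chart_deriv (V, \<phi>) f x w)"
proof (rule smooth_fun_chart[OF V])
  show "Ck_on k (\<lambda>y. frechet_derivative (\<lambda>y. f (inv_into V \<phi> y)) (at y) w) (\<phi> ` (U \<inter> V))" for k
    by (rule Ck_on_SucD(2)[OF smooth_fun_Ck[OF U(2) V]])
qed (use chart_open[OF V] U(1) in \<open>simp_all add: chart_deriv_def open_Int\<close>)

lemma has_derivative_near:
  assumes V: "(V, \<phi>) \<in> A" "x \<in> V" and T: "open T" "x \<in> T" "\<And>y. y \<in> T \<Longrightarrow> f y = g y"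
    and "((\<lambda>y. f (inv_into V \<phi> y)) has_derivative D) (at (\<phi> x))"
  shows "((\<lambda>y. g (inv_into V \<phi> y)) has_derivative D) (at (\<phi> x))"
  by (rule has_derivative_transform_within_open[OF assms(6) chart_image_open_Int[OF V(1) T(1)]])
     (use V T in auto)

section \<open>Functions vanishing to first order\<close>

text \<open>In another chart the expression is composed with a transition map, and the chain rule
  turns a zero derivative into a zero derivative.\<close>

lemma flat_atI:
  assumes V: "(V, \<phi>) \<in> A" "p \<in> V" and f: "f p = 0"
    "((\<lambda>y. f (inv_into V \<phi> y)) has_derivative (\<lambda>_. 0)) (at (\<phi> p))"
  shows "flat_at A p f"
proof -
  have "((\<lambda>y. f (inv_into W \<psi> y)) has_derivative (\<lambda>_. 0)) (at (\<psi> p))"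
    if W: "(W, \<psi>) \<in> A" "p \<in> W" for W \<psi>
  proof -
    have "((\<lambda>y. \<phi> (inv_into W \<psi> y)) has_derivative
        frechet_derivative (\<lambda>y. \<phi> (inv_into W \<psi> y)) (at (\<psi> p))) (at (\<psi> p))"
      by (rule Ck_on_SucD(1)[OF transition_Ck[OF W(1) V(1)]]) (use V W in auto)
    from has_derivative_compose[OF this, of "\<lambda>y. f (inv_into V \<phi> y)" "\<lambda>_. 0"] f(2) W V
    have "((\<lambda>y. f (inv_into V \<phi> (\<phi> (inv_into W \<psi> y)))) has_derivative (\<lambda>_. 0)) (at (\<psi> p))"
      by simp
    then show ?thesis
      by (rule has_derivative_near[OF W chart_open[OF V(1)] V(2), rotated, of "\<lambda>x. f (inv_into V \<phi> (\<phi> x))"])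
         (simp add: V)
  qed
  then show ?thesis using f by (auto simp: flat_at_def)
qed

lemma flat_atD:
  assumes "flat_at A p f"
  shows "f p = 0" 
    and "(V, \<phi>) \<in> A \<Longrightarrow> p \<in> V \<Longrightarrow>
      ((\<lambda>y. f (inv_into V \<phi> y)) has_derivative (\<lambda>_. 0)) (at (\<phi> p))"
  using assms chart_around[of p] by (fastforce simp: flat_at_def)+

lemma flat_at_zero: "flat_at A p (\<lambda>_. 0)"
  by (auto simp: flat_at_def)

lemma flat_at_add: "flat_at A p f \<Longrightarrow> flat_at A p g \<Longrightarrow> flat_at A p (\<lambda>x. f x + g x)"
proof -
  assume f: "flat_at A p f" and g: "flat_at A p g"
  obtain V \<phi> where V: "(V, \<phi>) \<in> A" "p \<in> V" by (rule chart_around)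
  show ?thesis
    using has_derivative_add[OF flat_atD(2)[OF f V] flat_atD(2)[OF g V]]
    by (intro flat_atI[OF V]) (simp_all only: flat_atD(1)[OF f] flat_atD(1)[OF g] add_0)
qed

lemma flat_at_sum: "(\<And>i. i \<in> I \<Longrightarrow> flat_at A p (f i)) \<Longrightarrow> flat_at A p (\<lambda>x. \<Sum>i\<in>I. f i x)"
proof (induction I rule: infinite_finite_induct)
  case (insert i I)
  have "flat_at A p (\<lambda>x. f i x + (\<Sum>i\<in>I. f i x))"
    by (rule flat_at_add) (simp_all add: insert.IH insert.prems)
  then show ?case using insert(1,2) by simp
qed (simp_all add: flat_at_zero)

text \<open>In the product rule one term contains \<open>f p\<close> and the other the derivative of
  \<open>f\<close>. Flat functions thus absorb smooth factors, which makes flatness of coefficients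
  insensitive to a change of frame.\<close>

lemma flat_at_mult:
  assumes "smooth_fun_on A U g" "p \<in> U" "flat_at A p f"
  shows "flat_at A p (\<lambda>x. g x * f x)"
proof -
  obtain V \<phi> where V: "(V, \<phi>) \<in> A" "p \<in> V" by (rule chart_around)
  let ?D = "\<lambda>h. g (inv_into V \<phi> (\<phi> p)) * 0 + chart_deriv (V, \<phi>) g p h * f (inv_into V \<phi> (\<phi> p))"
  have "((\<lambda>y. g (inv_into V \<phi> y) * f (inv_into V \<phi> y)) has_derivative ?D) (at (\<phi> p))"
    by (rule has_derivative_mult[OF chart_deriv_has_derivative[OF V(1) assms(1,2) V(2)]
        flat_atD(2)[OF assms(3) V]])
  moreover have "?D = (\<lambda>_. 0)" using V flat_atD(1)[OF assms(3)] by (simp add: fun_eq_iff)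
  ultimately have "((\<lambda>y. g (inv_into V \<phi> y) * f (inv_into V \<phi> y)) has_derivative (\<lambda>_. 0)) (at (\<phi> p))"
    by (simp only:)
  moreover have "g p * f p = 0" using flat_atD(1)[OF assms(3)] by simp
  ultimately show ?thesis by (intro flat_atI[OF V])
qed

lemma flat_at_cong:
  assumes "open T" "p \<in> T" "\<And>y. y \<in> T \<Longrightarrow> f y = g y" "flat_at A p f"
  shows "flat_at A p g"
proof -
  obtain V \<phi> where V: "(V, \<phi>) \<in> A" "p \<in> V" by (rule chart_around)
  show ?thesis
  proof (rule flat_atI[OF V])
    show "g p = 0" using flat_atD(1)[OF assms(4)] assms(3)[OF assms(2)] by simp
  qed (rule has_derivative_near[OF V assms(1-3) flat_atD(2)[OF assms(4) V]])
qed

section \<open>Bump functions and cutting off\<close>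

text \<open>In a chart the function is F(r^2 - q) / (F(r^2 - q) + F(q - r^2/4)), with F =
  \<open>flat_exp 0\<close> and q the squared distance from the centre. \<open>T\<close> is a
  plateau on which multiplication changes nothing; the closed set \<open>K\<close> inside
  \<open>U\<close> lets products with local objects be extended by 0.\<close>

lemma bump_function:
  assumes "open U" "p \<in> U"
  obtains \<rho> T K where "smooth_fun_on A UNIV \<rho>" "open T" "p \<in> T" "T \<subseteq> U" "\<And>x. x \<in> T \<Longrightarrow> \<rho> x = 1"
    "closed K" "K \<subseteq> U" "\<And>x. x \<notin> K \<Longrightarrow> \<rho> x = 0"
proof -
  obtain V \<phi> where V: "(V, \<phi>) \<in> A" "p \<in> V" by (rule chart_around)
  obtain B :: "'e set" where B: "orthonormal_basis B" using model_basis by auto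
  have "open (\<phi> ` (U \<inter> V))" "\<phi> p \<in> \<phi> ` (U \<inter> V)"
    using chart_image_open_Int[OF V(1) assms(1)] assms V by auto
  then obtain r where r: "r > 0" "cball (\<phi> p) r \<subseteq> \<phi> ` (U \<inter> V)"
    by (meson open_contains_cball)
  define q where "q y = (y - \<phi> p) \<bullet> (y - \<phi> p)" for y
  \<comment> \<open>The plateau is the ball of radius r/2 and the support lies in the ball of radius
    r. The two summands never vanish together because r^2/4 < r^2.\<close>
  define d where "d y = flat_exp 0 (r\<^sup>2 - q y) + flat_exp 0 (q y - r\<^sup>2 / 4)" for y
  define h where "h y = flat_exp 0 (r\<^sup>2 - q y) * inverse (d y)" for y
  have q: "q y = (dist (\<phi> p) y)\<^sup>2" for y
    by (simp add: q_def dist_norm norm_minus_commute power2_norm_eq_inner)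
  have dpos: "d y > 0" for y
  proof -
    have "r\<^sup>2 - q y > 0 \<or> q y - r\<^sup>2 / 4 > 0"
      using zero_less_power[OF r(1), of 2] by linarith
    then show ?thesis by (auto simp: d_def flat_exp_def intro: add_pos_pos)
  qed
  have idC: "Ck_on k (\<lambda>y. y + - \<phi> p) (UNIV :: 'e set)" for k
    by (intro Ck_on_add Ck_on_const Ck_on_bounded_linear bounded_linear_ident) auto
  have qC: "Ck_on k q UNIV" for k
    unfolding q_def using Ck_on_bilinear[OF bounded_bilinear_inner _ idC idC] by simp
  have q1: "Ck_on k (\<lambda>y. flat_exp 0 (r\<^sup>2 + (-1) * q y)) UNIV" for k
    by (rule Ck_on_compose[OF orthonormal_basis_real _ _ Ck_on_flat_exp])
       (intro Ck_on_add Ck_on_const Ck_on_bilinear[OF bounded_bilinear_mult] qC open_UNIV subset_UNIV)+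
  have q2: "Ck_on k (\<lambda>y. flat_exp 0 (q y + - (r\<^sup>2 / 4))) UNIV" for k
    by (rule Ck_on_compose[OF orthonormal_basis_real _ _ Ck_on_flat_exp])
       (intro Ck_on_add Ck_on_const Ck_on_bilinear[OF bounded_bilinear_mult] qC open_UNIV subset_UNIV)+
  have dC: "Ck_on k d UNIV" for k
    using Ck_on_add[OF _ q1 q2, of k] unfolding d_def by simp
  have iC: "Ck_on k (\<lambda>y. inverse (d y)) UNIV" for k
    by (rule Ck_on_compose[OF orthonormal_basis_real _ dC Ck_on_inverse])
       (use dpos in \<open>auto simp: less_le\<close>)
  have hC: "Ck_on k h UNIV" for k
    using Ck_on_bilinear[OF bounded_bilinear_mult _ q1 iC] unfolding h_def by simp
  have h1: "h y = 1" if "y \<in> ball (\<phi> p) (r / 2)" for y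
  proof -
    have "q y \<le> (r / 2)\<^sup>2" unfolding q by (rule power_mono) (use that in auto)
    then have "flat_exp 0 (q y - r\<^sup>2 / 4) = 0" by (simp add: flat_exp_def power_divide)
    then show ?thesis using dpos[of y] by (simp add: h_def d_def)
  qed
  have h0: "h y = 0" if "y \<notin> cball (\<phi> p) r" for y
  proof -
    have "r\<^sup>2 \<le> q y" unfolding q by (rule power_mono) (use that r in auto)
    then show ?thesis by (simp add: h_def flat_exp_def)
  qed
  define \<rho> where "\<rho> x = (if x \<in> V then h (\<phi> x) else 0)" for x
  define T where "T = inv_into V \<phi> ` ball (\<phi> p) (r / 2)"
  define K where "K = inv_into V \<phi> ` cball (\<phi> p) r"
  have ball_sub: "ball (\<phi> p) (r / 2) \<subseteq> \<phi> ` (U \<inter> V)" using r by force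
  have KU: "K \<subseteq> U \<inter> V" unfolding K_def using r(2) chart_inv_image[OF V(1)] by blast
  have TU: "T \<subseteq> U \<inter> V" unfolding T_def using ball_sub chart_inv_image[OF V(1)] by blast
  have "compact K" unfolding K_def
    by (rule compact_continuous_image[OF _ compact_cball_orthonormal_basis[OF B]])
       (use chart_homeo[OF V(1)] r(2) in \<open>auto simp: homeomorphism_def intro: continuous_on_subset\<close>)
  \<comment> \<open>The Hausdorff property of the manifold enters here: it makes the compact image
    of a closed coordinate ball closed.\<close>
  then have cK: "closed K" by (rule compact_imp_closed)
  have oT: "open T" unfolding T_def
    by (rule chart_preimage_open[OF V(1)]) (use ball_sub in auto)
  have pT: "p \<in> T" unfolding T_def
    by (rule image_eqI[of _ _ "\<phi> p"]) (use V r in auto)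
  have T1: "\<rho> x = 1" if "x \<in> T" for x
  proof -
    obtain y where y: "y \<in> ball (\<phi> p) (r / 2)" "x = inv_into V \<phi> y" using \<open>x \<in> T\<close> T_def by auto
    have "y \<in> \<phi> ` (U \<inter> V)" using y(1) ball_sub by blast
    then have "\<phi> x = y" using y(2) chart_inv_image(2)[OF V(1)] by blast
    then show ?thesis using h1 y TU \<open>x \<in> T\<close> by (auto simp: \<rho>_def)
  qed
  have K0: "\<rho> x = 0" if "x \<notin> K" for x
  proof (cases "x \<in> V")
    case True
    then have "\<phi> x \<notin> cball (\<phi> p) r" using \<open>x \<notin> K\<close> V(1) unfolding K_def by (metis chart_inv imageI)
    then show ?thesis using True h0 by (simp add: \<rho>_def)
  qed (simp add: \<rho>_def)
  have "smooth_fun_on A V \<rho>"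
    by (rule smooth_fun_chart[OF V(1) chart_open[OF V(1)] order_refl Ck_on_subset[OF hC]])
       (auto simp: \<rho>_def)
  moreover have "smooth_fun_on A (- K) \<rho>"
    by (rule smooth_fun_cong[OF _ smooth_fun_const[of _ 0]]) (use cK K0 in auto)
  \<comment> \<open>As \<open>K\<close> lies in the chart domain, two open sets cover the manifold,
    and smoothness is known on each of them.\<close>
  moreover have "x \<in> V \<or> x \<in> - K" for x using KU by auto
  ultimately have "smooth_fun_on A UNIV \<rho>"
    using chart_open[OF V(1)] cK by (intro smooth_fun_local) blast
  then show ?thesis using that[of \<rho> T K] oT pT TU KU cK T1 K0 by auto
qed

text \<open>Extension by 0 is harmless because the open sets \<open>U\<close> and \<open>- K\<close>
  cover the manifold and the function vanishes on \<open>- K\<close>.\<close>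

lemma cutoff_smooth_fun:
  assumes "smooth_fun_on A UNIV \<rho>" "open U" "closed K" "K \<subseteq> U" "\<And>x. x \<notin> K \<Longrightarrow> \<rho> x = 0"
    "smooth_fun_on A U f"
  shows "smooth_fun_on A UNIV (\<lambda>x. if x \<in> U then \<rho> x * f x else 0)"
proof (rule smooth_fun_local)
  fix p
  show "\<exists>T. open T \<and> p \<in> T \<and> smooth_fun_on A T (\<lambda>x. if x \<in> U then \<rho> x * f x else 0)"
  proof (cases "p \<in> U")
    case True
    have "smooth_fun_on A U (\<lambda>x. \<rho> x * f x)"
      using assms by (intro smooth_fun_mult) (auto intro: smooth_fun_subset)
    then have "smooth_fun_on A U (\<lambda>x. if x \<in> U then \<rho> x * f x else 0)"
      by (rule smooth_fun_cong[OF assms(2)]) simp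
    then show ?thesis using True assms(2) by blast
  next
    case False
    have "smooth_fun_on A (- K) (\<lambda>x. if x \<in> U then \<rho> x * f x else 0)"
      by (rule smooth_fun_cong[OF _ smooth_fun_const[of _ 0]]) (use assms in auto)
    then show ?thesis using False assms by (intro exI[of _ "- K"]) auto
  qed
qed

end

section \<open>Independent families and frames\<close>

text \<open>Families rather than sets: one index set can then serve at all points of an open set and
  in two bundles at once, and coinciding values are excluded by independence itself instead of a
  separate injectivity condition.\<close>

definition indep_fam :: "'j set \<Rightarrow> ('j \<Rightarrow> 'v::real_vector) \<Rightarrow> bool"
  where "indep_fam J s \<longleftrightarrow> (\<forall>c. (\<Sum>j\<in>J. c j *\<^sub>R s j) = 0 \<longrightarrow> (\<forall>j\<in>J. c j = 0))"

lemma indep_famD: "indep_fam J s \<Longrightarrow> (\<Sum>j\<in>J. c j *\<^sub>R s j) = 0 \<Longrightarrow> j \<in> J \<Longrightarrow> c j = 0"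
  by (simp add: indep_fam_def)

lemma indep_fam_unique:
  assumes "indep_fam J s" "(\<Sum>j\<in>J. c j *\<^sub>R s j) = (\<Sum>j\<in>J. d j *\<^sub>R s j)" "j \<in> J"
  shows "c j = d j"
  using indep_famD[OF assms(1), of "\<lambda>j. c j - d j"] assms(2,3)
  by (simp add: scaleR_diff_left sum_subtractf)

lemma indep_fam_inj:
  assumes "finite J" "indep_fam J s"
  shows "inj_on s J"
proof (rule inj_onI, rule ccontr)
  fix i j assume ij: "i \<in> J" "j \<in> J" "s i = s j" "i \<noteq> j"
  let ?c = "\<lambda>k. (if k = i then 1 else 0) - (if k = j then 1 else (0::real))"
  have "(\<Sum>k\<in>J. ?c k *\<^sub>R s k) = (\<Sum>k\<in>J. if k = i then s k else 0) - (\<Sum>k\<in>J. if k = j then s k else 0)"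
    by (simp add: scaleR_diff_left sum_subtractf if_distrib[of "\<lambda>c. c *\<^sub>R _"] cong: if_cong)
  also have "\<dots> = 0" using assms(1) ij by simp
  finally have "?c i = 0" by (rule indep_famD[OF assms(2) _ ij(1)])
  then show False using ij(4) by simp
qed

lemma indep_fam_iff:
  assumes "finite J"
  shows "indep_fam J s \<longleftrightarrow> inj_on s J \<and> independent (s ` J)"
proof
  assume L: "indep_fam J s"
  have inj: "inj_on s J" by (rule indep_fam_inj[OF assms L])
  have "u v = 0" if "(\<Sum>v\<in>s ` J. u v *\<^sub>R v) = 0" "v \<in> s ` J" for u v
    using indep_famD[OF L, of "\<lambda>j. u (s j)"] that by (auto simp: sum.reindex[OF inj])
  then have "independent (s ` J)" using assms by (auto simp: dependent_finite)
  then show "inj_on s J \<and> independent (s ` J)" using inj by simp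
next
  assume R: "inj_on s J \<and> independent (s ` J)"
  show "indep_fam J s" unfolding indep_fam_def
  proof (intro allI impI ballI)
    fix c j assume c: "(\<Sum>j\<in>J. c j *\<^sub>R s j) = 0" and j: "j \<in> J"
    have "(\<Sum>v\<in>s ` J. c (the_inv_into J s v) *\<^sub>R v) = (\<Sum>j\<in>J. c j *\<^sub>R s j)"
      using R by (simp add: sum.reindex the_inv_into_f_f)
    then have "c (the_inv_into J s (s j)) = 0"
      using R c j assms by (auto simp: dependent_finite)
    then show "c j = 0" using R j by (simp add: the_inv_into_f_f)
  qed
qed

lemma span_fam:
  assumes "finite J" "inj_on s J"
  shows "span (s ` J) = range (\<lambda>c. \<Sum>j\<in>J. c j *\<^sub>R s j)"
proof -
  have "(\<Sum>j\<in>J. c j *\<^sub>R s j) \<in> span (s ` J)" for c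
    by (intro span_sum span_scale span_base) auto
  moreover have "v \<in> range (\<lambda>c. \<Sum>j\<in>J. c j *\<^sub>R s j)" if v: "v \<in> span (s ` J)" for v
  proof -
    obtain u where "v = (\<Sum>w\<in>s ` J. u w *\<^sub>R w)" using v span_finite[of "s ` J"] assms(1) by auto
    then have "v = (\<Sum>j\<in>J. u (s j) *\<^sub>R s j)" using assms(2) by (simp add: sum.reindex)
    then show ?thesis by auto
  qed
  ultimately show ?thesis by auto
qed

text \<open>A vector of \<open>V\<close> outside the span would enlarge \<open>B\<close> to an
  independent set with more than \<open>dim V\<close> elements. The finite set \<open>T\<close>
  guarantees that a basis of \<open>V\<close> is finite; the ambient space may be
  infinite-dimensional, and the cardinality of an infinite set carries no information.\<close>

lemma span_independent_eq:
  assumes "independent B" "B \<subseteq> V" "subspace V" "card B = dim V" "finite T" "V \<subseteq> span T" "finite B"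
  shows "span B = V"
proof (rule ccontr)
  assume "span B \<noteq> V"
  then obtain v where v: "v \<in> V" "v \<notin> span B" using span_minimal[OF assms(2,3)] by auto
  obtain C where C: "C \<subseteq> V" "independent C" "V \<subseteq> span C" "card C = dim V" by (rule basis_exists)
  have fC: "finite C" using independent_span_bound[OF assms(5) C(2)] C(1) assms(6) by blast
  have "independent (insert v B)" using v assms(1) by (simp add: independent_insertI)
  moreover have "insert v B \<subseteq> span C" using v(1) assms(2) C(3) by auto
  ultimately have "card (insert v B) \<le> card C" using independent_span_bound[OF fC] by blast
  moreover have "v \<notin> B" using v(2) span_base by auto
  ultimately show False using assms(4,7) C(4) by simp
qed

text \<open>Indexed version of \<open>is_frame\<close>. Writing the fibre as a range of combinations
  lets coefficients be extracted, and frames be transported through linear maps, without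
  re-indexing.\<close>

definition fam_frame :: "('m::topological_space \<Rightarrow> 'v::real_vector set) \<Rightarrow> 'm set \<Rightarrow> 'j set \<Rightarrow>
    ('j \<Rightarrow> 'm \<Rightarrow> 'v) \<Rightarrow> bool"
  where "fam_frame F U J s \<longleftrightarrow> open U \<and> finite J \<and>
    (\<forall>x\<in>U. indep_fam J (\<lambda>j. s j x) \<and> F x = range (\<lambda>c. \<Sum>j\<in>J. c j *\<^sub>R s j x))"

lemma fam_frame_subset: "fam_frame F U J s \<Longrightarrow> open T \<Longrightarrow> T \<subseteq> U \<Longrightarrow> fam_frame F T J s"
  by (auto simp: fam_frame_def)

lemma fam_frame_cong:
  assumes "fam_frame F U J s" "\<And>j x. j \<in> J \<Longrightarrow> x \<in> U \<Longrightarrow> s j x = t j x"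
  shows "fam_frame F U J t"
proof -
  have "(\<Sum>j\<in>J. c j *\<^sub>R s j x) = (\<Sum>j\<in>J. c j *\<^sub>R t j x)" if "x \<in> U" for c x
    using assms(2) that by simp
  then show ?thesis using assms(1) by (simp add: fam_frame_def indep_fam_def)
qed

lemma is_frame_iff: "is_frame F U \<Phi> \<longleftrightarrow> fam_frame F U \<Phi> (\<lambda>b. b)"
proof -
  have "inj_on (\<lambda>b. b x) \<Phi> \<and> independent ((\<lambda>b. b x) ` \<Phi>) \<and> span ((\<lambda>b. b x) ` \<Phi>) = F x \<longleftrightarrow>
    indep_fam \<Phi> (\<lambda>b. b x) \<and> F x = range (\<lambda>c. \<Sum>b\<in>\<Phi>. c b *\<^sub>R b x)" if "finite \<Phi>" for x
    using span_fam[OF that, of "\<lambda>b. b x"] indep_fam_iff[OF that, of "\<lambda>b. b x"] by auto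
  then show ?thesis unfolding is_frame_def fam_frame_def by blast
qed

lemma fam_frame_is_frame:
  assumes "fam_frame F U J s"
  shows "is_frame F U (s ` J)"
proof -
  have fJ: "finite J" and oU: "open U" using assms by (auto simp: fam_frame_def)
  have "inj_on (\<lambda>b. b x) (s ` J) \<and> independent ((\<lambda>b. b x) ` s ` J) \<and> span ((\<lambda>b. b x) ` s ` J) = F x"
    if "x \<in> U" for x
  proof -
    have i: "indep_fam J (\<lambda>j. s j x)" and F: "F x = range (\<lambda>c. \<Sum>j\<in>J. c j *\<^sub>R s j x)"
      using assms that by (auto simp: fam_frame_def)
    have "inj_on (\<lambda>j. s j x) J" "independent ((\<lambda>j. s j x) ` J)" using i fJ by (auto simp: indep_fam_iff)
    moreover have "(\<lambda>b. b x) ` s ` J = (\<lambda>j. s j x) ` J" by auto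
    ultimately show ?thesis using span_fam[OF fJ, of "\<lambda>j. s j x"] F by (auto simp: inj_on_def)
  qed
  then show ?thesis using fJ oU by (simp add: is_frame_def)
qed

lemma fam_frame_dim:
  assumes "fam_frame F U J s" "x \<in> U"
  shows "dim (F x) = card J"
proof -
  have i: "inj_on (\<lambda>j. s j x) J" "independent ((\<lambda>j. s j x) ` J)" and "finite J"
    and F: "F x = span ((\<lambda>j. s j x) ` J)"
    using assms indep_fam_iff[of J "\<lambda>j. s j x"] span_fam[of J "\<lambda>j. s j x"] by (auto simp: fam_frame_def)
  then show ?thesis by (simp add: dim_eq_card_independent card_image)
qed

section \<open>Coefficients in a frame\<close>

lemma coef_expand:
  assumes "is_frame F U \<Phi>" "x \<in> U" "v \<in> F x"
  shows "(\<Sum>b\<in>\<Phi>. coef \<Phi> x v b *\<^sub>R b x) = v"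
proof -
  have "(\<Sum>w\<in>(\<lambda>b. b x) ` \<Phi>. representation ((\<lambda>b. b x) ` \<Phi>) v w *\<^sub>R w) = v"
    by (rule sum_representation_eq) (use assms in \<open>auto simp: is_frame_def\<close>)
  then show ?thesis using assms by (simp add: is_frame_def sum.reindex coef_def)
qed

lemma frame_comb_in: "is_frame F U \<Phi> \<Longrightarrow> x \<in> U \<Longrightarrow> (\<Sum>b\<in>\<Phi>. c b *\<^sub>R b x) \<in> F x"
  by (auto simp: is_frame_iff fam_frame_def)

lemma coef_comb:
  assumes "is_frame F U \<Phi>" "x \<in> U" "b \<in> \<Phi>"
  shows "coef \<Phi> x (\<Sum>b\<in>\<Phi>. c b *\<^sub>R b x) b = c b"
proof -
  have "indep_fam \<Phi> (\<lambda>b. b x)" using assms by (auto simp: is_frame_iff fam_frame_def)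
  from indep_fam_unique[OF this coef_expand[OF assms(1,2) frame_comb_in[OF assms(1,2)]] assms(3)]
  show ?thesis .
qed

lemma coef_sum_scale:
  assumes "is_frame F U \<Phi>" "x \<in> U" "b \<in> \<Phi>" "\<And>j. j \<in> J \<Longrightarrow> v j \<in> F x"
  shows "coef \<Phi> x (\<Sum>j\<in>J. c j *\<^sub>R v j) b = (\<Sum>j\<in>J. c j * coef \<Phi> x (v j) b)"
proof -
  have "(\<Sum>j\<in>J. c j *\<^sub>R v j) = (\<Sum>j\<in>J. \<Sum>b\<in>\<Phi>. (c j * coef \<Phi> x (v j) b) *\<^sub>R b x)"
  proof (rule sum.cong[OF refl])
    fix j assume "j \<in> J"
    then have "v j = (\<Sum>b\<in>\<Phi>. coef \<Phi> x (v j) b *\<^sub>R b x)" using coef_expand[OF assms(1,2) assms(4)] by simp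
    then show "c j *\<^sub>R v j = (\<Sum>b\<in>\<Phi>. (c j * coef \<Phi> x (v j) b) *\<^sub>R b x)"
      by (metis (no_types, lifting) scaleR_scaleR scaleR_sum_right sum.cong)
  qed
  also have "\<dots> = (\<Sum>b\<in>\<Phi>. (\<Sum>j\<in>J. c j * coef \<Phi> x (v j) b) *\<^sub>R b x)"
    by (subst sum.swap) (simp add: scaleR_sum_left)
  finally show ?thesis using coef_comb[OF assms(1-3)] by simp
qed

section \<open>Gram-Schmidt with smooth coefficients\<close>

text \<open>Linear independence of the rows \<open>a j\<close> of a real matrix with column set
  \<open>I\<close>; it stands in for a nonvanishing minor.\<close>

definition row_indep :: "'i set \<Rightarrow> 'j set \<Rightarrow> ('j \<Rightarrow> 'i \<Rightarrow> real) \<Rightarrow> bool"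
  where "row_indep I J a \<longleftrightarrow> (\<forall>c. (\<forall>i\<in>I. (\<Sum>j\<in>J. c j * a j i) = 0) \<longrightarrow> (\<forall>j\<in>J. c j = 0))"

lemma row_indepD:
  "row_indep I J a \<Longrightarrow> (\<And>i. i \<in> I \<Longrightarrow> (\<Sum>j\<in>J. c j * a j i) = 0) \<Longrightarrow> j \<in> J \<Longrightarrow> c j = 0"
  unfolding row_indep_def by blast

lemma row_indep_subset:
  assumes "row_indep I J a" "finite J" "K \<subseteq> J"
  shows "row_indep I K a"
  unfolding row_indep_def
proof (intro allI impI ballI)
  fix c k assume c: "\<forall>i\<in>I. (\<Sum>j\<in>K. c j * a j i) = 0" and k: "k \<in> K"
  have "(\<Sum>j\<in>J. (if j \<in> K then c j else 0) * a j i) = (\<Sum>j\<in>K. c j * a j i)" for i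
    using assms(2,3) by (intro sum.mono_neutral_cong_right) auto
  then have "(if k \<in> K then c k else 0) = 0"
    using row_indepD[OF assms(1), of "\<lambda>j. if j \<in> K then c j else 0" k] c k assms(3) by auto
  then show "c k = 0" using k by simp
qed

text \<open>A combination of rows in which row \<open>k\<close> has coefficient 1 cannot vanish. The
  squared norm considered here is the denominator in the divisions below.\<close>

lemma row_indep_residual:
  assumes "row_indep I (insert k J) a" "finite J" "k \<notin> J" "finite I"
  shows "(\<Sum>i\<in>I. (a k i - (\<Sum>j\<in>J. q j * a j i)) * (a k i - (\<Sum>j\<in>J. q j * a j i))) \<noteq> 0"
proof
  assume "(\<Sum>i\<in>I. (a k i - (\<Sum>j\<in>J. q j * a j i)) * (a k i - (\<Sum>j\<in>J. q j * a j i))) = 0"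
  then have 0: "a k i - (\<Sum>j\<in>J. q j * a j i) = 0" if "i \<in> I" for i
    using assms(4) that by (subst (asm) sum_nonneg_eq_0_iff) auto
  have "(\<Sum>j\<in>insert k J. (if j = k then 1 else - q j) * a j i) = 0" if "i \<in> I" for i
  proof -
    have "(\<Sum>j\<in>J. (if j = k then 1 else - q j) * a j i) = (\<Sum>j\<in>J. - (q j * a j i))"
      using assms(3) by (intro sum.cong) auto
    then show ?thesis using 0[OF that] assms(2,3) by (simp add: sum_negf)
  qed
  from row_indepD[OF assms(1) this, of k] show False by simp
qed

text \<open>Row \<open>k\<close> differs from the residual \<open>n\<close> by a combination of the
  rows in \<open>J\<close>, and these are orthogonal to \<open>n\<close>.\<close>

lemma residual_inner:
  fixes a :: "'j \<Rightarrow> 'i \<Rightarrow> real"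
  assumes "\<And>j. j \<in> J \<Longrightarrow> (\<Sum>i\<in>I. n i * a j i) = 0" "\<And>i. n i = a k i - (\<Sum>j\<in>J. q j * a j i)"
  shows "(\<Sum>i\<in>I. n i * a k i) = (\<Sum>i\<in>I. n i * n i)"
proof -
  have ak: "a k i = n i + (\<Sum>j\<in>J. q j * a j i)" for i by (simp add: assms(2))
  have "(\<Sum>i\<in>I. n i * a k i) = (\<Sum>i\<in>I. n i * n i) + (\<Sum>i\<in>I. \<Sum>j\<in>J. q j * (n i * a j i))"
    by (subst ak) (simp add: distrib_left sum.distrib sum_distrib_left ac_simps)
  also have "(\<Sum>i\<in>I. \<Sum>j\<in>J. q j * (n i * a j i)) = (\<Sum>j\<in>J. q j * (\<Sum>i\<in>I. n i * a j i))"
    by (subst sum.swap) (simp add: sum_distrib_left)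
  finally show ?thesis using assms(1) by simp
qed

context smooth_manifold
begin

text \<open>Induction on the rows: both the new row \<open>a k\<close> and \<open>r\<close> are made
  orthogonal to the old rows, which is why \<open>r\<close> is kept arbitrary, leaving residuals
  \<open>n\<close> and \<open>e\<close>; then \<open>e\<close> is made orthogonal to
  \<open>n\<close> alone. Division by the squared norm of \<open>n\<close>, nonzero on all of
  \<open>U\<close>, keeps the coefficients smooth there.\<close>

lemma gram_schmidt:
  assumes "open U" "finite I" "finite J"
    and "\<And>i j. i \<in> I \<Longrightarrow> j \<in> J \<Longrightarrow> smooth_fun_on A U (a j i)"
    and "\<And>x. x \<in> U \<Longrightarrow> row_indep I J (\<lambda>j i. a j i x)"
    and "\<And>i. i \<in> I \<Longrightarrow> smooth_fun_on A U (r i)"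
  shows "\<exists>q. (\<forall>j\<in>J. smooth_fun_on A U (q j)) \<and> (\<forall>x\<in>U. \<forall>k\<in>J.
    (\<Sum>i\<in>I. (r i x - (\<Sum>j\<in>J. q j x * a j i x)) * a k i x) = 0)"
  using assms(3-6)
proof (induction J arbitrary: r rule: finite_induct)
  case (insert k J)
  have ri: "row_indep I J (\<lambda>j i. a j i x)" if "x \<in> U" for x
    by (rule row_indep_subset[OF insert.prems(2)[OF that]]) (use insert in auto)
  obtain q where q: "\<forall>j\<in>J. smooth_fun_on A U (q j)"
    "\<forall>x\<in>U. \<forall>l\<in>J. (\<Sum>i\<in>I. (a k i x - (\<Sum>j\<in>J. q j x * a j i x)) * a l i x) = 0"
    using insert.IH[OF _ ri, of "a k"] insert.prems(1) by auto
  obtain q' where q': "\<forall>j\<in>J. smooth_fun_on A U (q' j)"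
    "\<forall>x\<in>U. \<forall>l\<in>J. (\<Sum>i\<in>I. (r i x - (\<Sum>j\<in>J. q' j x * a j i x)) * a l i x) = 0"
    using insert.IH[OF _ ri, of r] insert.prems(1,3) by auto
  define n where "n i x = a k i x - (\<Sum>j\<in>J. q j x * a j i x)" for i x
  define e where "e i x = r i x - (\<Sum>j\<in>J. q' j x * a j i x)" for i x
  define N where "N x = (\<Sum>i\<in>I. n i x * n i x)" for x
  define t where "t x = (\<Sum>i\<in>I. e i x * n i x) / N x" for x
  have N0: "N x \<noteq> 0" if "x \<in> U" for x
    using row_indep_residual[OF insert.prems(2)[OF that] insert.hyps assms(2)] by (simp add: N_def n_def)
  have sn: "smooth_fun_on A U (n i)" if "i \<in> I" for i
    unfolding n_def[abs_def]
    by (rule smooth_fun_diff[OF assms(1)], use insert.prems(1) that in blast,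
        rule smooth_fun_sum[OF assms(1)], rule smooth_fun_mult[OF assms(1)])
       (use q(1) insert.prems(1) that in blast)+
  have se: "smooth_fun_on A U (e i)" if "i \<in> I" for i
    unfolding e_def[abs_def]
    by (rule smooth_fun_diff[OF assms(1)], use insert.prems(3) that in blast,
        rule smooth_fun_sum[OF assms(1)], rule smooth_fun_mult[OF assms(1)])
       (use q'(1) insert.prems(1) that in blast)+
  have "smooth_fun_on A U N"
    unfolding N_def[abs_def]
    by (rule smooth_fun_sum[OF assms(1)], rule smooth_fun_mult[OF assms(1)]) (use sn in blast)+
  moreover have "smooth_fun_on A U (\<lambda>x. \<Sum>i\<in>I. e i x * n i x)"
    by (rule smooth_fun_sum[OF assms(1)], rule smooth_fun_mult[OF assms(1)]) (use sn se in blast)+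
  ultimately have st: "smooth_fun_on A U t"
    unfolding t_def[abs_def] using N0 by (intro smooth_fun_divide[OF assms(1)])
  \<comment> \<open>Since \<open>n\<close> is \<open>a k\<close> minus a combination of old rows,
    subtracting \<open>t\<close> times \<open>n\<close> adds \<open>t x * q j x\<close> times each
    old row back; the coefficients \<open>q'\<close> are corrected for that.\<close>
  define Q where "Q j x = (if j = k then t x else q' j x - t x * q j x)" for j x
  have "smooth_fun_on A U (Q j)" if "j \<in> insert k J" for j
  proof (cases "j = k")
    case True
    then have "Q j = t" by (simp add: Q_def fun_eq_iff)
    then show ?thesis using st by simp
  next
    case False
    then have "Q j = (\<lambda>x. q' j x - t x * q j x)" by (simp add: Q_def fun_eq_iff)
    moreover have "smooth_fun_on A U (\<lambda>x. q' j x - t x * q j x)"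
      using q(1) q'(1) that False st by (intro smooth_fun_diff[OF assms(1)] smooth_fun_mult[OF assms(1)]) auto
    ultimately show ?thesis by simp
  qed
  moreover have "(\<Sum>i\<in>I. (r i x - (\<Sum>j\<in>insert k J. Q j x * a j i x)) * a l i x) = 0"
    if x: "x \<in> U" and l: "l \<in> insert k J" for x l
  proof -
    have res: "r i x - (\<Sum>j\<in>insert k J. Q j x * a j i x) = e i x - t x * n i x" for i
    proof -
      have "(\<Sum>j\<in>J. Q j x * a j i x) = (\<Sum>j\<in>J. q' j x * a j i x - t x * (q j x * a j i x))"
        by (rule sum.cong) (use insert.hyps in \<open>auto simp: Q_def algebra_simps\<close>)
      then show ?thesis using insert.hyps
        by (simp add: e_def n_def Q_def sum_subtractf sum_distrib_left algebra_simps)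
    qed
    have J0: "(\<Sum>i\<in>I. (e i x - t x * n i x) * a j i x) = 0" if "j \<in> J" for j
    proof -
      have "(\<Sum>i\<in>I. (e i x - t x * n i x) * a j i x) =
          (\<Sum>i\<in>I. e i x * a j i x) - t x * (\<Sum>i\<in>I. n i x * a j i x)"
        by (simp add: left_diff_distrib sum_subtractf sum_distrib_left mult.assoc)
      then show ?thesis using q(2) q'(2) x that by (simp add: e_def n_def)
    qed
    have "(\<Sum>i\<in>I. (e i x - t x * n i x) * a k i x) = 0"
    proof -
      have ak: "a k i x = n i x + (\<Sum>j\<in>J. q j x * a j i x)" for i by (simp add: n_def)
      have "(\<Sum>i\<in>I. (e i x - t x * n i x) * a k i x) = (\<Sum>i\<in>I. (e i x - t x * n i x) * n i x) +
          (\<Sum>i\<in>I. \<Sum>j\<in>J. q j x * ((e i x - t x * n i x) * a j i x))"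
        by (subst ak) (simp add: distrib_left sum.distrib sum_distrib_left ac_simps)
      also have "(\<Sum>i\<in>I. \<Sum>j\<in>J. q j x * ((e i x - t x * n i x) * a j i x)) =
          (\<Sum>j\<in>J. q j x * (\<Sum>i\<in>I. (e i x - t x * n i x) * a j i x))"
        by (subst sum.swap) (simp add: sum_distrib_left)
      also have "\<dots> = 0" using J0 by simp
      also have "(\<Sum>i\<in>I. (e i x - t x * n i x) * n i x) = (\<Sum>i\<in>I. e i x * n i x) - t x * N x"
        by (simp add: N_def left_diff_distrib sum_subtractf sum_distrib_left mult.assoc)
      also have "\<dots> = 0" using N0[OF x] by (simp add: t_def)
      finally show ?thesis by simp
    qed
    then show ?thesis using l J0 by (auto simp: res)
  qed
  ultimately show ?case by blast
qed simp

text \<open>Row \<open>k\<close> of the inverse is a dual vector: the part \<open>n\<close> of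
  \<open>a k\<close> orthogonal to the other rows, divided by its squared norm. Pairing with it
  gives 0 on the other rows and 1 on row \<open>k\<close>.\<close>

lemma left_inverse:
  assumes "open U" "finite I" "finite J"
    and "\<And>i j. i \<in> I \<Longrightarrow> j \<in> J \<Longrightarrow> smooth_fun_on A U (a j i)"
    and "\<And>x. x \<in> U \<Longrightarrow> row_indep I J (\<lambda>j i. a j i x)"
  shows "\<exists>m. (\<forall>k\<in>J. \<forall>i\<in>I. smooth_fun_on A U (m k i)) \<and> (\<forall>x\<in>U. \<forall>c. \<forall>k\<in>J.
    (\<Sum>i\<in>I. m k i x * (\<Sum>j\<in>J. c j * a j i x)) = c k)"
proof -
  have "\<exists>m. (\<forall>i\<in>I. smooth_fun_on A U (m i)) \<and>
      (\<forall>x\<in>U. \<forall>c. (\<Sum>i\<in>I. m i x * (\<Sum>j\<in>J. c j * a j i x)) = c k)" if k: "k \<in> J" for k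
  proof -
    define J' where "J' = J - {k}"
    have J': "finite J'" "k \<notin> J'" "J = insert k J'" using k assms(3) by (auto simp: J'_def)
    have ri: "row_indep I J' (\<lambda>j i. a j i x)" if "x \<in> U" for x
      by (rule row_indep_subset[OF assms(5)[OF that] assms(3)]) (use J' in auto)
    obtain q where q: "\<forall>j\<in>J'. smooth_fun_on A U (q j)"
      "\<forall>x\<in>U. \<forall>l\<in>J'. (\<Sum>i\<in>I. (a k i x - (\<Sum>j\<in>J'. q j x * a j i x)) * a l i x) = 0"
      using gram_schmidt[OF assms(1,2) J'(1), where a = a and r = "a k"] ri assms(4) J'(3) by auto
    define n where "n i x = a k i x - (\<Sum>j\<in>J'. q j x * a j i x)" for i x
    define N where "N x = (\<Sum>i\<in>I. n i x * n i x)" for x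
    have N0: "N x \<noteq> 0" if "x \<in> U" for x
      using row_indep_residual[OF assms(5)[OF that, unfolded J'(3)] J'(1,2) assms(2)] by (simp add: N_def n_def)
    have sn: "smooth_fun_on A U (n i)" if "i \<in> I" for i
      unfolding n_def[abs_def]
      by (rule smooth_fun_diff[OF assms(1)], use assms(4) k that in blast,
          rule smooth_fun_sum[OF assms(1)], rule smooth_fun_mult[OF assms(1)])
         (use q(1) assms(4) J'(3) that in blast)+
    have "smooth_fun_on A U N"
      unfolding N_def[abs_def]
      by (rule smooth_fun_sum[OF assms(1)], rule smooth_fun_mult[OF assms(1)]) (use sn in blast)+
    then have "smooth_fun_on A U (\<lambda>x. n i x / N x)" if "i \<in> I" for i
      using N0 sn[OF that] by (intro smooth_fun_divide[OF assms(1)])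
    moreover have "(\<Sum>i\<in>I. n i x / N x * (\<Sum>j\<in>J. c j * a j i x)) = c k" if x: "x \<in> U" for x c
    proof -
      have 0: "(\<Sum>i\<in>I. n i x * a j i x) = 0" if "j \<in> J'" for j
        using q(2) x that by (simp add: n_def)
      have 1: "(\<Sum>i\<in>I. n i x * a k i x) = N x"
        unfolding N_def by (rule residual_inner[OF 0]) (simp_all add: n_def)
      have "(\<Sum>i\<in>I. n i x / N x * (\<Sum>j\<in>J. c j * a j i x)) =
          (\<Sum>i\<in>I. \<Sum>j\<in>J. c j / N x * (n i x * a j i x))"
        by (simp add: sum_distrib_left ac_simps)
      also have "\<dots> = (\<Sum>j\<in>J. c j / N x * (\<Sum>i\<in>I. n i x * a j i x))"
        by (subst sum.swap) (simp add: sum_distrib_left)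
      also have "\<dots> = c k" using J' 0 1 N0[OF x] by simp
      finally show ?thesis .
    qed
    ultimately show ?thesis by (intro exI[of _ "\<lambda>i x. n i x / N x"]) blast
  qed
  then have "\<forall>k\<in>J. \<exists>m. (\<forall>i\<in>I. smooth_fun_on A U (m i)) \<and>
      (\<forall>x\<in>U. \<forall>c. (\<Sum>i\<in>I. m i x * (\<Sum>j\<in>J. c j * a j i x)) = c k)" by blast
  from bchoice[OF this] show ?thesis by blast
qed

text \<open>Rows are added one at a time. Where the old rows are independent, the new one is
  independent of them as long as its Gram-Schmidt residual is nonzero, and the squared norm of the
  residual is continuous.\<close>

lemma row_indep_open:
  assumes "open U" "p \<in> U" "finite I" "finite J"
    and "\<And>i j. i \<in> I \<Longrightarrow> j \<in> J \<Longrightarrow> smooth_fun_on A U (a j i)"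
    and "row_indep I J (\<lambda>j i. a j i p)"
  shows "\<exists>T. open T \<and> p \<in> T \<and> T \<subseteq> U \<and> (\<forall>x\<in>T. row_indep I J (\<lambda>j i. a j i x))"
  using assms(4-6)
proof (induction J rule: finite_induct)
  case empty
  then show ?case using assms(1,2) by (auto simp: row_indep_def)
next
  case (insert k J)
  have "row_indep I J (\<lambda>j i. a j i p)"
    by (rule row_indep_subset[OF insert.prems(2)]) (use insert in auto)
  then obtain T where T: "open T" "p \<in> T" "T \<subseteq> U" "\<And>x. x \<in> T \<Longrightarrow> row_indep I J (\<lambda>j i. a j i x)"
    using insert.IH insert.prems(1) by auto
  have sa: "smooth_fun_on A T (a j i)" if "i \<in> I" "j \<in> insert k J" for i j
    by (rule smooth_fun_subset[OF insert.prems(1)[OF that] T(3)])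
  obtain q where q: "\<forall>j\<in>J. smooth_fun_on A T (q j)"
    "\<forall>x\<in>T. \<forall>l\<in>J. (\<Sum>i\<in>I. (a k i x - (\<Sum>j\<in>J. q j x * a j i x)) * a l i x) = 0"
    using gram_schmidt[OF T(1) assms(3) insert.hyps(1), where a = a and r = "a k"] T(4) sa by auto
  define n where "n i x = a k i x - (\<Sum>j\<in>J. q j x * a j i x)" for i x
  define N where "N x = (\<Sum>i\<in>I. n i x * n i x)" for x
  have sn: "smooth_fun_on A T (n i)" if "i \<in> I" for i
    unfolding n_def[abs_def]
    by (rule smooth_fun_diff[OF T(1)], use sa that in blast,
        rule smooth_fun_sum[OF T(1)], rule smooth_fun_mult[OF T(1)])
       (use q(1) sa that in blast)+
  have "smooth_fun_on A T N"
    unfolding N_def[abs_def]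
    by (rule smooth_fun_sum[OF T(1)], rule smooth_fun_mult[OF T(1)]) (use sn in blast)+
  then have "continuous_on T N" by (rule smooth_fun_continuous[OF T(1)])
  then have oT': "open {x \<in> T. N x \<in> - {0}}"
    using continuous_open_preimage[OF _ T(1) open_delete[OF open_UNIV], of N 0]
    by (simp add: vimage_def Int_def)
  have Np: "N p \<noteq> 0"
    using row_indep_residual[OF insert.prems(2) insert.hyps assms(3)] by (simp add: N_def n_def)
  have "row_indep I (insert k J) (\<lambda>j i. a j i x)" if x: "x \<in> T" "N x \<noteq> 0" for x
    unfolding row_indep_def
  proof (intro allI impI ballI)
    fix c l assume c: "\<forall>i\<in>I. (\<Sum>j\<in>insert k J. c j * a j i x) = 0" and l: "l \<in> insert k J"
    have 0: "(\<Sum>i\<in>I. n i x * a j i x) = 0" if "j \<in> J" for j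
      using q(2) x that by (simp add: n_def)
    have 1: "(\<Sum>i\<in>I. n i x * a k i x) = N x"
      unfolding N_def by (rule residual_inner[OF 0]) (simp_all add: n_def)
    \<comment> \<open>Pairing the relation with the residual \<open>n\<close> removes every row
      except \<open>k\<close>.\<close>
    have "0 = (\<Sum>i\<in>I. n i x * (\<Sum>j\<in>insert k J. c j * a j i x))" using c by simp
    also have "\<dots> = (\<Sum>i\<in>I. \<Sum>j\<in>insert k J. c j * (n i x * a j i x))"
      by (simp only: sum_distrib_left ac_simps)
    also have "\<dots> = (\<Sum>j\<in>insert k J. c j * (\<Sum>i\<in>I. n i x * a j i x))"
      by (subst sum.swap) (simp only: sum_distrib_left)
    also have "\<dots> = c k * N x" using insert.hyps 0 1 by simp
    finally have ck: "c k = 0" using x(2) by simp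
    have "(\<Sum>j\<in>J. c j * a j i x) = 0" if "i \<in> I" for i
      using c that insert.hyps ck by simp
    then have "c j = 0" if "j \<in> J" for j using row_indepD[OF T(4)[OF x(1)] _ that] by blast
    then show "c l = 0" using l ck by auto
  qed
  then show ?case using oT' T(2,3) Np by (intro exI[of _ "{x \<in> T. N x \<in> - {0}}"]) auto
qed

end

section \<open>Smooth sections of vector bundles\<close>

context smooth_manifold
begin

text \<open>\<open>l i x\<close> are coordinates on a fibre, only required to be linear and jointly injective on the span
  of the family \<open>s\<close>.\<close>

lemma coordinates_row_indep:
  assumes lin: "\<And>i c. i \<in> I \<Longrightarrow> l i (\<Sum>j\<in>J. c j *\<^sub>R s j) = (\<Sum>j\<in>J. c j * l i (s j))"
    and inj: "\<And>c. (\<And>i. i \<in> I \<Longrightarrow> l i (\<Sum>j\<in>J. c j *\<^sub>R s j) = 0) \<Longrightarrow> (\<Sum>j\<in>J. c j *\<^sub>R s j) = 0"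
    and indep: "indep_fam J s"
  shows "row_indep I J (\<lambda>j i. l i (s j))"
  unfolding row_indep_def
proof (intro allI impI ballI)
  fix c j assume "\<forall>i\<in>I. (\<Sum>j\<in>J. c j * l i (s j)) = 0" and j: "j \<in> J"
  then have "(\<Sum>j\<in>J. c j *\<^sub>R s j) = 0" by (intro inj) (simp add: lin)
  then show "c j = 0" by (rule indep_famD[OF indep _ j])
qed

text \<open>The coordinates stay abstract because the lemma serves twice: with the frame
  coefficients of a bundle, and with \<open>jet_coord\<close> at a stage where the jets are not yet
  known to form a vector bundle.\<close>

lemma coordinates_left_inverse:
  assumes "open U" "finite I" "finite J"
    and lin: "\<And>x i c. x \<in> U \<Longrightarrow> i \<in> I \<Longrightarrow> l i x (\<Sum>j\<in>J. c j *\<^sub>R s j x) = (\<Sum>j\<in>J. c j * l i x (s j x))"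
    and inj: "\<And>x c. x \<in> U \<Longrightarrow> (\<And>i. i \<in> I \<Longrightarrow> l i x (\<Sum>j\<in>J. c j *\<^sub>R s j x) = 0) \<Longrightarrow> (\<Sum>j\<in>J. c j *\<^sub>R s j x) = 0"
    and indep: "\<And>x. x \<in> U \<Longrightarrow> indep_fam J (\<lambda>j. s j x)"
    and smooth: "\<And>i j. i \<in> I \<Longrightarrow> j \<in> J \<Longrightarrow> smooth_fun_on A U (\<lambda>x. l i x (s j x))"
  obtains m where "\<And>k i. k \<in> J \<Longrightarrow> i \<in> I \<Longrightarrow> smooth_fun_on A U (m k i)"
    "\<And>x c k. x \<in> U \<Longrightarrow> k \<in> J \<Longrightarrow> (\<Sum>i\<in>I. m k i x * l i x (\<Sum>j\<in>J. c j *\<^sub>R s j x)) = c k"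
proof -
  have "row_indep I J (\<lambda>j i. l i x (s j x))" if "x \<in> U" for x
    by (rule coordinates_row_indep[OF lin[OF that] inj[OF that] indep[OF that]])
  from left_inverse[OF assms(1-3) smooth this]
  obtain m where m: "\<forall>k\<in>J. \<forall>i\<in>I. smooth_fun_on A U (m k i)"
    "\<forall>x\<in>U. \<forall>c. \<forall>k\<in>J. (\<Sum>i\<in>I. m k i x * (\<Sum>j\<in>J. c j * l i x (s j x))) = c k"
    by blast
  show ?thesis
  proof (rule that)
    fix x c k assume x: "x \<in> U" and k: "k \<in> J"
    have "(\<Sum>i\<in>I. m k i x * l i x (\<Sum>j\<in>J. c j *\<^sub>R s j x)) = (\<Sum>i\<in>I. m k i x * (\<Sum>j\<in>J. c j * l i x (s j x)))"
      by (rule sum.cong) (simp_all add: lin[OF x])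
    then show "(\<Sum>i\<in>I. m k i x * l i x (\<Sum>j\<in>J. c j *\<^sub>R s j x)) = c k" using m(2) x k by simp
  qed (use m(1) in blast)
qed

end

locale smooth_bundle = smooth_manifold A
  for A :: "('m::{t2_space,second_countable_topology}, 'e::real_inner) chart set" +
  fixes E :: "('m, 'v::real_vector, 'z) vbundle_scheme"
  assumes vb: "vector_bundle A E"
begin

lemma fib_subspace: "subspace (fib E x)"
  using vb by (simp add: vector_bundle_def)

lemma frame_around:
  obtains U \<Phi> where "(U, \<Phi>) \<in> frames E" "x \<in> U"
proof -
  have "x \<in> (\<Union>(U, \<Phi>)\<in>frames E. U)" using vb by (simp add: vector_bundle_def)
  then show ?thesis using that by auto
qed

lemma frame:
  assumes "(U, \<Phi>) \<in> frames E"
  shows frame_is_frame: "is_frame (fib E) U \<Phi>" and frame_open: "open U" and frame_finite: "finite \<Phi>"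
    and frame_smooth: "b \<in> \<Phi> \<Longrightarrow> smooth_section_on A E U b"
  using vb assms by (auto simp: vector_bundle_def is_frame_def)

lemma section_fib: "smooth_section_on A E U s \<Longrightarrow> x \<in> U \<Longrightarrow> s x \<in> fib E x"
  by (simp add: smooth_section_on_def)

lemma section_coef:
  "smooth_section_on A E U s \<Longrightarrow> (W, \<Phi>) \<in> frames E \<Longrightarrow> b \<in> \<Phi> \<Longrightarrow>
    smooth_fun_on A (U \<inter> W) (\<lambda>x. coef \<Phi> x (s x) b)"
  by (fastforce simp: smooth_section_on_def)

lemma sectionI:
  assumes "\<And>x. x \<in> U \<Longrightarrow> s x \<in> fib E x"
    "\<And>W \<Phi> b. (W, \<Phi>) \<in> frames E \<Longrightarrow> b \<in> \<Phi> \<Longrightarrow> smooth_fun_on A (U \<inter> W) (\<lambda>x. coef \<Phi> x (s x) b)"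
  shows "smooth_section_on A E U s"
  using assms by (auto simp: smooth_section_on_def)

lemma section_cong:
  assumes "open U" "smooth_section_on A E U s" "\<And>x. x \<in> U \<Longrightarrow> s x = t x"
  shows "smooth_section_on A E U t"
proof (rule sectionI)
  show "t x \<in> fib E x" if "x \<in> U" for x using section_fib[OF assms(2) that] assms(3)[OF that] by simp
  show "smooth_fun_on A (U \<inter> W) (\<lambda>x. coef \<Phi> x (t x) b)" if W: "(W, \<Phi>) \<in> frames E" "b \<in> \<Phi>" for W \<Phi> b
    by (rule smooth_fun_cong[OF _ section_coef[OF assms(2) W]])
       (use assms(1,3) frame_open[OF W(1)] in auto)
qed

lemma section_subset:
  assumes "smooth_section_on A E U s" "T \<subseteq> U"
  shows "smooth_section_on A E T s"
proof (rule sectionI)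
  show "smooth_fun_on A (T \<inter> W) (\<lambda>x. coef \<Phi> x (s x) b)" if W: "(W, \<Phi>) \<in> frames E" "b \<in> \<Phi>" for W \<Phi> b
    by (rule smooth_fun_subset[OF section_coef[OF assms(1) W]]) (use assms(2) in auto)
qed (use assms section_fib in blast)

lemma section_local:
  assumes "\<And>p. p \<in> U \<Longrightarrow> \<exists>T. open T \<and> p \<in> T \<and> smooth_section_on A E T s"
  shows "smooth_section_on A E U s"
proof (rule sectionI)
  show "s x \<in> fib E x" if "x \<in> U" for x using assms[OF that] section_fib by blast
  show "smooth_fun_on A (U \<inter> W) (\<lambda>x. coef \<Phi> x (s x) b)" if W: "(W, \<Phi>) \<in> frames E" "b \<in> \<Phi>" for W \<Phi> b
  proof (rule smooth_fun_local)
    fix p assume p: "p \<in> U \<inter> W"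
    then obtain T where T: "open T" "p \<in> T" "smooth_section_on A E T s" using assms by blast
    show "\<exists>T. open T \<and> p \<in> T \<and> smooth_fun_on A T (\<lambda>x. coef \<Phi> x (s x) b)"
      by (rule exI[of _ "T \<inter> W"])
         (use T p frame_open[OF W(1)] section_coef[OF T(3) W] in auto)
  qed
qed

lemma section_comb:
  assumes "open U" "finite J" "\<And>j. j \<in> J \<Longrightarrow> smooth_fun_on A U (f j)"
    "\<And>j. j \<in> J \<Longrightarrow> smooth_section_on A E U (s j)"
  shows "smooth_section_on A E U (\<lambda>x. \<Sum>j\<in>J. f j x *\<^sub>R s j x)"
proof (rule sectionI)
  show "(\<Sum>j\<in>J. f j x *\<^sub>R s j x) \<in> fib E x" if "x \<in> U" for x
    by (intro subspace_sum subspace_scale fib_subspace) (use assms(4) section_fib that in blast)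
  fix W \<Phi> b assume W: "(W, \<Phi>) \<in> frames E" "b \<in> \<Phi>"
  have o: "open (U \<inter> W)" using assms(1) frame_open[OF W(1)] by auto
  show "smooth_fun_on A (U \<inter> W) (\<lambda>x. coef \<Phi> x (\<Sum>j\<in>J. f j x *\<^sub>R s j x) b)"
  proof (rule smooth_fun_cong[OF o])
    show "smooth_fun_on A (U \<inter> W) (\<lambda>x. \<Sum>j\<in>J. f j x * coef \<Phi> x (s j x) b)"
      by (rule smooth_fun_sum[OF o], rule smooth_fun_mult[OF o])
         (use assms(3) smooth_fun_subset section_coef[OF assms(4) W] in blast)+
    show "(\<Sum>j\<in>J. f j x * coef \<Phi> x (s j x) b) = coef \<Phi> x (\<Sum>j\<in>J. f j x *\<^sub>R s j x) b" if "x \<in> U \<inter> W" for x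
      by (rule coef_sum_scale[OF frame_is_frame[OF W(1)] _ W(2), symmetric])
         (use that assms(4) section_fib in blast)+
  qed
qed

lemma section_scale:
  assumes "open U" "smooth_fun_on A U f" "smooth_section_on A E U s"
  shows "smooth_section_on A E U (\<lambda>x. f x *\<^sub>R s x)"
  using section_comb[of U "{()}" "\<lambda>_. f" "\<lambda>_. s"] assms by simp

lemma section_add:
  assumes "open U" "smooth_section_on A E U s" "smooth_section_on A E U t"
  shows "smooth_section_on A E U (\<lambda>x. s x + t x)"
proof -
  have "smooth_section_on A E U (\<lambda>x. \<Sum>b\<in>{True, False}. 1 *\<^sub>R (if b then s else t) x)"
    by (rule section_comb[OF assms(1)]) (use assms smooth_fun_const in auto)
  then show ?thesis by simp
qed

lemma section_diff:
  assumes "open U" "smooth_section_on A E U s" "smooth_section_on A E U t"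
  shows "smooth_section_on A E U (\<lambda>x. s x - t x)"
  using section_add[OF assms(1,2) section_scale[OF assms(1) smooth_fun_const[OF assms(1), of "-1"] assms(3)]]
  by simp

lemma frame_coordinates:
  assumes W: "(W, \<Psi>) \<in> frames E" and x: "x \<in> W" and s: "\<And>j. j \<in> J \<Longrightarrow> s j \<in> fib E x"
  shows "\<psi> \<in> \<Psi> \<Longrightarrow> coef \<Psi> x (\<Sum>j\<in>J. c j *\<^sub>R s j) \<psi> = (\<Sum>j\<in>J. c j * coef \<Psi> x (s j) \<psi>)"
    and "(\<And>\<psi>. \<psi> \<in> \<Psi> \<Longrightarrow> coef \<Psi> x (\<Sum>j\<in>J. c j *\<^sub>R s j) \<psi> = 0) \<Longrightarrow> (\<Sum>j\<in>J. c j *\<^sub>R s j) = 0"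
proof -
  show "\<psi> \<in> \<Psi> \<Longrightarrow> coef \<Psi> x (\<Sum>j\<in>J. c j *\<^sub>R s j) \<psi> = (\<Sum>j\<in>J. c j * coef \<Psi> x (s j) \<psi>)"
    by (rule coef_sum_scale[OF frame_is_frame[OF W] x _ s])
  have "(\<Sum>j\<in>J. c j *\<^sub>R s j) \<in> fib E x"
    by (intro subspace_sum subspace_scale fib_subspace s)
  from coef_expand[OF frame_is_frame[OF W] x this]
  show "(\<And>\<psi>. \<psi> \<in> \<Psi> \<Longrightarrow> coef \<Psi> x (\<Sum>j\<in>J. c j *\<^sub>R s j) \<psi> = 0) \<Longrightarrow> (\<Sum>j\<in>J. c j *\<^sub>R s j) = 0"
    by simp
qed

text \<open>The functions \<open>m\<close> invert the coefficient matrix of the family from the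
  left. They are chosen before any particular section is expanded, and so also provide the
  projection in \<open>intersection_frame\<close>.\<close>

lemma frame_left_inverse:
  assumes W: "(W, \<Psi>) \<in> frames E" and U: "open U" "finite J"
    and s: "\<And>j. j \<in> J \<Longrightarrow> smooth_section_on A E U (s j)"
    and indep: "\<And>x. x \<in> U \<Longrightarrow> indep_fam J (\<lambda>j. s j x)"
  shows "\<exists>m. (\<forall>k\<in>J. \<forall>\<psi>\<in>\<Psi>. smooth_fun_on A (U \<inter> W) (m k \<psi>)) \<and> (\<forall>x\<in>U \<inter> W. \<forall>c. \<forall>k\<in>J.
    (\<Sum>\<psi>\<in>\<Psi>. m k \<psi> x * coef \<Psi> x (\<Sum>j\<in>J. c j *\<^sub>R s j x) \<psi>) = c k)" (is "\<exists>m. ?P m")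
proof (rule coordinates_left_inverse[where U = "U \<inter> W" and I = \<Psi> and J = J and s = s and
      l = "\<lambda>\<psi> x v. coef \<Psi> x v \<psi>"])
  show "open (U \<inter> W)" "finite \<Psi>" "finite J" using U frame[OF W] by auto
  have f: "s j x \<in> fib E x" if "x \<in> U \<inter> W" "j \<in> J" for x j using s section_fib that by blast
  show "coef \<Psi> x (\<Sum>j\<in>J. c j *\<^sub>R s j x) i = (\<Sum>j\<in>J. c j * coef \<Psi> x (s j x) i)"
    if "x \<in> U \<inter> W" "i \<in> \<Psi>" for x i c
    by (rule frame_coordinates(1)[OF W]) (use that f in auto)
  show "(\<Sum>j\<in>J. c j *\<^sub>R s j x) = 0"
    if "x \<in> U \<inter> W" "\<And>i. i \<in> \<Psi> \<Longrightarrow> coef \<Psi> x (\<Sum>j\<in>J. c j *\<^sub>R s j x) i = 0" for x c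
    by (rule frame_coordinates(2)[OF W]) (use that f in auto)
  show "\<exists>m. ?P m" if "\<And>k i. k \<in> J \<Longrightarrow> i \<in> \<Psi> \<Longrightarrow> smooth_fun_on A (U \<inter> W) (m k i)"
    "\<And>x c k. x \<in> U \<inter> W \<Longrightarrow> k \<in> J \<Longrightarrow> (\<Sum>i\<in>\<Psi>. m k i x * coef \<Psi> x (\<Sum>j\<in>J. c j *\<^sub>R s j x) i) = c k" for m
    using that by blast
qed (use indep section_coef[OF s W] in auto)

text \<open>The left inverse computes each \<open>c k\<close> from the frame coefficients of
  \<open>t\<close>. The family may span only part of the fibre, so this is what makes smoothness
  inside a subbundle agree with smoothness in the ambient bundle.\<close>

lemma smooth_coefficients:
  assumes U: "open U" "finite J"
    and s: "\<And>j. j \<in> J \<Longrightarrow> smooth_section_on A E U (s j)"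
    and indep: "\<And>x. x \<in> U \<Longrightarrow> indep_fam J (\<lambda>j. s j x)"
    and t: "smooth_section_on A E U t" "\<And>x. x \<in> U \<Longrightarrow> t x = (\<Sum>j\<in>J. c j x *\<^sub>R s j x)"
    and k: "k \<in> J"
  shows "smooth_fun_on A U (c k)"
proof (rule smooth_fun_local)
  fix p assume p: "p \<in> U"
  obtain W \<Psi> where W: "(W, \<Psi>) \<in> frames E" "p \<in> W" by (rule frame_around)
  obtain m where m: "\<forall>k\<in>J. \<forall>\<psi>\<in>\<Psi>. smooth_fun_on A (U \<inter> W) (m k \<psi>)"
    "\<forall>x\<in>U \<inter> W. \<forall>c. \<forall>k\<in>J. (\<Sum>\<psi>\<in>\<Psi>. m k \<psi> x * coef \<Psi> x (\<Sum>j\<in>J. c j *\<^sub>R s j x) \<psi>) = c k"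
    using frame_left_inverse[where s = s, OF W(1) U s indep] by blast
  have o: "open (U \<inter> W)" using U frame_open[OF W(1)] by auto
  have "smooth_fun_on A (U \<inter> W) (c k)"
  proof (rule smooth_fun_cong[OF o])
    show "smooth_fun_on A (U \<inter> W) (\<lambda>x. \<Sum>\<psi>\<in>\<Psi>. m k \<psi> x * coef \<Psi> x (t x) \<psi>)"
      by (rule smooth_fun_sum[OF o], rule smooth_fun_mult[OF o])
         (use m(1) k section_coef[OF t(1) W(1)] in auto)
    show "(\<Sum>\<psi>\<in>\<Psi>. m k \<psi> x * coef \<Psi> x (t x) \<psi>) = c k x" if "x \<in> U \<inter> W" for x
      using m(2)[rule_format, OF that k, of "\<lambda>j. c j x"] t(2) that by simp
  qed
  then show "\<exists>T. open T \<and> p \<in> T \<and> smooth_fun_on A T (c k)" using o p W(2) by blast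
qed

lemma fam_frame_coefficients:
  assumes F: "fam_frame F U J s" and s: "\<And>j. j \<in> J \<Longrightarrow> smooth_section_on A E U (s j)"
    and t: "smooth_section_on A E T t" "\<And>x. x \<in> T \<Longrightarrow> t x \<in> F x" and T: "open T" "T \<subseteq> U"
  obtains c where "\<And>j. j \<in> J \<Longrightarrow> smooth_fun_on A T (c j)"
    "\<And>x. x \<in> T \<Longrightarrow> t x = (\<Sum>j\<in>J. c j x *\<^sub>R s j x)"
proof -
  have "\<exists>c. t x = (\<Sum>j\<in>J. c j *\<^sub>R s j x)" if "x \<in> T" for x
  proof -
    have "F x = range (\<lambda>c. \<Sum>j\<in>J. c j *\<^sub>R s j x)" using F that T(2) by (auto simp: fam_frame_def)
    then show ?thesis using t(2)[OF that] by blast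
  qed
  then obtain c where c: "\<And>x. x \<in> T \<Longrightarrow> t x = (\<Sum>j\<in>J. c x j *\<^sub>R s j x)" by metis
  have "smooth_fun_on A T (\<lambda>x. c x j)" if "j \<in> J" for j
    by (rule smooth_coefficients[where c = "\<lambda>j x. c x j" and s = s, OF T(1) _ _ _ t(1) c that])
       (use F T section_subset[OF s] in \<open>auto simp: fam_frame_def\<close>)
  then show ?thesis using c that[of "\<lambda>j x. c x j"] by simp
qed

lemma indep_fam_open:
  assumes U: "open U" "p \<in> U" "finite J"
    and s: "\<And>j. j \<in> J \<Longrightarrow> smooth_section_on A E U (s j)"
    and indep: "indep_fam J (\<lambda>j. s j p)"
  obtains T where "open T" "p \<in> T" "T \<subseteq> U" "\<And>x. x \<in> T \<Longrightarrow> indep_fam J (\<lambda>j. s j x)"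
proof -
  obtain W \<Psi> where W: "(W, \<Psi>) \<in> frames E" "p \<in> W" by (rule frame_around)
  have o: "open (U \<inter> W)" using U frame_open[OF W(1)] by auto
  have f: "s j x \<in> fib E x" if "x \<in> U \<inter> W" "j \<in> J" for x j using s section_fib that by blast
  have "row_indep \<Psi> J (\<lambda>j \<psi>. coef \<Psi> p (s j p) \<psi>)"
    by (rule coordinates_row_indep[where l = "\<lambda>\<psi> v. coef \<Psi> p v \<psi>" and s = "\<lambda>j. s j p", OF _ _ indep])
       (use frame_coordinates[OF W, of J "\<lambda>j. s j p"] f U(2) W(2) in auto)
  then have "\<exists>T. open T \<and> p \<in> T \<and> T \<subseteq> U \<inter> W \<and> (\<forall>x\<in>T. row_indep \<Psi> J (\<lambda>j \<psi>. coef \<Psi> x (s j x) \<psi>))"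
    by (intro row_indep_open[OF o _ frame_finite[OF W(1)] U(3)] section_coef[OF s W(1)])
       (use U(2) W(2) in auto)
  then obtain T where T: "open T" "p \<in> T" "T \<subseteq> U \<inter> W"
    "\<forall>x\<in>T. row_indep \<Psi> J (\<lambda>j \<psi>. coef \<Psi> x (s j x) \<psi>)"
    by blast
  have "indep_fam J (\<lambda>j. s j x)" if x: "x \<in> T" for x
    unfolding indep_fam_def
  proof (intro allI impI ballI)
    fix c j assume c: "(\<Sum>j\<in>J. c j *\<^sub>R s j x) = 0" and j: "j \<in> J"
    have xW: "x \<in> W" "x \<in> U \<inter> W" using x T(3) by auto
    have "(\<Sum>j\<in>J. c j * coef \<Psi> x (s j x) \<psi>) = 0" if "\<psi> \<in> \<Psi>" for \<psi>
    proof -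
      have "(\<Sum>j\<in>J. c j * coef \<Psi> x (s j x) \<psi>) = coef \<Psi> x (\<Sum>j\<in>J. c j *\<^sub>R s j x) \<psi>"
        by (rule frame_coordinates(1)[OF W(1) xW(1) f[OF xW(2)] that, symmetric])
      \<comment> \<open>The zero vector is written as an empty combination so that
        \<open>frame_coordinates\<close> yields its coefficients.\<close>
      also have "\<dots> = coef \<Psi> x (\<Sum>j\<in>{}. 0 *\<^sub>R s j x) \<psi>" by (simp add: c)
      also have "\<dots> = 0"
        using frame_coordinates(1)[OF W(1) xW(1) _ that, of "{}"] by simp
      finally show ?thesis .
    qed
    then show "c j = 0" using row_indepD[OF T(4)[rule_format, OF x] _ j] by blast
  qed
  then show ?thesis using that[of T] T by auto
qed

lemma fib_finite_span: "\<exists>T. finite T \<and> fib E x \<subseteq> span T"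
proof -
  obtain W \<Psi> where W: "(W, \<Psi>) \<in> frames E" "x \<in> W" by (rule frame_around)
  show ?thesis
    using frame_is_frame[OF W(1)] W(2) by (intro exI[of _ "(\<lambda>b. b x) ` \<Psi>"]) (auto simp: is_frame_def)
qed

text \<open>Sections whose values form a basis of \<open>F p\<close> stay independent near
  \<open>p\<close>; being as many as the constant rank, they then also span \<open>F x\<close>.
  Generation at the single point \<open>p\<close> is therefore enough.\<close>

lemma constant_rank_frame:
  assumes F: "\<And>x. subspace (F x)" "\<And>x. F x \<subseteq> fib E x" "constant_rank F"
    and U: "open U" "p \<in> U" "finite J"
    and s: "\<And>j. j \<in> J \<Longrightarrow> smooth_section_on A E U (s j)" "\<And>j x. j \<in> J \<Longrightarrow> x \<in> U \<Longrightarrow> s j x \<in> F x"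
    and gen: "F p \<subseteq> span ((\<lambda>j. s j p) ` J)"
  obtains T K where "open T" "p \<in> T" "T \<subseteq> U" "K \<subseteq> J" "fam_frame F T K s"
proof -
  obtain B where B: "B \<subseteq> (\<lambda>j. s j p) ` J" "independent B" "(\<lambda>j. s j p) ` J \<subseteq> span B"
    using maximal_independent_subset by metis
  obtain K where K: "K \<subseteq> J" "inj_on (\<lambda>j. s j p) K" "B = (\<lambda>j. s j p) ` K"
    using B(1) by (auto simp: subset_image_inj)
  have fK: "finite K" using K(1) U(3) finite_subset by blast
  have ip: "indep_fam K (\<lambda>j. s j p)" using indep_fam_iff[OF fK] K B(2) by auto
  have "F p = span B"
  proof
    show "F p \<subseteq> span B" using gen B(3) by (metis span_mono span_span subset_trans)
    show "span B \<subseteq> F p" using B(1) s(2) U(2) by (intro span_minimal F(1)) auto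
  qed
  then have "card K = dim (F p)" using B(2) K by (simp add: dim_eq_card_independent card_image)
  then have dim: "dim (F x) = card K" for x using F(3) unfolding constant_rank_def by metis
  obtain T where T: "open T" "p \<in> T" "T \<subseteq> U" "\<And>x. x \<in> T \<Longrightarrow> indep_fam K (\<lambda>j. s j x)"
    using indep_fam_open[where s = s, OF U(1,2) fK _ ip] s(1) K(1) by blast
  have "F x = range (\<lambda>c. \<Sum>j\<in>K. c j *\<^sub>R s j x)" if x: "x \<in> T" for x
  proof -
    have i: "inj_on (\<lambda>j. s j x) K" "independent ((\<lambda>j. s j x) ` K)"
      using T(4)[OF x] indep_fam_iff[OF fK] by auto
    obtain G where G: "finite G" "fib E x \<subseteq> span G" using fib_finite_span by blast
    have "span ((\<lambda>j. s j x) ` K) = F x"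
    proof (rule span_independent_eq[OF i(2) _ F(1) _ G(1)])
      show "(\<lambda>j. s j x) ` K \<subseteq> F x" using s(2) K(1) x T(3) by auto
      show "card ((\<lambda>j. s j x) ` K) = dim (F x)" using dim i(1) by (simp add: card_image)
    qed (use F(2) G(2) fK in auto)
    then show ?thesis using span_fam[OF fK i(1)] by simp
  qed
  then show ?thesis using that[of T K] T K(1) fK by (simp add: fam_frame_def)
qed

lemma cutoff_section:
  assumes "smooth_fun_on A UNIV \<rho>" "open U" "closed K" "K \<subseteq> U" "\<And>x. x \<notin> K \<Longrightarrow> \<rho> x = 0"
    "smooth_section_on A E U s"
  shows "(\<lambda>x. if x \<in> U then \<rho> x *\<^sub>R s x else 0) \<in> sections A E" (is "?t \<in> _")
proof -
  have "smooth_section_on A E U ?t"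
    by (rule section_cong[OF assms(2) section_scale[OF assms(2) _ assms(6)]])
       (use smooth_fun_subset[OF assms(1)] in auto)
  moreover have "smooth_section_on A E (- K) ?t"
  proof (rule section_cong)
    show "smooth_section_on A E (- K) (\<lambda>x. 0)" using section_comb[of "- K" "{}"] assms(3) by (simp add: open_Compl)
  qed (use assms(3,5) in auto)
  ultimately have "smooth_section_on A E UNIV ?t"
    using assms(2-4) by (intro section_local) blast
  then show ?thesis by (simp add: sections_def)
qed

text \<open>The bracket axioms speak of global sections only. Multiplying by a bump function keeps
  the sections in \<open>F\<close> everywhere, since the fibres are subspaces, and leaves them
  unchanged near \<open>p\<close>.\<close>

lemma fam_frame_globalize:
  assumes F: "fam_frame F U J s" "\<And>x. subspace (F x)" and s: "\<And>j. j \<in> J \<Longrightarrow> smooth_section_on A E U (s j)"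
    and p: "p \<in> U"
  obtains T \<sigma> where "open T" "p \<in> T" "T \<subseteq> U" "fam_frame F T J \<sigma>" "\<And>j. j \<in> J \<Longrightarrow> \<sigma> j \<in> sections A E"
    "\<And>j x. j \<in> J \<Longrightarrow> \<sigma> j x \<in> F x" "\<And>j x. j \<in> J \<Longrightarrow> x \<in> T \<Longrightarrow> \<sigma> j x = s j x"
proof -
  have oU: "open U" and fJ: "finite J" using F(1) by (auto simp: fam_frame_def)
  obtain \<rho> T K where \<rho>: "smooth_fun_on A UNIV \<rho>" "open T" "p \<in> T" "T \<subseteq> U" "\<And>x. x \<in> T \<Longrightarrow> \<rho> x = 1"
    "closed K" "K \<subseteq> U" "\<And>x. x \<notin> K \<Longrightarrow> \<rho> x = 0"
    by (rule bump_function[OF oU p]) auto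
  define \<sigma> where "\<sigma> j x = (if x \<in> U then \<rho> x *\<^sub>R s j x else 0)" for j x
  have eq: "\<sigma> j x = s j x" if "x \<in> T" for j x using \<rho>(4,5) that by (auto simp: \<sigma>_def)
  have sF: "s j x \<in> F x" if "j \<in> J" "x \<in> U" for j x
  proof -
    have "F x = span ((\<lambda>j. s j x) ` J)"
      using F(1) that span_fam[OF fJ] indep_fam_iff[OF fJ] by (auto simp: fam_frame_def)
    then show ?thesis using that by (auto intro: span_base)
  qed
  show ?thesis
  proof (rule that[OF \<rho>(2-4)])
    show "fam_frame F T J \<sigma>"
      by (rule fam_frame_cong[OF fam_frame_subset[OF F(1) \<rho>(2,4)]]) (simp add: eq)
    show "\<sigma> j \<in> sections A E" if "j \<in> J" for j
      unfolding \<sigma>_def[abs_def] by (rule cutoff_section[OF \<rho>(1) oU \<rho>(6-8) s[OF that]])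
    show "\<sigma> j x \<in> F x" if "j \<in> J" for j x
      using sF[OF that] F(2) by (auto simp: \<sigma>_def intro: subspace_scale subspace_0)
    show "\<sigma> j x = s j x" if "j \<in> J" "x \<in> T" for j x by (rule eq[OF that(2)])
  qed
qed

end

section \<open>Jets\<close>

lemma sum_fun_apply: "(\<Sum>i\<in>I. f i) x = (\<Sum>i\<in>I. f i x)"
  by (induction I rule: infinite_finite_induct) simp_all

lemma fst_comb: "fst (\<Sum>i\<in>I. c i *\<^sub>R f i) = (\<Sum>i\<in>I. c i *\<^sub>R fst (f i))"
  by (simp add: fst_sum)

lemma snd_comb: "snd (\<Sum>i\<in>I. c i *\<^sub>R f i) k w = (\<Sum>i\<in>I. c i *\<^sub>R snd (f i) k w)"
  by (simp add: snd_sum sum_fun_apply scaleR_fun_def)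

lemma sum_insert_None:
  assumes "finite B"
  shows "(\<Sum>i\<in>insert None (Some ` B). f i) = f None + (\<Sum>e\<in>B. f (Some e))"
  using assms by (simp add: sum.reindex)

context smooth_manifold
begin

lemma chart_deriv_cong:
  assumes V: "(V, \<phi>) \<in> A" "x \<in> V" and T: "open T" "x \<in> T" "\<And>z. z \<in> T \<Longrightarrow> f z = g z"
    and f: "smooth_fun_on A T f"
  shows "chart_deriv (V, \<phi>) f x = chart_deriv (V, \<phi>) g x"
  by (rule chart_deriv_eqI[OF has_derivative_near[OF V T chart_deriv_has_derivative[OF V(1) f T(2) V(2)]], symmetric])

lemma chart_deriv_comb:
  assumes V: "(V, \<phi>) \<in> A" "x \<in> V" and T: "x \<in> T" and f: "\<And>j. j \<in> J \<Longrightarrow> smooth_fun_on A T (f j)"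
  shows "chart_deriv (V, \<phi>) (\<lambda>z. \<Sum>j\<in>J. c j * f j z) x w = (\<Sum>j\<in>J. c j * chart_deriv (V, \<phi>) (f j) x w)"
proof -
  have "((\<lambda>y. \<Sum>j\<in>J. c j * f j (inv_into V \<phi> y)) has_derivative
      (\<lambda>w. \<Sum>j\<in>J. c j * chart_deriv (V, \<phi>) (f j) x w)) (at (\<phi> x))"
    by (intro has_derivative_sum has_derivative_mult_right chart_deriv_has_derivative[OF V(1) f T V(2)])
  from chart_deriv_eqI[OF this] show ?thesis by simp
qed

lemma chart_deriv_linear:
  assumes V: "(V, \<phi>) \<in> A" "x \<in> V" and T: "x \<in> T" "smooth_fun_on A T f"
  shows "linear (chart_deriv (V, \<phi>) f x)"
  using chart_deriv_has_derivative[OF V(1) T(2,1) V(2)] has_derivative_linear by blast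

lemma linear_orthonormal_expand:
  assumes B: "orthonormal_basis (B :: 'e set)" and f: "linear f"
  shows "f w = (\<Sum>e\<in>B. (w \<bullet> e) *\<^sub>R f e)"
proof -
  have "w = (\<Sum>e\<in>B. (w \<bullet> e) *\<^sub>R e)" using B unfolding orthonormal_basis_def by blast
  then have "f w = f (\<Sum>e\<in>B. (w \<bullet> e) *\<^sub>R e)" by simp
  then show ?thesis by (simp add: linear_sum[OF f] linear_cmul[OF f])
qed

end

context smooth_bundle
begin

lemma fst_jet [simp]: "fst (jet A E x s) = s x"
  by (simp add: jet_def)

lemma snd_jet:
  assumes "(V, \<phi>) \<in> A" "(U, \<Phi>) \<in> frames E" "x \<in> V" "x \<in> U"
  shows "snd (jet A E x s) ((V, \<phi>), (U, \<Phi>)) w =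
    (\<Sum>b\<in>\<Phi>. chart_deriv (V, \<phi>) (\<lambda>z. coef \<Phi> z (s z) b) x w *\<^sub>R b x)"
  using assms by (simp add: jet_def chart_deriv_def)

lemma snd_jet_outside:
  assumes "\<not> ((V, \<phi>) \<in> A \<and> (U, \<Phi>) \<in> frames E \<and> x \<in> V \<and> x \<in> U)"
  shows "snd (jet A E x s) ((V, \<phi>), (U, \<Phi>)) w = 0"
  using assms by (auto simp: jet_def)

lemma jet_eqI:
  assumes "fst j = fst k"
    and "\<And>V \<phi> U \<Phi> w. snd j ((V, \<phi>), (U, \<Phi>)) w = snd k ((V, \<phi>), (U, \<Phi>)) w"
  shows "j = k"
  using assms by (auto simp: prod_eq_iff fun_eq_iff)

lemma jet_comb:
  assumes T: "open T" "x \<in> T" and s: "\<And>j. j \<in> J \<Longrightarrow> smooth_section_on A E T (s j)"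
  shows "jet A E x (\<lambda>z. \<Sum>j\<in>J. c j *\<^sub>R s j z) = (\<Sum>j\<in>J. c j *\<^sub>R jet A E x (s j))"
proof (rule jet_eqI)
  show "fst (jet A E x (\<lambda>z. \<Sum>j\<in>J. c j *\<^sub>R s j z)) = fst (\<Sum>j\<in>J. c j *\<^sub>R jet A E x (s j))"
    by (simp only: fst_comb fst_jet)
  fix V \<phi> U \<Phi> w
  show "snd (jet A E x (\<lambda>z. \<Sum>j\<in>J. c j *\<^sub>R s j z)) ((V, \<phi>), (U, \<Phi>)) w =
      snd (\<Sum>j\<in>J. c j *\<^sub>R jet A E x (s j)) ((V, \<phi>), (U, \<Phi>)) w"
  proof (cases "(V, \<phi>) \<in> A \<and> (U, \<Phi>) \<in> frames E \<and> x \<in> V \<and> x \<in> U")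
    case True
    then have V: "(V, \<phi>) \<in> A" "x \<in> V" and U: "(U, \<Phi>) \<in> frames E" "x \<in> U" by auto
    have o: "open (T \<inter> U)" using T frame_open[OF U(1)] by auto
    have "chart_deriv (V, \<phi>) (\<lambda>z. coef \<Phi> z (\<Sum>j\<in>J. c j *\<^sub>R s j z) b) x w =
        (\<Sum>j\<in>J. c j * chart_deriv (V, \<phi>) (\<lambda>z. coef \<Phi> z (s j z) b) x w)" if b: "b \<in> \<Phi>" for b
    proof -
      have "chart_deriv (V, \<phi>) (\<lambda>z. \<Sum>j\<in>J. c j * coef \<Phi> z (s j z) b) x =
          chart_deriv (V, \<phi>) (\<lambda>z. coef \<Phi> z (\<Sum>j\<in>J. c j *\<^sub>R s j z) b) x"
      proof (rule chart_deriv_cong[OF V o])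
        show "smooth_fun_on A (T \<inter> U) (\<lambda>z. \<Sum>j\<in>J. c j * coef \<Phi> z (s j z) b)"
          by (rule smooth_fun_sum[OF o], rule smooth_fun_mult[OF o smooth_fun_const[OF o]],
              rule section_coef[OF s U(1) b])
        show "(\<Sum>j\<in>J. c j * coef \<Phi> z (s j z) b) = coef \<Phi> z (\<Sum>j\<in>J. c j *\<^sub>R s j z) b" if "z \<in> T \<inter> U" for z
          by (rule coef_sum_scale[OF frame_is_frame[OF U(1)] _ b, symmetric])
             (use that section_fib[OF s] in auto)
      qed (use T U in auto)
      moreover have "chart_deriv (V, \<phi>) (\<lambda>z. \<Sum>j\<in>J. c j * coef \<Phi> z (s j z) b) x w =
          (\<Sum>j\<in>J. c j * chart_deriv (V, \<phi>) (\<lambda>z. coef \<Phi> z (s j z) b) x w)"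
        by (rule chart_deriv_comb[OF V _ section_coef[OF s U(1) b]]) (use T U in auto)
      ultimately show ?thesis by simp
    qed
    then have "snd (jet A E x (\<lambda>z. \<Sum>j\<in>J. c j *\<^sub>R s j z)) ((V, \<phi>), (U, \<Phi>)) w =
        (\<Sum>b\<in>\<Phi>. (\<Sum>j\<in>J. c j * chart_deriv (V, \<phi>) (\<lambda>z. coef \<Phi> z (s j z) b) x w) *\<^sub>R b x)"
      by (simp add: snd_jet[OF V(1) U(1) V(2) U(2)])
    also have "\<dots> = (\<Sum>j\<in>J. c j *\<^sub>R snd (jet A E x (s j)) ((V, \<phi>), (U, \<Phi>)) w)"
      unfolding snd_jet[OF V(1) U(1) V(2) U(2)] scaleR_sum_left scaleR_sum_right scaleR_scaleR
      by (rule sum.swap)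
    finally show ?thesis by (simp only: snd_comb)
  qed (simp add: snd_jet_outside snd_comb)
qed

section \<open>Vanishing of jets\<close>

text \<open>A jet stores a derivative as a vector of the fibre; independence of the frame vectors at
  \<open>x\<close> recovers the derivative of each coefficient, and one chart is enough for
  flatness.\<close>

lemma jet_zero_imp_flat:
  assumes T: "open T" "x \<in> T" and s: "smooth_section_on A E T s" and j: "jet A E x s = 0"
    and U: "(U, \<Phi>) \<in> frames E" "x \<in> U" and b: "b \<in> \<Phi>"
  shows "flat_at A x (\<lambda>z. coef \<Phi> z (s z) b)"
proof -
  obtain V \<phi> where V: "(V, \<phi>) \<in> A" "x \<in> V" by (rule chart_around)
  have i: "indep_fam \<Phi> (\<lambda>b. b x)" using frame_is_frame[OF U(1)] U(2) by (auto simp: is_frame_iff fam_frame_def)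
  have "s x = 0" using j fst_jet[of x s] by simp
  then have "(\<Sum>b\<in>\<Phi>. coef \<Phi> x (s x) b *\<^sub>R b x) = 0"
    using coef_expand[OF frame_is_frame[OF U(1)] U(2) section_fib[OF s T(2)]] by simp
  then have 0: "coef \<Phi> x (s x) b = 0" by (rule indep_famD[OF i _ b])
  have "chart_deriv (V, \<phi>) (\<lambda>z. coef \<Phi> z (s z) b) x w = 0" for w
  proof -
    have "snd (jet A E x s) ((V, \<phi>), (U, \<Phi>)) w = 0" using j by simp
    then have "(\<Sum>b\<in>\<Phi>. chart_deriv (V, \<phi>) (\<lambda>z. coef \<Phi> z (s z) b) x w *\<^sub>R b x) = 0"
      by (simp only: snd_jet[OF V(1) U(1) V(2) U(2)])
    then show ?thesis by (rule indep_famD[OF i _ b])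
  qed
  then have "chart_deriv (V, \<phi>) (\<lambda>z. coef \<Phi> z (s z) b) x = (\<lambda>_. 0)" by (simp add: fun_eq_iff)
  moreover have "x \<in> T \<inter> U" using T U by auto
  ultimately show ?thesis
    using chart_deriv_has_derivative[OF V(1) section_coef[OF s U(1) b] _ V(2)]
    by (intro flat_atI[where f = "\<lambda>z. coef \<Phi> z (s z) b", OF V] 0) (simp only:)
qed

lemma flat_imp_jet_zero:
  assumes s: "s x \<in> fib E x"
    and flat: "\<And>U \<Phi> b. (U, \<Phi>) \<in> frames E \<Longrightarrow> x \<in> U \<Longrightarrow> b \<in> \<Phi> \<Longrightarrow> flat_at A x (\<lambda>z. coef \<Phi> z (s z) b)"
  shows "jet A E x s = 0"
proof (rule jet_eqI)
  obtain U \<Phi> where U: "(U, \<Phi>) \<in> frames E" "x \<in> U" by (rule frame_around)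
  have "s x = (\<Sum>b\<in>\<Phi>. coef \<Phi> x (s x) b *\<^sub>R b x)" by (rule coef_expand[OF frame_is_frame[OF U(1)] U(2) s, symmetric])
  also have "\<dots> = 0" using flat_atD(1)[OF flat[OF U]] by simp
  finally show "fst (jet A E x s) = fst 0" by simp
  fix V \<phi> U \<Phi> w
  show "snd (jet A E x s) ((V, \<phi>), (U, \<Phi>)) w = snd 0 ((V, \<phi>), (U, \<Phi>)) w"
  proof (cases "(V, \<phi>) \<in> A \<and> (U, \<Phi>) \<in> frames E \<and> x \<in> V \<and> x \<in> U")
    case True
    then have V: "(V, \<phi>) \<in> A" "x \<in> V" and U: "(U, \<Phi>) \<in> frames E" "x \<in> U" by auto
    have "chart_deriv (V, \<phi>) (\<lambda>z. coef \<Phi> z (s z) b) x = (\<lambda>_. 0)" if "b \<in> \<Phi>" for b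
      by (rule chart_deriv_eqI[OF flat_atD(2)[OF flat[OF U that] V]])
    then show ?thesis by (simp add: snd_jet[OF V(1) U(1) V(2) U(2)])
  qed (simp add: snd_jet_outside)
qed

text \<open>The family may be a frame of a subbundle, hence no frame of \<open>E\<close>. Its
  coefficients and the frame coefficients are smooth combinations of each other, through the left
  inverse in one direction and the coefficients of the \<open>s j\<close> in the other, and smooth
  combinations preserve flatness.\<close>

lemma jet_zero_iff_flat_coefficients:
  assumes T: "open T" "x \<in> T" "finite J" and s: "\<And>j. j \<in> J \<Longrightarrow> smooth_section_on A E T (s j)"
    and indep: "\<And>z. z \<in> T \<Longrightarrow> indep_fam J (\<lambda>j. s j z)"
    and t: "smooth_section_on A E T t" "\<And>z. z \<in> T \<Longrightarrow> t z = (\<Sum>j\<in>J. c j z *\<^sub>R s j z)"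
  shows "jet A E x t = 0 \<longleftrightarrow> (\<forall>j\<in>J. flat_at A x (c j))"
proof
  assume j: "jet A E x t = 0"
  obtain W \<Psi> where W: "(W, \<Psi>) \<in> frames E" "x \<in> W" by (rule frame_around)
  obtain m where m: "\<forall>k\<in>J. \<forall>\<psi>\<in>\<Psi>. smooth_fun_on A (T \<inter> W) (m k \<psi>)"
    "\<forall>x\<in>T \<inter> W. \<forall>c. \<forall>k\<in>J. (\<Sum>\<psi>\<in>\<Psi>. m k \<psi> x * coef \<Psi> x (\<Sum>j\<in>J. c j *\<^sub>R s j x) \<psi>) = c k"
    using frame_left_inverse[where s = s, OF W(1) T(1,3) s indep] by blast
  show "\<forall>k\<in>J. flat_at A x (c k)"
  proof
    fix k assume k: "k \<in> J"
    have "flat_at A x (\<lambda>z. \<Sum>\<psi>\<in>\<Psi>. m k \<psi> z * coef \<Psi> z (t z) \<psi>)"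
      by (rule flat_at_sum, rule flat_at_mult[of "T \<inter> W"])
         (use m(1) k T(2) W(2) jet_zero_imp_flat[OF T(1,2) t(1) j W] in auto)
    then show "flat_at A x (c k)"
    proof (rule flat_at_cong[of "T \<inter> W", rotated 3])
      show "(\<Sum>\<psi>\<in>\<Psi>. m k \<psi> z * coef \<Psi> z (t z) \<psi>) = c k z" if "z \<in> T \<inter> W" for z
        using m(2)[rule_format, OF that k, of "\<lambda>j. c j z"] t(2) that by simp
    qed (use T W frame_open[OF W(1)] in auto)
  qed
next
  assume c: "\<forall>j\<in>J. flat_at A x (c j)"
  show "jet A E x t = 0"
  proof (rule flat_imp_jet_zero)
    show "t x \<in> fib E x" by (rule section_fib[OF t(1) T(2)])
    fix U \<Phi> b assume U: "(U, \<Phi>) \<in> frames E" "x \<in> U" and b: "b \<in> \<Phi>"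
    have "flat_at A x (\<lambda>z. \<Sum>j\<in>J. coef \<Phi> z (s j z) b * c j z)"
      by (rule flat_at_sum, rule flat_at_mult[of "T \<inter> U"])
         (use c section_coef[OF s U(1) b] T U in auto)
    then show "flat_at A x (\<lambda>z. coef \<Phi> z (t z) b)"
    proof (rule flat_at_cong[of "T \<inter> U", rotated 3])
      show "(\<Sum>j\<in>J. coef \<Phi> z (s j z) b * c j z) = coef \<Phi> z (t z) b" if "z \<in> T \<inter> U" for z
      proof -
        have "coef \<Phi> z (\<Sum>j\<in>J. c j z *\<^sub>R s j z) b = (\<Sum>j\<in>J. c j z * coef \<Phi> z (s j z) b)"
          by (rule coef_sum_scale[OF frame_is_frame[OF U(1)] _ b]) (use that section_fib[OF s] in auto)
        then show ?thesis using t(2) that by (simp add: mult.commute)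
      qed
    qed (use T U frame_open[OF U(1)] in auto)
  qed
qed

lemma sections_iff: "s \<in> sections A E \<longleftrightarrow> smooth_section_on A E UNIV s"
  by (simp add: sections_def)

lemma sections_on: "s \<in> sections A E \<Longrightarrow> smooth_section_on A E U s"
  using section_subset by (auto simp: sections_iff)

lemma sections_comb:
  assumes "finite J" "\<And>j. j \<in> J \<Longrightarrow> s j \<in> sections A E"
  shows "(\<lambda>z. \<Sum>j\<in>J. c j *\<^sub>R s j z) \<in> sections A E"
  using section_comb[of UNIV J "\<lambda>j z. c j" s] assms smooth_fun_const by (simp add: sections_iff)

lemma jet_comb_sections:
  assumes "\<And>j. j \<in> J \<Longrightarrow> s j \<in> sections A E"
  shows "jet A E x (\<lambda>z. \<Sum>j\<in>J. c j *\<^sub>R s j z) = (\<Sum>j\<in>J. c j *\<^sub>R jet A E x (s j))"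
  by (rule jet_comb[of UNIV]) (use assms sections_iff in auto)

lemma jet_add:
  assumes "s \<in> sections A E" "t \<in> sections A E"
  shows "jet A E x (\<lambda>z. s z + t z) = jet A E x s + jet A E x t" "(\<lambda>z. s z + t z) \<in> sections A E"
proof -
  have "jet A E x (\<lambda>z. \<Sum>b\<in>{True, False}. 1 *\<^sub>R (if b then s else t) z) =
      (\<Sum>b\<in>{True, False}. 1 *\<^sub>R jet A E x (if b then s else t))"
    by (rule jet_comb_sections) (use assms in auto)
  then show "jet A E x (\<lambda>z. s z + t z) = jet A E x s + jet A E x t" by simp
  show "(\<lambda>z. s z + t z) \<in> sections A E" using assms section_add by (simp add: sections_iff)
qed

lemma jet_scale:
  assumes "s \<in> sections A E"
  shows "jet A E x (\<lambda>z. c *\<^sub>R s z) = c *\<^sub>R jet A E x s" "(\<lambda>z. c *\<^sub>R s z) \<in> sections A E"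
proof -
  have "jet A E x (\<lambda>z. \<Sum>j\<in>{()}. c *\<^sub>R s z) = (\<Sum>j\<in>{()}. c *\<^sub>R jet A E x s)"
    by (rule jet_comb_sections[OF assms])
  then show "jet A E x (\<lambda>z. c *\<^sub>R s z) = c *\<^sub>R jet A E x s" by simp
  have "(\<lambda>z. \<Sum>j\<in>{()}. c *\<^sub>R s z) \<in> sections A E"
    by (rule sections_comb[OF _ assms]) simp
  then show "(\<lambda>z. c *\<^sub>R s z) \<in> sections A E" by simp
qed

lemma jet_zero: "jet A E x (\<lambda>z. 0) = 0" "(\<lambda>z. 0) \<in> sections A E"
  using jet_comb_sections[of "{}"] sections_comb[of "{}"] by simp_all

lemma jet_fib_subspace: "subspace (jet_fib A E x)"
proof (rule subspaceI)
  show "0 \<in> jet_fib A E x" 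
    unfolding jet_fib_def by (rule image_eqI[of _ _ "\<lambda>z. 0"]) (simp_all add: jet_zero)
  show "j + k \<in> jet_fib A E x" if jk: "j \<in> jet_fib A E x" "k \<in> jet_fib A E x" for j k
  proof -
    obtain s t where "s \<in> sections A E" "t \<in> sections A E" "j = jet A E x s" "k = jet A E x t"
      using jk by (auto simp: jet_fib_def)
    then show ?thesis unfolding jet_fib_def by (intro image_eqI[of _ _ "\<lambda>z. s z + t z"]) (simp_all add: jet_add)
  qed
  show "c *\<^sub>R j \<in> jet_fib A E x" if j: "j \<in> jet_fib A E x" for j c
  proof -
    obtain s where "s \<in> sections A E" "j = jet A E x s" using j by (auto simp: jet_fib_def)
    then show ?thesis unfolding jet_fib_def by (intro image_eqI[of _ _ "\<lambda>z. c *\<^sub>R s z"]) (simp_all add: jet_scale)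
  qed
qed

lemma jet_fib_fst: "j \<in> jet_fib A E x \<Longrightarrow> fst j \<in> fib E x"
  using section_fib sections_iff by (fastforce simp: jet_fib_def)

lemma jet_fib_snd:
  assumes "j \<in> jet_fib A E x" "(V, \<phi>) \<in> A" "(U, \<Phi>) \<in> frames E" "x \<in> V" "x \<in> U"
  shows "snd j ((V, \<phi>), (U, \<Phi>)) w \<in> fib E x"
proof -
  obtain s where "j = jet A E x s" using assms(1) by (auto simp: jet_fib_def)
  then show ?thesis using frame_comb_in[OF frame_is_frame[OF assms(3)] assms(5)] by (simp add: snd_jet assms(2-))
qed

lemma jet_smooth_prolongation:
  assumes s: "s \<in> sections A E"
  shows "jet_smooth_on A E U (\<lambda>x. jet A E x s)"
proof -
  have "smooth_fun_on A (U \<inter> V \<inter> W) (\<lambda>x. coef \<Phi> x (snd (jet A E x s) ((V, \<phi>), (W, \<Phi>)) w) b)"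
    if V: "(V, \<phi>) \<in> A" and W: "(W, \<Phi>) \<in> frames E" and b: "b \<in> \<Phi>" for V \<phi> W \<Phi> b w
  proof -
    have c: "smooth_fun_on A W (\<lambda>z. coef \<Phi> z (s z) b)"
      using section_coef[OF sections_on[OF s, of UNIV] W b] by simp
    have "smooth_fun_on A (W \<inter> V) (\<lambda>x. coef \<Phi> x (snd (jet A E x s) ((V, \<phi>), (W, \<Phi>)) w) b)"
      by (rule smooth_fun_cong[OF _ chart_deriv_smooth[OF V frame_open[OF W] c, of w]])
         (use chart_open[OF V] frame_open[OF W] coef_comb[OF frame_is_frame[OF W] _ b] in
           \<open>auto simp: snd_jet[OF V W]\<close>)
    then show ?thesis by (rule smooth_fun_subset) auto
  qed
  then show ?thesis using sections_on[OF s] s by (auto simp: jet_smooth_on_def jet_fib_def)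
qed

end

section \<open>Coordinates on jets\<close>

text \<open>An index \<open>(b, None)\<close> reads the \<open>b\<close>-coefficient of the value,
  an index \<open>(b, Some e)\<close> that of the derivative in direction \<open>e\<close>. Only
  directions from an orthonormal basis are used, so finitely many coordinates occur.\<close>

definition jet_coord :: "('m, 'e::real_inner) chart \<Rightarrow> ('m, 'v::real_vector) frame \<Rightarrow>
    ('m \<Rightarrow> 'v) \<times> 'e option \<Rightarrow> 'm \<Rightarrow> ('m, 'e, 'v) jet \<Rightarrow> real"
  where "jet_coord c f i x j = coef (snd f) x
    (case snd i of None \<Rightarrow> fst j | Some e \<Rightarrow> snd j (c, f) e) (fst i)"

context smooth_bundle
begin

context
  fixes V \<phi> W \<Phi> B
  assumes V: "(V, \<phi>) \<in> A" and W: "(W, \<Phi>) \<in> frames E" and B: "orthonormal_basis (B :: 'e set)"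
begin

lemma jet_coord_comb:
  assumes x: "x \<in> V \<inter> W" and i: "i \<in> \<Phi> \<times> insert None (Some ` B)" and j: "\<And>k. k \<in> J \<Longrightarrow> j k \<in> jet_fib A E x"
  shows "jet_coord (V, \<phi>) (W, \<Phi>) i x (\<Sum>k\<in>J. c k *\<^sub>R j k) = (\<Sum>k\<in>J. c k * jet_coord (V, \<phi>) (W, \<Phi>) i x (j k))"
proof (cases "snd i")
  case None
  then show ?thesis
    using coef_sum_scale[OF frame_is_frame[OF W], of x "fst i" J "\<lambda>k. fst (j k)" c] jet_fib_fst[OF j] x i
    by (auto simp: jet_coord_def fst_comb)
next
  case (Some e)
  then show ?thesis
    using coef_sum_scale[OF frame_is_frame[OF W], of x "fst i" J "\<lambda>k. snd (j k) ((V, \<phi>), (W, \<Phi>)) e" c]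
      jet_fib_snd[OF j V W] x i
    by (auto simp: jet_coord_def snd_comb)
qed

text \<open>Although a jet lists its derivatives in all charts and frames, one coordinate system
  determines it: vanishing there makes the coefficients flat, and flatness does not depend on the
  coordinate system.\<close>

lemma jet_coord_inj:
  assumes x: "x \<in> V \<inter> W" and j: "j \<in> jet_fib A E x"
    and 0: "\<And>i. i \<in> \<Phi> \<times> insert None (Some ` B) \<Longrightarrow> jet_coord (V, \<phi>) (W, \<Phi>) i x j = 0"
  shows "j = 0"
proof -
  obtain s where s: "s \<in> sections A E" "j = jet A E x s" using j by (auto simp: jet_fib_def)
  have xV: "x \<in> V" and xW: "x \<in> W" using x by auto
  have flat: "flat_at A x (\<lambda>z. coef \<Phi> z (s z) b)" if b: "b \<in> \<Phi>" for b
  proof -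
    have c: "smooth_fun_on A W (\<lambda>z. coef \<Phi> z (s z) b)"
      using section_coef[OF sections_on[OF s(1), of UNIV] W b] by simp
    have D: "chart_deriv (V, \<phi>) (\<lambda>z. coef \<Phi> z (s z) b) x e = 0" if "e \<in> B" for e
      using 0[of "(b, Some e)"] b that
      by (simp add: jet_coord_def s(2) snd_jet[OF V W xV xW] coef_comb[OF frame_is_frame[OF W] xW b])
    have "chart_deriv (V, \<phi>) (\<lambda>z. coef \<Phi> z (s z) b) x = (\<lambda>_. 0)"
      using linear_orthonormal_expand[OF B chart_deriv_linear[OF V xV xW c]] D by (simp add: fun_eq_iff)
    moreover have "coef \<Phi> x (s x) b = 0" using 0[of "(b, None)"] b by (simp add: jet_coord_def s(2))
    ultimately show ?thesis using chart_deriv_has_derivative[OF V c xW xV]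
      by (intro flat_atI[where f = "\<lambda>z. coef \<Phi> z (s z) b", OF V xV]) (simp_all only:)
  qed
  have "jet A E x s = 0 \<longleftrightarrow> (\<forall>b\<in>\<Phi>. flat_at A x (\<lambda>z. coef \<Phi> z (s z) b))"
  proof (rule jet_zero_iff_flat_coefficients[OF frame_open[OF W] xW frame_finite[OF W], where s = "\<lambda>b. b"])
    show "indep_fam \<Phi> (\<lambda>b. b z)" if "z \<in> W" for z
      using frame_is_frame[OF W] that by (auto simp: is_frame_iff fam_frame_def)
    show "s z = (\<Sum>b\<in>\<Phi>. coef \<Phi> z (s z) b *\<^sub>R b z)" if "z \<in> W" for z
      by (rule coef_expand[OF frame_is_frame[OF W] that section_fib[OF sections_on[OF s(1), of UNIV]], symmetric]) simp
  qed (use frame_smooth[OF W] sections_on[OF s(1)] in auto)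
  then show ?thesis using flat s(2) by simp
qed

lemma jet_coord_smooth:
  assumes U: "open U" "jet_smooth_on A E U \<sigma>" and i: "i \<in> \<Phi> \<times> insert None (Some ` B)"
  shows "smooth_fun_on A (U \<inter> (V \<inter> W)) (\<lambda>x. jet_coord (V, \<phi>) (W, \<Phi>) i x (\<sigma> x))"
proof (cases "snd i")
  case None
  have "smooth_fun_on A (U \<inter> W) (\<lambda>x. coef \<Phi> x (fst (\<sigma> x)) (fst i))"
    by (rule section_coef[OF _ W]) (use U(2) i in \<open>auto simp: jet_smooth_on_def\<close>)
  then have "smooth_fun_on A (U \<inter> (V \<inter> W)) (\<lambda>x. coef \<Phi> x (fst (\<sigma> x)) (fst i))"
    by (rule smooth_fun_subset) auto
  then show ?thesis using None by (simp add: jet_coord_def)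
next
  case (Some e)
  have "smooth_fun_on A (U \<inter> V \<inter> W) (\<lambda>x. coef \<Phi> x (snd (\<sigma> x) ((V, \<phi>), (W, \<Phi>)) e) (fst i))"
    using U(2) V W i by (fastforce simp: jet_smooth_on_def)
  then show ?thesis using Some by (simp add: jet_coord_def Int_assoc)
qed

end

text \<open>Counterpart of \<open>smooth_coefficients\<close> in terms of jet coordinates. It shows
  that the members of \<open>jet_frames\<close> are smoothly related, so it has to precede the
  vector bundle structure on jets.\<close>

lemma jet_smooth_coefficients:
  assumes U: "open U" "finite J"
    and s: "\<And>j. j \<in> J \<Longrightarrow> jet_smooth_on A E U (s j)"
    and indep: "\<And>x. x \<in> U \<Longrightarrow> indep_fam J (\<lambda>j. s j x)"
    and t: "jet_smooth_on A E U t" "\<And>x. x \<in> U \<Longrightarrow> t x = (\<Sum>j\<in>J. c j x *\<^sub>R s j x)"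
    and k: "k \<in> J"
  shows "smooth_fun_on A U (c k)"
proof (rule smooth_fun_local)
  fix p assume p: "p \<in> U"
  obtain V \<phi> where V: "(V, \<phi>) \<in> A" "p \<in> V" by (rule chart_around)
  obtain W \<Phi> where W: "(W, \<Phi>) \<in> frames E" "p \<in> W" by (rule frame_around)
  obtain B :: "'e set" where B: "orthonormal_basis B" using model_basis by auto
  let ?l = "jet_coord (V, \<phi>) (W, \<Phi>)" and ?I = "\<Phi> \<times> insert None (Some ` B)" and ?T = "U \<inter> (V \<inter> W)"
  have o: "open ?T" using U(1) chart_open[OF V(1)] frame_open[OF W(1)] by auto
  have fI: "finite ?I" using frame_finite[OF W(1)] B by (simp add: orthonormal_basis_def)
  have sf: "s j x \<in> jet_fib A E x" if "j \<in> J" "x \<in> U" for j x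
    using s[OF that(1)] that(2) by (simp add: jet_smooth_on_def)
  have "smooth_fun_on A ?T (c k)"
  proof (rule coordinates_left_inverse[where U = ?T and I = ?I and J = J and s = s and l = ?l])
    show "?l i x (\<Sum>j\<in>J. c j *\<^sub>R s j x) = (\<Sum>j\<in>J. c j * ?l i x (s j x))" if "x \<in> ?T" "i \<in> ?I" for x i c
      by (rule jet_coord_comb[OF V(1) W(1) B]) (use that sf in auto)
    show "(\<Sum>j\<in>J. c j *\<^sub>R s j x) = 0"
      if x: "x \<in> ?T" and 0: "\<And>i. i \<in> ?I \<Longrightarrow> ?l i x (\<Sum>j\<in>J. c j *\<^sub>R s j x) = 0" for x c
    proof (rule jet_coord_inj[OF V(1) W(1) B _ _ 0])
      show "(\<Sum>j\<in>J. c j *\<^sub>R s j x) \<in> jet_fib A E x"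
        by (intro subspace_sum subspace_scale jet_fib_subspace sf) (use x in auto)
    qed (use x in auto)
    show "smooth_fun_on A ?T (\<lambda>x. ?l i x (s j x))" if "i \<in> ?I" "j \<in> J" for i j
      by (rule jet_coord_smooth[OF V(1) W(1) B U(1) s[OF that(2)] that(1)])
    fix m assume m: "\<And>k i. k \<in> J \<Longrightarrow> i \<in> ?I \<Longrightarrow> smooth_fun_on A ?T (m k i)"
      "\<And>x c k. x \<in> ?T \<Longrightarrow> k \<in> J \<Longrightarrow> (\<Sum>i\<in>?I. m k i x * ?l i x (\<Sum>j\<in>J. c j *\<^sub>R s j x)) = c k"
    show "smooth_fun_on A ?T (c k)"
    proof (rule smooth_fun_cong[OF o])
      show "smooth_fun_on A ?T (\<lambda>x. \<Sum>i\<in>?I. m k i x * ?l i x (t x))"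
        by (rule smooth_fun_sum[OF o], rule smooth_fun_mult[OF o])
           (use m(1) k jet_coord_smooth[OF V(1) W(1) B U(1) t(1)] in blast)+
      show "(\<Sum>i\<in>?I. m k i x * ?l i x (t x)) = c k x" if "x \<in> ?T" for x
        using m(2)[OF that k, of "\<lambda>j. c j x"] t(2) that by simp
    qed
  qed (use o fI U indep in auto)
  then show "\<exists>T. open T \<and> p \<in> T \<and> smooth_fun_on A T (c k)" using o p V W by blast
qed

end

context smooth_manifold
begin

section \<open>Frames of the jet bundle made of prolongations\<close>

lemma affine_chart_has_derivative:
  assumes V: "(V, \<phi>) \<in> A" "x \<in> V"
  shows "((\<lambda>y. a + (\<Sum>e\<in>B. c e * (\<phi> (inv_into V \<phi> y) \<bullet> e))) has_derivative
    (\<lambda>w. \<Sum>e\<in>B. c e * (w \<bullet> e))) (at (\<phi> x))"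
proof -
  have "((\<lambda>y. a + (\<Sum>e\<in>B. c e * (y \<bullet> e))) has_derivative (\<lambda>w. 0 + (\<Sum>e\<in>B. c e * (w \<bullet> e)))) (at (\<phi> x))"
    by (intro has_derivative_add has_derivative_const has_derivative_sum has_derivative_mult_right
        has_derivative_inner_left has_derivative_ident)
  then have "((\<lambda>y. a + (\<Sum>e\<in>B. c e * (y \<bullet> e))) has_derivative (\<lambda>w. \<Sum>e\<in>B. c e * (w \<bullet> e))) (at (\<phi> x))"
    by (simp only: add_0)
  then show ?thesis
    by (rule has_derivative_transform_within_open[OF _ chart_image_open[OF V(1)]]) (use V in auto)
qed

lemma affine_chart_smooth:
  assumes V: "(V, \<phi>) \<in> A"
  shows "smooth_fun_on A V (\<lambda>x. \<phi> x \<bullet> e)"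
  by (rule smooth_fun_chart[OF V chart_open[OF V] order_refl, where h = "\<lambda>y. y \<bullet> e"])
     (simp_all add: Ck_on_bounded_linear[OF chart_image_open[OF V] bounded_linear_inner_left])

end

context smooth_bundle
begin

text \<open>First-order Taylor expansion: at \<open>x\<close> every coefficient of a section agrees
  to first order with exactly one function that is affine in the chart. Hence the jets of the frame
  sections \<open>b\<close>, and of their products with linear coordinates, form a basis. The count
  refers to one fixed choice of an orthonormal basis, so that counts at different points can be
  compared.\<close>

lemma prolongation_frame:
  obtains T \<beta> and J :: "(('m \<Rightarrow> 'v) \<times> 'e option) set"
  where "open T" "p \<in> T" "fam_frame (jet_fib A E) T J (\<lambda>j x. jet A E x (\<beta> j))"
    "\<And>j. j \<in> J \<Longrightarrow> \<beta> j \<in> sections A E"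
    "card J = dim (fib E p) * (1 + card (SOME B::'e set. orthonormal_basis B))"
proof -
  obtain V \<phi> where V: "(V, \<phi>) \<in> A" "p \<in> V" by (rule chart_around)
  obtain W \<Phi> where W: "(W, \<Phi>) \<in> frames E" "p \<in> W" by (rule frame_around)
  define B :: "'e set" where "B = (SOME B. orthonormal_basis B)"
  have B: "orthonormal_basis B" unfolding B_def using model_basis someI_ex by metis
  have fB: "finite B" and f\<Phi>: "finite \<Phi>" using B frame_finite[OF W(1)] by (auto simp: orthonormal_basis_def)
  have o: "open (V \<inter> W)" using chart_open[OF V(1)] frame_open[OF W(1)] by auto
  obtain \<rho> T K where \<rho>: "smooth_fun_on A UNIV \<rho>" "open T" "p \<in> T" "T \<subseteq> V \<inter> W" "\<And>x. x \<in> T \<Longrightarrow> \<rho> x = 1"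
    "closed K" "K \<subseteq> V \<inter> W" "\<And>x. x \<notin> K \<Longrightarrow> \<rho> x = 0"
    by (rule bump_function[OF o, of p]) (use V W in auto)
  define J where "J = \<Phi> \<times> insert None (Some ` B)"
  \<comment> \<open>The coordinates are not centred at a point, so that the same sections give a
    basis of jets at every point of \<open>T\<close>.\<close>
  define s where "s i x = (case snd i of None \<Rightarrow> fst i x | Some e \<Rightarrow> (\<phi> x \<bullet> e) *\<^sub>R fst i x)"
    for i :: "('m \<Rightarrow> 'v) \<times> 'e option" and x
  define \<beta> where "\<beta> i x = (if x \<in> V \<inter> W then \<rho> x *\<^sub>R s i x else 0)" for i x
  have fJ: "finite J" using fB f\<Phi> by (simp add: J_def)
  have ss: "smooth_section_on A E (V \<inter> W) (s i)" if "i \<in> J" for i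
  proof (cases "snd i")
    case None
    then have "s i = fst i" by (simp add: s_def fun_eq_iff)
    then show ?thesis using section_subset[OF frame_smooth[OF W(1), of "fst i"], of "V \<inter> W"] that
      by (auto simp: J_def)
  next
    case (Some e)
    then have "s i = (\<lambda>x. (\<phi> x \<bullet> e) *\<^sub>R fst i x)" by (simp add: s_def fun_eq_iff)
    moreover have "smooth_section_on A E (V \<inter> W) (\<lambda>x. (\<phi> x \<bullet> e) *\<^sub>R fst i x)"
      by (rule section_scale[OF o smooth_fun_subset[OF affine_chart_smooth[OF V(1)]]
            section_subset[OF frame_smooth[OF W(1)]]]) (use that in \<open>auto simp: J_def\<close>)
    ultimately show ?thesis by simp
  qed
  have \<beta>sec: "\<beta> i \<in> sections A E" if "i \<in> J" for i
    unfolding \<beta>_def[abs_def] by (rule cutoff_section[OF \<rho>(1) o \<rho>(6-8) ss[OF that]])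
  \<comment> \<open>Collecting the terms that belong to \<open>b\<close> turns a combination of the
    \<open>\<beta> i\<close> into a frame expansion whose coefficients are affine in the
    chart.\<close>
  define g where "g c b x = c (b, None) + (\<Sum>e\<in>B. c (b, Some e) * (\<phi> x \<bullet> e))"
    for c :: "('m \<Rightarrow> 'v) \<times> 'e option \<Rightarrow> real" and b x
  have comb: "(\<Sum>i\<in>J. c i *\<^sub>R \<beta> i x) = (\<Sum>b\<in>\<Phi>. g c b x *\<^sub>R b x)" if "x \<in> T" for c x
  proof -
    have "(\<Sum>i\<in>J. c i *\<^sub>R \<beta> i x) = (\<Sum>i\<in>J. c i *\<^sub>R s i x)"
      using \<rho>(4,5) that by (intro sum.cong) (auto simp: \<beta>_def)
    also have "\<dots> = (\<Sum>b\<in>\<Phi>. \<Sum>k\<in>insert None (Some ` B). c (b, k) *\<^sub>R s (b, k) x)"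
      unfolding J_def by (simp add: sum.cartesian_product)
    also have "\<dots> = (\<Sum>b\<in>\<Phi>. g c b x *\<^sub>R b x)"
      by (rule sum.cong) (simp_all add: sum_insert_None[OF fB] s_def g_def scaleR_add_left scaleR_sum_left)
    finally show ?thesis .
  qed
  have gD: "((\<lambda>y. g c b (inv_into V \<phi> y)) has_derivative (\<lambda>w. \<Sum>e\<in>B. c (b, Some e) * (w \<bullet> e))) (at (\<phi> x))"
    if "x \<in> V" for c b x
    unfolding g_def by (rule affine_chart_has_derivative[OF V(1) that])
  have TW: "T \<subseteq> W" and TV: "T \<subseteq> V" using \<rho>(4) by auto
  have i\<Phi>: "indep_fam \<Phi> (\<lambda>b. b z)" if "z \<in> T" for z
    using frame_is_frame[OF W(1)] that TW by (auto simp: is_frame_iff fam_frame_def)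
  have flat: "jet A E x t = 0 \<longleftrightarrow> (\<forall>b\<in>\<Phi>. flat_at A x (c b))"
    if "x \<in> T" "t \<in> sections A E" "\<And>z. z \<in> T \<Longrightarrow> t z = (\<Sum>b\<in>\<Phi>. c b z *\<^sub>R b z)" for x t c
    by (rule jet_zero_iff_flat_coefficients[OF \<rho>(2) that(1) f\<Phi> section_subset[OF frame_smooth[OF W(1)] TW] i\<Phi>
        sections_on[OF that(2)] that(3)])
  have "fam_frame (jet_fib A E) T J (\<lambda>j x. jet A E x (\<beta> j))"
    unfolding fam_frame_def
  proof (intro conjI ballI)
    fix x assume x: "x \<in> T"
    have xV: "x \<in> V" and xW: "x \<in> W" using x TV TW by auto
    show "indep_fam J (\<lambda>j. jet A E x (\<beta> j))" unfolding indep_fam_def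
    proof (intro allI impI ballI)
      fix c i assume c: "(\<Sum>j\<in>J. c j *\<^sub>R jet A E x (\<beta> j)) = 0" and i: "i \<in> J"
      have "jet A E x (\<lambda>z. \<Sum>j\<in>J. c j *\<^sub>R \<beta> j z) = 0"
        using jet_comb_sections[where s = \<beta> and J = J and c = c and x = x, OF \<beta>sec] c by simp
      then have fl: "flat_at A x (g c b)" if "b \<in> \<Phi>" for b
        using flat[OF x sections_comb[where s = \<beta>, OF fJ \<beta>sec], of c "g c"] comb that by blast
      have b: "fst i \<in> \<Phi>" using i by (auto simp: J_def)
      have D: "(\<Sum>e\<in>B. c (fst i, Some e) * (w \<bullet> e)) = 0" for w
        using has_derivative_unique[OF gD[OF xV] flat_atD(2)[OF fl[OF b] V(1) xV]] by metis
      have Se: "c (fst i, Some e) = 0" if "e \<in> B" for e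
      proof -
        have "(\<Sum>e'\<in>B. c (fst i, Some e') * (e \<bullet> e')) = (\<Sum>e'\<in>B. if e' = e then c (fst i, Some e') else 0)"
          by (rule sum.cong) (use B that in \<open>auto simp: orthonormal_basis_def\<close>)
        then show ?thesis using D[of e] fB that by simp
      qed
      then have "c (fst i, None) = 0" using flat_atD(1)[OF fl[OF b]] by (simp add: g_def)
      then show "c i = 0" using Se i by (cases i) (auto simp: J_def)
    qed
    show "jet_fib A E x = range (\<lambda>c. \<Sum>j\<in>J. c j *\<^sub>R jet A E x (\<beta> j))"
    proof
      show "range (\<lambda>c. \<Sum>j\<in>J. c j *\<^sub>R jet A E x (\<beta> j)) \<subseteq> jet_fib A E x"
        by (auto intro!: subspace_sum subspace_scale jet_fib_subspace) (use \<beta>sec in \<open>auto simp: jet_fib_def\<close>)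
      show "jet_fib A E x \<subseteq> range (\<lambda>c. \<Sum>j\<in>J. c j *\<^sub>R jet A E x (\<beta> j))"
      proof
        fix k assume "k \<in> jet_fib A E x"
        then obtain t where t: "t \<in> sections A E" "k = jet A E x t" by (auto simp: jet_fib_def)
        define a where "a b z = coef \<Phi> z (t z) b" for b z
        have sa: "smooth_fun_on A W (a b)" if "b \<in> \<Phi>" for b
          using section_coef[OF sections_on[OF t(1), of UNIV] W(1) that] by (simp add: a_def[abs_def])
        \<comment> \<open>Taylor coefficients at \<open>x\<close>: the slopes of \<open>a b\<close>,
          and a constant term corrected by the slopes because the chart is not centred at
          \<open>x\<close>.\<close>
        define c where "c i = (case snd i of Some e \<Rightarrow> chart_deriv (V, \<phi>) (a (fst i)) x e
          | None \<Rightarrow> a (fst i) x - (\<Sum>e\<in>B. chart_deriv (V, \<phi>) (a (fst i)) x e * (\<phi> x \<bullet> e)))" for i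
        have te: "t z = (\<Sum>b\<in>\<Phi>. a b z *\<^sub>R b z)" if "z \<in> T" for z
          unfolding a_def
          by (rule coef_expand[OF frame_is_frame[OF W(1)] _ section_fib[OF sections_on[OF t(1), of UNIV]], symmetric])
             (use that TW in auto)
        \<comment> \<open>Subtracting the Taylor approximation from \<open>t\<close> leaves flat
          coefficients, hence a zero jet at \<open>x\<close>.\<close>
        let ?u = "\<lambda>z. t z + (\<Sum>i\<in>J. (- c i) *\<^sub>R \<beta> i z)"
        have us: "?u \<in> sections A E" by (rule jet_add(2)[OF t(1) sections_comb[where s = \<beta>, OF fJ \<beta>sec]])
        have "jet A E x ?u = 0 \<longleftrightarrow> (\<forall>b\<in>\<Phi>. flat_at A x (\<lambda>z. a b z + g (\<lambda>i. - c i) b z))"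
          by (rule flat[OF x us]) (simp only: te comb scaleR_add_left sum.distrib)
        moreover have "flat_at A x (\<lambda>z. a b z + g (\<lambda>i. - c i) b z)" if b: "b \<in> \<Phi>" for b
        proof (rule flat_atI[OF V(1) xV])
          show "a b x + g (\<lambda>i. - c i) b x = 0" by (simp add: g_def c_def sum_negf)
          have "chart_deriv (V, \<phi>) (a b) x w + (\<Sum>e\<in>B. - c (b, Some e) * (w \<bullet> e)) = 0" for w
            using linear_orthonormal_expand[OF B chart_deriv_linear[OF V(1) xV xW sa[OF b]], of w]
            by (simp add: c_def sum_negf mult.commute)
          then show "((\<lambda>y. a b (inv_into V \<phi> y) + g (\<lambda>i. - c i) b (inv_into V \<phi> y)) has_derivative (\<lambda>_. 0)) (at (\<phi> x))"
            using has_derivative_add[OF chart_deriv_has_derivative[OF V(1) sa[OF b] xW xV] gD[OF xV, of "\<lambda>i. - c i" b]]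
            by (simp only:)
        qed
        ultimately have "jet A E x ?u = 0" by blast
        moreover have "jet A E x ?u = jet A E x t + (\<Sum>i\<in>J. (- c i) *\<^sub>R jet A E x (\<beta> i))"
        proof -
          have "jet A E x (\<lambda>z. \<Sum>i\<in>J. (- c i) *\<^sub>R \<beta> i z) = (\<Sum>i\<in>J. (- c i) *\<^sub>R jet A E x (\<beta> i))"
            by (rule jet_comb_sections[OF \<beta>sec])
          moreover have "jet A E x ?u = jet A E x t + jet A E x (\<lambda>z. \<Sum>i\<in>J. (- c i) *\<^sub>R \<beta> i z)"
            by (rule jet_add(1)[OF t(1) sections_comb[OF fJ \<beta>sec]])
          ultimately show ?thesis by (simp only:)
        qed
        ultimately have "jet A E x t + (\<Sum>i\<in>J. (- c i) *\<^sub>R jet A E x (\<beta> i)) = 0" by (simp only:)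
        then have "k = (\<Sum>i\<in>J. c i *\<^sub>R jet A E x (\<beta> i))" using t(2) by (simp add: sum_negf)
        then show "k \<in> range (\<lambda>c. \<Sum>j\<in>J. c j *\<^sub>R jet A E x (\<beta> j))" by blast
      qed
    qed
  qed (use \<rho>(2) fJ in auto)
  moreover have "card J = dim (fib E p) * (1 + card B)"
  proof -
    have "card \<Phi> = dim (fib E p)"
      using fam_frame_dim[of "fib E" W \<Phi> "\<lambda>b. b" p] frame_is_frame[OF W(1)] W(2) by (simp add: is_frame_iff)
    then show ?thesis using fB by (simp add: J_def card_cartesian_product card_image)
  qed
  ultimately show ?thesis using that[of T J \<beta>] \<rho>(2,3) \<beta>sec by (simp add: B_def)
qed

end

section \<open>The jet bundle as a vector bundle\<close>

locale jet_bundle = smooth_bundle A E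
  for A :: "('m::{t2_space,second_countable_topology}, 'e::real_inner) chart set"
    and E :: "('m, 'v::real_vector, 'z) vbundle_scheme" +
  fixes J :: "('m, ('m, 'e, 'v) jet, 'w) vbundle_scheme"
  assumes fib_J: "fib J = jet_fib A E" and frames_J: "frames J = jet_frames A E"
begin

text \<open>\<open>jet_frames\<close> contains every frame with smooth jet coordinates, so the
  coefficients of \<open>\<sigma>\<close> have to be smooth with respect to all of these;
  \<open>jet_smooth_coefficients\<close> provides this.\<close>

lemma jet_smooth_section:
  assumes "open U" "jet_smooth_on A E U \<sigma>"
  shows "smooth_section_on A J U \<sigma>"
  unfolding smooth_section_on_def
proof (intro conjI ballI, goal_cases)
  case (1 x)
  then show ?case using assms(2) by (simp add: jet_smooth_on_def fib_J)
next
  case (2 f)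
  obtain W \<Psi> where f: "f = (W, \<Psi>)" by (cases f)
  have W: "is_frame (jet_fib A E) W \<Psi>" and \<Psi>: "\<And>\<psi>. \<psi> \<in> \<Psi> \<Longrightarrow> jet_smooth_on A E W \<psi>"
    using 2 by (auto simp: f frames_J jet_frames_def)
  have o: "open (U \<inter> W)" "finite \<Psi>" using assms(1) W by (auto simp: is_frame_def)
  have sub: "jet_smooth_on A E (U \<inter> W) \<tau>" if "jet_smooth_on A E T \<tau>" "U \<inter> W \<subseteq> T" for T \<tau>
  proof -
    have "smooth_fun_on A (U \<inter> W \<inter> V \<inter> W') f" if "smooth_fun_on A (T \<inter> V \<inter> W') f" for V W' f
      by (rule smooth_fun_subset[OF that]) (use \<open>U \<inter> W \<subseteq> T\<close> in auto)
    then show ?thesis using that section_subset by (fastforce simp: jet_smooth_on_def)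
  qed
  have "smooth_fun_on A (U \<inter> W) (\<lambda>x. coef \<Psi> x (\<sigma> x) \<psi>)" if "\<psi> \<in> \<Psi>" for \<psi>
  proof (rule jet_smooth_coefficients[where c = "\<lambda>\<psi> x. coef \<Psi> x (\<sigma> x) \<psi>" and s = "\<lambda>\<psi>. \<psi>", OF o])
    show "jet_smooth_on A E (U \<inter> W) \<psi>" if "\<psi> \<in> \<Psi>" for \<psi> by (rule sub[OF \<Psi>[OF that]]) simp
    show "indep_fam \<Psi> (\<lambda>\<psi>. \<psi> x)" if "x \<in> U \<inter> W" for x
      using W that by (auto simp: is_frame_iff fam_frame_def)
    show "jet_smooth_on A E (U \<inter> W) \<sigma>" by (rule sub[OF assms(2)]) simp
    show "\<sigma> x = (\<Sum>\<psi>\<in>\<Psi>. coef \<Psi> x (\<sigma> x) \<psi> *\<^sub>R \<psi> x)" if "x \<in> U \<inter> W" for x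
      by (rule coef_expand[OF W, symmetric]) (use that assms(2) in \<open>auto simp: jet_smooth_on_def\<close>)
  qed (rule that)
  then show ?case by (simp add: f)
qed

lemma prolongation_jet_frame:
  assumes "fam_frame (jet_fib A E) T I (\<lambda>j x. jet A E x (\<beta> j))" "\<And>j. j \<in> I \<Longrightarrow> \<beta> j \<in> sections A E"
  shows "(T, (\<lambda>j x. jet A E x (\<beta> j)) ` I) \<in> frames J"
  using fam_frame_is_frame[OF assms(1)] jet_smooth_prolongation[OF assms(2)]
  by (auto simp: frames_J jet_frames_def)

lemma jet_vector_bundle: "vector_bundle A J"
  unfolding vector_bundle_def
proof (intro conjI)
  show "smooth_atlas A" by (rule atlas)
  show "\<forall>x. subspace (fib J x)" by (simp add: fib_J jet_fib_subspace)
  have "constant_rank (fib E)" using vb by (simp add: vector_bundle_def)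
  then obtain r where r: "\<And>x. dim (fib E x) = r" by (auto simp: constant_rank_def)
  \<comment> \<open>The count in \<open>prolongation_frame\<close> depends only on the rank of
    \<open>E\<close> and on the chosen basis of the model space, hence is the same at every
    point.\<close>
  have "dim (jet_fib A E x) = r * (1 + card (SOME B::'e set. orthonormal_basis B))" for x
  proof -
    obtain T \<beta> and I :: "(('m \<Rightarrow> 'v) \<times> 'e option) set" where T: "open T" "x \<in> T"
      "fam_frame (jet_fib A E) T I (\<lambda>j x. jet A E x (\<beta> j))" "\<And>j. j \<in> I \<Longrightarrow> \<beta> j \<in> sections A E"
      "card I = dim (fib E x) * (1 + card (SOME B::'e set. orthonormal_basis B))"
      by (rule prolongation_frame[of x], rule that) (assumption | blast)+
    then show ?thesis using fam_frame_dim[OF T(3,2)] r by simp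
  qed
  then show "constant_rank (fib J)" unfolding constant_rank_def fib_J by blast
  have "x \<in> (\<Union>(U, \<Phi>)\<in>frames J. U)" for x
  proof -
    obtain T \<beta> and I :: "(('m \<Rightarrow> 'v) \<times> 'e option) set" where T: "open T" "x \<in> T"
      "fam_frame (jet_fib A E) T I (\<lambda>j x. jet A E x (\<beta> j))" "\<And>j. j \<in> I \<Longrightarrow> \<beta> j \<in> sections A E"
      "card I = dim (fib E x) * (1 + card (SOME B::'e set. orthonormal_basis B))"
      by (rule prolongation_frame[of x], rule that) (assumption | blast)+
    show ?thesis using prolongation_jet_frame[OF T(3,4)] T(2) by auto
  qed
  then show "(\<Union>(U, \<Phi>)\<in>frames J. U) = UNIV" by blast
  show "\<forall>(U, \<Phi>)\<in>frames J. is_frame (fib J) U \<Phi>" by (auto simp: frames_J jet_frames_def fib_J)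
  show "\<forall>(U, \<Phi>)\<in>frames J. \<forall>b\<in>\<Phi>. smooth_section_on A J U b"
    using jet_smooth_section by (auto simp: frames_J jet_frames_def is_frame_def)
qed

sublocale J: smooth_bundle A J
  by unfold_locales (rule jet_vector_bundle)

lemma prolongation_section: "X \<in> sections A E \<Longrightarrow> (\<lambda>x. jet A E x X) \<in> sections A J"
  using jet_smooth_section[OF open_UNIV jet_smooth_prolongation] by (simp add: sections_def)

lemma section_fst:
  assumes U: "open U" and s: "smooth_section_on A J U \<sigma>"
  shows "smooth_section_on A E U (\<lambda>x. fst (\<sigma> x))"
proof (rule section_local)
  fix p assume p: "p \<in> U"
  obtain W \<Psi> where W: "(W, \<Psi>) \<in> frames J" "p \<in> W" by (rule J.frame_around)
  have \<Psi>: "smooth_section_on A E W (\<lambda>x. fst (\<psi> x))" if "\<psi> \<in> \<Psi>" for \<psi>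
    using W(1) that by (auto simp: frames_J jet_frames_def jet_smooth_on_def)
  have o: "open (U \<inter> W)" "finite \<Psi>" using U J.frame_open[OF W(1)] J.frame_finite[OF W(1)] by auto
  have "smooth_section_on A E (U \<inter> W) (\<lambda>x. \<Sum>\<psi>\<in>\<Psi>. coef \<Psi> x (\<sigma> x) \<psi> *\<^sub>R fst (\<psi> x))"
    by (rule section_comb[OF o J.section_coef[OF s W(1)] section_subset[OF \<Psi>]]) auto
  then have "smooth_section_on A E (U \<inter> W) (\<lambda>x. fst (\<sigma> x))"
  proof (rule section_cong[OF o(1)])
    fix x assume x: "x \<in> U \<inter> W"
    have "fst (\<sigma> x) = fst (\<Sum>\<psi>\<in>\<Psi>. coef \<Psi> x (\<sigma> x) \<psi> *\<^sub>R \<psi> x)"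
      using coef_expand[OF J.frame_is_frame[OF W(1)], of x "\<sigma> x"] J.section_fib[OF s] x by simp
    then show "(\<Sum>\<psi>\<in>\<Psi>. coef \<Psi> x (\<sigma> x) \<psi> *\<^sub>R fst (\<psi> x)) = fst (\<sigma> x)" by (simp add: fst_comb)
  qed
  then show "\<exists>T. open T \<and> p \<in> T \<and> smooth_section_on A E T (\<lambda>x. fst (\<sigma> x))" using o p W(2) by blast
qed

lemma sections_fst: "\<sigma> \<in> sections A J \<Longrightarrow> (\<lambda>x. fst (\<sigma> x)) \<in> sections A E"
  using section_fst[OF open_UNIV] by (simp add: sections_def)

end

section \<open>Kernels, intersections and subbundles\<close>

lemma comb_in_subspace:
  "subspace S \<Longrightarrow> (\<And>j. j \<in> J \<Longrightarrow> s j \<in> S) \<Longrightarrow> (\<Sum>j\<in>J. c j *\<^sub>R s j) \<in> S"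
  by (intro subspace_sum subspace_scale)

text \<open>A maximal element exists among the finitely many independent subfamilies containing
  \<open>K0\<close>. Prescribing \<open>K0\<close> allows a family selected at one point to be
  enlarged at nearby points.\<close>

lemma maximal_indep_fam:
  assumes J: "finite J" and K0: "K0 \<subseteq> J" "indep_fam K0 v"
  shows "\<exists>K. K0 \<subseteq> K \<and> K \<subseteq> J \<and> indep_fam K v \<and> (\<forall>l\<in>J. \<exists>c. v l = (\<Sum>k\<in>K. c k *\<^sub>R v k))"
proof -
  let ?\<K> = "{K. K0 \<subseteq> K \<and> K \<subseteq> J \<and> indep_fam K v}"
  have "finite ?\<K>" by (rule finite_subset[of _ "Pow J"]) (use J in auto)
  moreover have "K0 \<in> ?\<K>" using K0 by simp
  ultimately have "\<exists>K\<in>?\<K>. \<forall>K'\<in>?\<K>. K \<subseteq> K' \<longrightarrow> K = K'"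
    by (intro finite_has_maximal) auto
  then obtain K where K: "K \<in> ?\<K>" and max: "\<And>K'. K' \<in> ?\<K> \<Longrightarrow> K \<subseteq> K' \<Longrightarrow> K = K'"
    by (elim bexE) blast
  have fK: "finite K" using K J finite_subset by auto
  have i: "inj_on v K" "independent (v ` K)" using K indep_fam_iff[OF fK] by auto
  have "\<exists>c. v l = (\<Sum>k\<in>K. c k *\<^sub>R v k)" if l: "l \<in> J" for l
  proof (rule ccontr)
    assume "\<nexists>c. v l = (\<Sum>k\<in>K. c k *\<^sub>R v k)"
    then have n: "v l \<notin> span (v ` K)" using span_fam[OF fK i(1)] by auto
    then have lK: "v l \<notin> v ` K" by (metis span_base)
    then have "inj_on v (insert l K)" using i(1) by auto
    moreover have "independent (v ` insert l K)" using independent_insertI[OF n i(2)] by simp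
    ultimately have "indep_fam (insert l K) v" using fK indep_fam_iff[of "insert l K" v] by blast
    then have "K = insert l K" using max[of "insert l K"] K l by blast
    then show False using lK by blast
  qed
  then show ?thesis using K by blast
qed

text \<open>\<open>K\<close> indexes a basis of the image of the linear map that sends \<open>s j\<close> to \<open>v j\<close>.\<close>

lemma kernel_basis:
  fixes s v :: "'j \<Rightarrow> 'v::real_vector"
  assumes J: "finite J" "K \<subseteq> J" and s: "indep_fam J s" and v: "indep_fam K v"
    and m: "\<And>l. l \<in> J - K \<Longrightarrow> v l = (\<Sum>k\<in>K. m l k *\<^sub>R v k)"
  defines "\<kappa> \<equiv> \<lambda>l. s l - (\<Sum>k\<in>K. m l k *\<^sub>R s k)"
  shows "indep_fam (J - K) \<kappa>"
    and "{\<Sum>j\<in>J. c j *\<^sub>R s j | c. (\<Sum>j\<in>J. c j *\<^sub>R v j) = 0} = range (\<lambda>d. \<Sum>l\<in>J - K. d l *\<^sub>R \<kappa> l)"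
proof -
  have fK: "finite K" using J finite_subset by auto
  \<comment> \<open>Coefficients of the combination of the \<open>\<kappa> l\<close> in the original
    family: unchanged off \<open>K\<close>, and on \<open>K\<close> collected from the subtracted
    terms.\<close>
  define e where "e d j = (if j \<in> K then - (\<Sum>l\<in>J - K. d l * m l j) else d j)" for d :: "'j \<Rightarrow> real" and j
  have split: "(\<Sum>j\<in>J. c j *\<^sub>R w j) = (\<Sum>l\<in>J - K. c l *\<^sub>R w l) + (\<Sum>k\<in>K. c k *\<^sub>R w k)"
    for c and w :: "'j \<Rightarrow> 'v"
    by (rule sum.subset_diff[OF J(2,1)])
  \<comment> \<open>The identity is kept general in \<open>w\<close>: for \<open>s\<close> it
    expands the \<open>\<kappa> l\<close>, and for \<open>v\<close> every term on the left vanishes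
    by \<open>m\<close>.\<close>
  have swap: "(\<Sum>l\<in>J - K. d l *\<^sub>R (w l - (\<Sum>k\<in>K. m l k *\<^sub>R w k))) = (\<Sum>j\<in>J. e d j *\<^sub>R w j)"
    for d and w :: "'j \<Rightarrow> 'v"
  proof -
    have "(\<Sum>j\<in>J. e d j *\<^sub>R w j) = (\<Sum>l\<in>J - K. d l *\<^sub>R w l) + (\<Sum>k\<in>K. (- (\<Sum>l\<in>J - K. d l * m l k)) *\<^sub>R w k)"
      unfolding split by (simp add: e_def)
    also have "(\<Sum>k\<in>K. (- (\<Sum>l\<in>J - K. d l * m l k)) *\<^sub>R w k) = - (\<Sum>k\<in>K. \<Sum>l\<in>J - K. (d l * m l k) *\<^sub>R w k)"
      by (simp add: scaleR_sum_left sum_negf)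
    also have "(\<Sum>k\<in>K. \<Sum>l\<in>J - K. (d l * m l k) *\<^sub>R w k) = (\<Sum>l\<in>J - K. d l *\<^sub>R (\<Sum>k\<in>K. m l k *\<^sub>R w k))"
      by (subst sum.swap) (simp add: scaleR_sum_right)
    finally show ?thesis by (simp add: scaleR_diff_right sum_subtractf)
  qed
  show "indep_fam (J - K) \<kappa>" unfolding indep_fam_def
  proof (intro allI impI ballI)
    fix d l assume "(\<Sum>l\<in>J - K. d l *\<^sub>R \<kappa> l) = 0" and l: "l \<in> J - K"
    then have "(\<Sum>j\<in>J. e d j *\<^sub>R s j) = 0" by (simp add: \<kappa>_def swap)
    then have "e d l = 0" using l by (intro indep_famD[OF s]) auto
    then show "d l = 0" using l by (simp add: e_def)
  qed
  show "{\<Sum>j\<in>J. c j *\<^sub>R s j | c. (\<Sum>j\<in>J. c j *\<^sub>R v j) = 0} = range (\<lambda>d. \<Sum>l\<in>J - K. d l *\<^sub>R \<kappa> l)" (is "?G = ?R")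
  proof
    show "?R \<subseteq> ?G"
    proof
      fix u assume "u \<in> ?R"
      then obtain d where "u = (\<Sum>j\<in>J. e d j *\<^sub>R s j)" by (auto simp: \<kappa>_def swap)
      moreover have "(\<Sum>j\<in>J. e d j *\<^sub>R v j) = 0"
        unfolding swap[symmetric] by (intro sum.neutral) (simp add: m[symmetric])
      ultimately show "u \<in> ?G" by blast
    qed
    show "?G \<subseteq> ?R"
    proof
      fix u assume "u \<in> ?G"
      then obtain c where c: "u = (\<Sum>j\<in>J. c j *\<^sub>R s j)" "(\<Sum>j\<in>J. c j *\<^sub>R v j) = 0" by auto
      \<comment> \<open>Both \<open>c\<close> and \<open>e c\<close> solve the same linear equation
        and agree off \<open>K\<close>; independence of the \<open>v k\<close> with \<open>k\<close>
        in \<open>K\<close> makes them agree on \<open>K\<close> too.\<close>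
      have "(\<Sum>j\<in>J. e c j *\<^sub>R v j) = 0"
        unfolding swap[symmetric] by (intro sum.neutral) (simp add: m[symmetric])
      then have "(\<Sum>k\<in>K. c k *\<^sub>R v k) = (\<Sum>k\<in>K. e c k *\<^sub>R v k)"
        using c(2) unfolding split[of _ v] by (simp add: e_def add_eq_0_iff)
      then have "c k = e c k" if "k \<in> K" for k using indep_fam_unique[OF v] that by blast
      then have "c j = e c j" if "j \<in> J" for j using that by (cases "j \<in> K") (auto simp: e_def)
      then have "u = (\<Sum>j\<in>J. e c j *\<^sub>R s j)" using c(1) by simp
      then have "u = (\<Sum>l\<in>J - K. c l *\<^sub>R \<kappa> l)" by (simp add: \<kappa>_def swap)
      then show "u \<in> ?R" by blast
    qed
  qed
qed

lemma fam_dim: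
  assumes "finite I" "indep_fam I s"
  shows "dim (range (\<lambda>c. \<Sum>i\<in>I. c i *\<^sub>R s i)) = card I"
proof -
  have i: "inj_on s I" "independent (s ` I)" using assms indep_fam_iff by auto
  show ?thesis unfolding span_fam[OF assms(1) i(1), symmetric] dim_span
    using i by (simp add: dim_eq_card_independent card_image)
qed

context smooth_bundle
begin

text \<open>The \<open>v k\<close> with \<open>k\<close> in \<open>K\<close> stay independent near
  \<open>p\<close>, so their rank cannot drop; it cannot rise either, as the kernel would become
  smaller. Thus \<open>K\<close> stays maximal, the coefficients \<open>m\<close> are smooth, and
  \<open>kernel_basis\<close> applies at each nearby point with the same index set.\<close>

lemma kernel_frame:
  fixes J :: "'j set"
  assumes U: "open U" "p \<in> U" "finite J"
    and s: "\<And>j. j \<in> J \<Longrightarrow> smooth_section_on A E U (s j)" and si: "\<And>x. x \<in> U \<Longrightarrow> indep_fam J (\<lambda>j. s j x)"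
    and v: "\<And>j. j \<in> J \<Longrightarrow> smooth_section_on A E U (v j)"
    and G: "constant_rank G" "\<And>x. x \<in> U \<Longrightarrow> G x = {\<Sum>j\<in>J. c j *\<^sub>R s j x | c. (\<Sum>j\<in>J. c j *\<^sub>R v j x) = 0}"
  obtains T I and u :: "'j \<Rightarrow> 'm \<Rightarrow> 'v" where "open T" "p \<in> T" "fam_frame G T I u"
    "\<And>i. i \<in> I \<Longrightarrow> smooth_section_on A E T (u i)"
proof -
  have "indep_fam {} (\<lambda>j. v j p)" by (simp add: indep_fam_def)
  from maximal_indep_fam[OF U(3) empty_subsetI this]
  obtain K where K: "K \<subseteq> J" "indep_fam K (\<lambda>j. v j p)"
    "\<And>l. l \<in> J \<Longrightarrow> \<exists>c. v l p = (\<Sum>k\<in>K. c k *\<^sub>R v k p)"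
    by blast
  have fK: "finite K" using K(1) U(3) finite_subset by auto
  obtain r where r: "\<And>x. dim (G x) = r" using G(1) by (auto simp: constant_rank_def)
  \<comment> \<open>The constant dimension of \<open>G\<close> fixes the size of every maximal
    independent subfamily at every point; below this forces an enlargement \<open>K'\<close> of
    \<open>K\<close> to equal \<open>K\<close>.\<close>
  have dimG: "r = card (J - K')"
    if x: "x \<in> U" and K': "K' \<subseteq> J" "indep_fam K' (\<lambda>j. v j x)"
      "\<And>l. l \<in> J \<Longrightarrow> \<exists>c. v l x = (\<Sum>k\<in>K'. c k *\<^sub>R v k x)" for x K'
  proof -
    obtain m where m: "\<And>l. l \<in> J \<Longrightarrow> v l x = (\<Sum>k\<in>K'. m l k *\<^sub>R v k x)" using K'(3) by metis
    have "G x = range (\<lambda>d. \<Sum>l\<in>J - K'. d l *\<^sub>R (s l x - (\<Sum>k\<in>K'. m l k *\<^sub>R s k x)))"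
      unfolding G(2)[OF x] by (rule kernel_basis(2)[OF U(3) K'(1) si[OF x] K'(2) m]) simp
    moreover have "indep_fam (J - K') (\<lambda>l. s l x - (\<Sum>k\<in>K'. m l k *\<^sub>R s k x))"
      by (rule kernel_basis(1)[OF U(3) K'(1) si[OF x] K'(2) m]) simp
    from fam_dim[OF finite_Diff[OF U(3)] this] calculation show ?thesis using r[of x] by simp
  qed
  have rK: "r = card (J - K)" by (rule dimG[OF U(2) K])
  obtain T where T: "open T" "p \<in> T" "T \<subseteq> U" "\<And>x. x \<in> T \<Longrightarrow> indep_fam K (\<lambda>j. v j x)"
    using indep_fam_open[where s = v, OF U(1,2) fK _ K(2)] v K(1) by blast
  have "\<exists>c. v l x = (\<Sum>k\<in>K. c k *\<^sub>R v k x)" if x: "x \<in> T" and l: "l \<in> J" for x l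
  proof -
    obtain K' where K': "K \<subseteq> K'" "K' \<subseteq> J" "indep_fam K' (\<lambda>j. v j x)"
      "\<And>l. l \<in> J \<Longrightarrow> \<exists>c. v l x = (\<Sum>k\<in>K'. c k *\<^sub>R v k x)"
      using maximal_indep_fam[OF U(3) K(1) T(4)[OF x]] by blast
    have "x \<in> U" using x T(3) by auto
    then have "card (J - K') = card (J - K)" using dimG[OF _ K'(2-4)] rK by simp
    then have "J - K' = J - K" using K' U(3) by (intro card_subset_eq) auto
    then have "K' = K" using K' K(1) by blast
    then show ?thesis using K'(4)[OF l] by simp
  qed
  then have "\<forall>l\<in>J. \<forall>x\<in>T. \<exists>c. v l x = (\<Sum>k\<in>K. c k *\<^sub>R v k x)" by blast
  then obtain m where m: "\<And>l x. l \<in> J \<Longrightarrow> x \<in> T \<Longrightarrow> v l x = (\<Sum>k\<in>K. m l x k *\<^sub>R v k x)" by metis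
  have sm: "smooth_fun_on A T (\<lambda>x. m l x k)" if "l \<in> J" "k \<in> K" for l k
    by (rule smooth_coefficients[where c = "\<lambda>k x. m l x k" and s = v, OF T(1) fK _ T(4)
          section_subset[OF v[OF that(1)] T(3)] m[OF that(1)] that(2)])
       (use section_subset[OF v T(3)] K(1) in auto)
  define u where "u l x = s l x - (\<Sum>k\<in>K. m l x k *\<^sub>R s k x)" for l x
  have "smooth_section_on A E T (u l)" if "l \<in> J - K" for l
    unfolding u_def[abs_def]
    by (rule section_diff[OF T(1) section_subset[OF s T(3)] section_comb[OF T(1) fK sm section_subset[OF s T(3)]]])
       (use that K(1) in auto)
  moreover have "fam_frame G T (J - K) u"
    unfolding fam_frame_def
  proof (intro conjI ballI)
    fix x assume x: "x \<in> T"
    then have xU: "x \<in> U" using T(3) by auto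
    show "indep_fam (J - K) (\<lambda>l. u l x)" unfolding u_def
      by (rule kernel_basis(1)[OF U(3) K(1) si[OF xU] T(4)[OF x] m]) (use x in auto)
    show "G x = range (\<lambda>c. \<Sum>l\<in>J - K. c l *\<^sub>R u l x)" unfolding u_def G(2)[OF xU]
      by (rule kernel_basis(2)[OF U(3) K(1) si[OF xU] T(4)[OF x] m]) (use x in auto)
  qed (use T(1) U(3) in auto)
  ultimately show ?thesis using that[of T "J - K" u] T(1,2) by blast
qed

text \<open>Since \<open>F2\<close> is the fixed set of a smooth linear map \<open>P\<close>, the
  intersection is the kernel on \<open>F1\<close> of the identity minus \<open>P\<close>. The
  \<open>v j\<close> are the images of the frame of \<open>F1\<close> under that difference.\<close>

lemma intersection_frame:
  fixes s :: "'j \<Rightarrow> 'm \<Rightarrow> 'v" and t :: "'k \<Rightarrow> 'm \<Rightarrow> 'v"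
  assumes U: "open U" "p \<in> U"
    and F1: "fam_frame F1 U J s" and s: "\<And>j. j \<in> J \<Longrightarrow> smooth_section_on A E U (s j)"
    and F2: "fam_frame F2 U K t" and t: "\<And>k. k \<in> K \<Longrightarrow> smooth_section_on A E U (t k)"
    and G: "constant_rank (\<lambda>x. F1 x \<inter> F2 x)"
  obtains T I and u :: "'j \<Rightarrow> 'm \<Rightarrow> 'v" where "open T" "p \<in> T" "fam_frame (\<lambda>x. F1 x \<inter> F2 x) T I u"
    "\<And>i. i \<in> I \<Longrightarrow> smooth_section_on A E T (u i)"
proof -
  have fJ: "finite J" and fK: "finite K" using F1 F2 by (auto simp: fam_frame_def)
  obtain W \<Psi> where W: "(W, \<Psi>) \<in> frames E" "p \<in> W" by (rule frame_around)
  let ?S = "U \<inter> W"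
  have o: "open ?S" "p \<in> ?S" using U W frame_open[OF W(1)] by auto
  have it: "indep_fam K (\<lambda>k. t k x)" if "x \<in> U" for x using F2 that by (auto simp: fam_frame_def)
  have si: "indep_fam J (\<lambda>j. s j x)" if "x \<in> U" for x using F1 that by (auto simp: fam_frame_def)
  obtain m where m: "\<forall>k\<in>K. \<forall>\<psi>\<in>\<Psi>. smooth_fun_on A ?S (m k \<psi>)"
    "\<forall>x\<in>?S. \<forall>c. \<forall>k\<in>K. (\<Sum>\<psi>\<in>\<Psi>. m k \<psi> x * coef \<Psi> x (\<Sum>j\<in>K. c j *\<^sub>R t j x) \<psi>) = c k"
    using frame_left_inverse[where s = t, OF W(1) U(1) fK t it] by blast
  \<comment> \<open>\<open>P\<close> is a smooth fibrewise projection onto \<open>F2\<close>.\<close>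
  define q where "q k x w = (\<Sum>\<psi>\<in>\<Psi>. m k \<psi> x * coef \<Psi> x w \<psi>)" for k x w
  define P where "P x w = (\<Sum>k\<in>K. q k x w *\<^sub>R t k x)" for x w
  define v where "v j x = s j x - P x (s j x)" for j x
  have sq: "smooth_fun_on A ?S (\<lambda>x. q k x (s j x))" if "k \<in> K" "j \<in> J" for k j
    unfolding q_def
    by (rule smooth_fun_sum[OF o(1)], rule smooth_fun_mult[OF o(1)])
       (use m(1) that section_coef[OF s[OF that(2)] W(1)] in auto)
  have sv: "smooth_section_on A E ?S (v j)" if "j \<in> J" for j
    unfolding v_def[abs_def] P_def
    by (rule section_diff[OF o(1) section_subset[OF s[OF that]] section_comb[OF o(1) fK sq section_subset[OF t]]])
       (use that in auto)
  have sfib: "s j x \<in> fib E x" if "j \<in> J" "x \<in> U" for j x using section_fib[OF s[OF that(1)] that(2)] .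
  have Pcomb: "P x (\<Sum>j\<in>J. c j *\<^sub>R s j x) = (\<Sum>j\<in>J. c j *\<^sub>R P x (s j x))" if x: "x \<in> ?S" for x c
  proof -
    have "q k x (\<Sum>j\<in>J. c j *\<^sub>R s j x) = (\<Sum>j\<in>J. c j * q k x (s j x))" for k
    proof -
      have "q k x (\<Sum>j\<in>J. c j *\<^sub>R s j x) = (\<Sum>\<psi>\<in>\<Psi>. m k \<psi> x * (\<Sum>j\<in>J. c j * coef \<Psi> x (s j x) \<psi>))"
        unfolding q_def by (rule sum.cong) (use frame_coordinates(1)[OF W(1), of x J "\<lambda>j. s j x"] sfib x in auto)
      also have "\<dots> = (\<Sum>\<psi>\<in>\<Psi>. \<Sum>j\<in>J. c j * (m k \<psi> x * coef \<Psi> x (s j x) \<psi>))"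
        by (simp only: sum_distrib_left ac_simps)
      also have "\<dots> = (\<Sum>j\<in>J. c j * q k x (s j x))"
        unfolding q_def by (subst sum.swap) (simp only: sum_distrib_left)
      finally show ?thesis .
    qed
    then have "P x (\<Sum>j\<in>J. c j *\<^sub>R s j x) = (\<Sum>k\<in>K. \<Sum>j\<in>J. c j *\<^sub>R q k x (s j x) *\<^sub>R t k x)"
      unfolding P_def by (simp add: scaleR_sum_left)
    also have "\<dots> = (\<Sum>j\<in>J. c j *\<^sub>R P x (s j x))"
      unfolding P_def by (subst sum.swap) (simp add: scaleR_sum_right)
    finally show ?thesis .
  qed
  have Pfix: "w \<in> F2 x \<longleftrightarrow> P x w = w" if x: "x \<in> ?S" for x w
  proof
    assume "w \<in> F2 x"
    then obtain c where w: "w = (\<Sum>k\<in>K. c k *\<^sub>R t k x)" using F2 x by (auto simp: fam_frame_def)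
    have "q k x w = c k" if "k \<in> K" for k using m(2) x that by (simp add: q_def w)
    then show "P x w = w" by (simp add: P_def w)
  next
    assume "P x w = w"
    then have "w = (\<Sum>k\<in>K. q k x w *\<^sub>R t k x)" by (simp add: P_def)
    then show "w \<in> F2 x" using F2 x by (auto simp: fam_frame_def)
  qed
  have vcomb: "(\<Sum>j\<in>J. c j *\<^sub>R v j x) = 0 \<longleftrightarrow> (\<Sum>j\<in>J. c j *\<^sub>R s j x) \<in> F2 x" if x: "x \<in> ?S" for x c
    using Pfix[OF x] Pcomb[OF x, of c] by (auto simp: v_def scaleR_diff_right sum_subtractf)
  have G2: "F1 x \<inter> F2 x = {\<Sum>j\<in>J. c j *\<^sub>R s j x | c. (\<Sum>j\<in>J. c j *\<^sub>R v j x) = 0}" if x: "x \<in> ?S" for x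
    using F1 vcomb[OF x] x by (auto simp: fam_frame_def)
  show ?thesis
    by (rule kernel_frame[where s = s and v = v, OF o fJ section_subset[OF s] si sv G G2]) (use that in auto)
qed

end

section \<open>Subbundles as bundles, and comparison of jets\<close>

locale sub_bundle = smooth_bundle A E
  for A :: "('m::{t2_space,second_countable_topology}, 'e::real_inner) chart set"
    and E :: "('m, 'v::real_vector, 'z) vbundle_scheme" +
  fixes F :: "'m \<Rightarrow> 'v set" and E1 :: "('m, 'v, 'y) vbundle_scheme"
  assumes sub: "subbundle A E F" and fib_E1: "fib E1 = F" and frames_E1: "frames E1 = sub_frames A E F"
begin

lemma sub_frame:
  assumes "(W, \<Phi>) \<in> frames E1"
  shows "is_frame F W \<Phi>" "fam_frame F W \<Phi> (\<lambda>b. b)" "\<And>b. b \<in> \<Phi> \<Longrightarrow> smooth_section_on A E W b"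
  using assms by (auto simp: frames_E1 sub_frames_def is_frame_iff)

lemma sub_frame_around:
  obtains W \<Phi> where "(W, \<Phi>) \<in> frames E1" "x \<in> W"
proof -
  have "x \<in> (\<Union>(U, \<Phi>)\<in>frames E1. U)" using sub by (simp add: subbundle_def frames_E1)
  then show ?thesis using that by auto
qed

text \<open>A frame of \<open>F\<close> is an independent family of smooth sections of
  \<open>E\<close>, so \<open>smooth_coefficients\<close> in \<open>E\<close> applies to it.\<close>

lemma sub_sectionI:
  assumes U: "open U" and s: "smooth_section_on A E U s" "\<And>x. x \<in> U \<Longrightarrow> s x \<in> F x"
  shows "smooth_section_on A E1 U s"
  unfolding smooth_section_on_def
proof (intro conjI ballI, goal_cases)
  case (1 x)
  then show ?case using s(2) by (simp add: fib_E1)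
next
  case (2 f)
  obtain W \<Phi> where f: "f = (W, \<Phi>)" by (cases f)
  have W: "(W, \<Phi>) \<in> frames E1" using 2 f by simp
  have oW: "open W" "finite \<Phi>" using sub_frame(1)[OF W] by (auto simp: is_frame_def)
  have o: "open (U \<inter> W)" using U oW by auto
  have "smooth_fun_on A (U \<inter> W) (\<lambda>x. coef \<Phi> x (s x) b)" if "b \<in> \<Phi>" for b
  proof (rule smooth_coefficients[where c = "\<lambda>b x. coef \<Phi> x (s x) b" and s = "\<lambda>b. b", OF o oW(2)])
    show "smooth_section_on A E (U \<inter> W) b" if "b \<in> \<Phi>" for b
      by (rule section_subset[OF sub_frame(3)[OF W that]]) simp
    show "indep_fam \<Phi> (\<lambda>b. b x)" if "x \<in> U \<inter> W" for x
      using sub_frame(2)[OF W] that by (auto simp: fam_frame_def)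
    show "smooth_section_on A E (U \<inter> W) s" by (rule section_subset[OF s(1)]) simp
    show "s x = (\<Sum>b\<in>\<Phi>. coef \<Phi> x (s x) b *\<^sub>R b x)" if "x \<in> U \<inter> W" for x
      by (rule coef_expand[OF sub_frame(1)[OF W], symmetric]) (use that s(2) in auto)
  qed (rule that)
  then show ?case by (simp add: f)
qed

lemma sub_vector_bundle: "vector_bundle A E1"
  unfolding vector_bundle_def
proof (intro conjI)
  show "\<forall>(U, \<Phi>)\<in>frames E1. is_frame (fib E1) U \<Phi>" using sub_frame(1) by (auto simp: fib_E1)
  show "\<forall>(U, \<Phi>)\<in>frames E1. \<forall>b\<in>\<Phi>. smooth_section_on A E1 U b"
  proof (clarify)
    fix U \<Phi> b assume W: "(U, \<Phi>) \<in> frames E1" and b: "b \<in> \<Phi>"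
    have "b x \<in> F x" if "x \<in> U" for x
      using sub_frame(1)[OF W] that b span_base[of "b x" "(\<lambda>b. b x) ` \<Phi>"] by (auto simp: is_frame_def)
    then show "smooth_section_on A E1 U b"
      using sub_frame(1)[OF W] by (intro sub_sectionI sub_frame(3)[OF W b]) (auto simp: is_frame_def)
  qed
qed (use atlas sub in \<open>auto simp: subbundle_def fib_E1 frames_E1\<close>)

sublocale E1: smooth_bundle A E1
  by unfold_locales (rule sub_vector_bundle)

lemma sub_sectionD:
  assumes U: "open U" and s: "smooth_section_on A E1 U s"
  shows "smooth_section_on A E U s" "\<And>x. x \<in> U \<Longrightarrow> s x \<in> F x"
proof -
  show "s x \<in> F x" if "x \<in> U" for x using E1.section_fib[OF s that] by (simp add: fib_E1)
  show "smooth_section_on A E U s"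
  proof (rule section_local)
    fix p assume p: "p \<in> U"
    obtain W \<Phi> where W: "(W, \<Phi>) \<in> frames E1" "p \<in> W" by (rule sub_frame_around)
    have o: "open (U \<inter> W)" "finite \<Phi>" using U sub_frame(1)[OF W(1)] by (auto simp: is_frame_def)
    have "smooth_section_on A E (U \<inter> W) (\<lambda>x. \<Sum>b\<in>\<Phi>. coef \<Phi> x (s x) b *\<^sub>R b x)"
      by (rule section_comb[OF o E1.section_coef[OF s W(1)] section_subset[OF sub_frame(3)[OF W(1)]]]) auto
    then have "smooth_section_on A E (U \<inter> W) s"
      by (rule section_cong[OF o(1)])
         (use coef_expand[OF sub_frame(1)[OF W(1)]] E1.section_fib[OF s] in \<open>auto simp: fib_E1\<close>)
    then show "\<exists>T. open T \<and> p \<in> T \<and> smooth_section_on A E T s" using o p W(2) by blast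
  qed
qed

lemma sub_sections_iff: "s \<in> sections A E1 \<longleftrightarrow> s \<in> sections A E \<and> (\<forall>x. s x \<in> F x)"
  using sub_sectionI[OF open_UNIV] sub_sectionD[OF open_UNIV] by (auto simp: sections_def)

text \<open>A frame of \<open>F\<close> belongs to the frames of \<open>E1\<close> and is an
  independent family of sections of \<open>E\<close>; the vanishing of either jet means flatness of
  the very same coefficients.\<close>

lemma sub_jet_zero_iff:
  assumes s: "s \<in> sections A E1"
  shows "jet A E1 x s = 0 \<longleftrightarrow> jet A E x s = 0"
proof -
  obtain W \<Phi> where W: "(W, \<Phi>) \<in> frames E1" "x \<in> W" by (rule sub_frame_around)
  have o: "open W" "finite \<Phi>" using sub_frame(1)[OF W(1)] by (auto simp: is_frame_def)
  have i: "indep_fam \<Phi> (\<lambda>b. b z)" if "z \<in> W" for z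
    using sub_frame(2)[OF W(1)] that by (auto simp: fam_frame_def)
  have e: "s z = (\<Sum>b\<in>\<Phi>. coef \<Phi> z (s z) b *\<^sub>R b z)" if "z \<in> W" for z
    by (rule coef_expand[OF sub_frame(1)[OF W(1)] that, symmetric]) (use s sub_sections_iff in auto)
  have "jet A E1 x s = 0 \<longleftrightarrow> (\<forall>b\<in>\<Phi>. flat_at A x (\<lambda>z. coef \<Phi> z (s z) b))"
    by (rule E1.jet_zero_iff_flat_coefficients[OF o(1) W(2) o(2) E1.frame_smooth[OF W(1)] i E1.sections_on[OF s] e])
  moreover have "jet A E x s = 0 \<longleftrightarrow> (\<forall>b\<in>\<Phi>. flat_at A x (\<lambda>z. coef \<Phi> z (s z) b))"
    by (rule jet_zero_iff_flat_coefficients[OF o(1) W(2) o(2) sub_frame(3)[OF W(1)] i sections_on e])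
       (use s sub_sections_iff in auto)
  ultimately show ?thesis by simp
qed

end

section \<open>Lie algebroids and their jets\<close>

context smooth_bundle
begin

lemma sections_fib: "s \<in> sections A E \<Longrightarrow> s x \<in> fib E x"
  using section_fib[of UNIV] by (simp add: sections_def)

lemma sections_add: "s \<in> sections A E \<Longrightarrow> t \<in> sections A E \<Longrightarrow> (\<lambda>x. s x + t x) \<in> sections A E"
  using section_add[OF open_UNIV] by (simp add: sections_def)

lemma sections_scale: "smooth_fun_on A UNIV f \<Longrightarrow> s \<in> sections A E \<Longrightarrow> (\<lambda>x. f x *\<^sub>R s x) \<in> sections A E"
  using section_scale[OF open_UNIV] by (simp add: sections_def)

text \<open>A predicate \<open>Q\<close> on sections (typically about values at \<open>p\<close>) only has to be checked on a local
  frame of global sections. Cutting off with a bump function that is \<open>1\<close> at \<open>p\<close> makes every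
  \<open>F\<close>-valued section a global combination of the frame.\<close>

lemma local_generation:
  assumes fr: "fam_frame F U I \<beta>" and \<beta>: "\<And>i. i \<in> I \<Longrightarrow> \<beta> i \<in> sections A E" "\<And>i x. i \<in> I \<Longrightarrow> \<beta> i x \<in> F x"
    and p: "p \<in> U"
    and gen: "\<And>i. i \<in> I \<Longrightarrow> Q (\<beta> i)" and zero: "Q (\<lambda>x. 0)"
    and add: "\<And>s t. s \<in> sections A E \<Longrightarrow> t \<in> sections A E \<Longrightarrow> Q s \<Longrightarrow> Q t \<Longrightarrow> Q (\<lambda>x. s x + t x)"
    and scale: "\<And>f s. smooth_fun_on A UNIV f \<Longrightarrow> s \<in> sections A E \<Longrightarrow> s p \<in> F p \<Longrightarrow> Q s \<Longrightarrow>
      Q (\<lambda>x. f x *\<^sub>R s x)"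
    and cancel: "\<And>f s. smooth_fun_on A UNIV f \<Longrightarrow> f p = 1 \<Longrightarrow> s \<in> sections A E \<Longrightarrow> s p \<in> F p \<Longrightarrow>
      Q (\<lambda>x. f x *\<^sub>R s x) \<Longrightarrow> Q s"
    and \<sigma>: "\<sigma> \<in> sections A E" "\<And>x. \<sigma> x \<in> F x"
  shows "Q \<sigma>"
proof -
  have oU: "open U" and fI: "finite I" using fr by (auto simp: fam_frame_def)
  have "\<exists>c. (\<forall>i\<in>I. smooth_fun_on A U (c i)) \<and> (\<forall>x\<in>U. \<sigma> x = (\<Sum>i\<in>I. c i x *\<^sub>R \<beta> i x))"
    (is "\<exists>c. ?P c")
  proof (rule fam_frame_coefficients[OF fr sections_on[OF \<beta>(1)] sections_on[OF \<sigma>(1)] \<sigma>(2) oU order_refl])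
    show "\<exists>c. ?P c" if "\<And>i. i \<in> I \<Longrightarrow> smooth_fun_on A U (c i)"
      "\<And>x. x \<in> U \<Longrightarrow> \<sigma> x = (\<Sum>i\<in>I. c i x *\<^sub>R \<beta> i x)" for c
      using that by (intro exI[of _ c]) simp
  qed
  then obtain c where c: "\<And>i. i \<in> I \<Longrightarrow> smooth_fun_on A U (c i)" "\<And>x. x \<in> U \<Longrightarrow> \<sigma> x = (\<Sum>i\<in>I. c i x *\<^sub>R \<beta> i x)"
    by blast
  obtain \<rho> T K where \<rho>: "smooth_fun_on A UNIV \<rho>" "open T" "p \<in> T" "T \<subseteq> U" "\<And>x. x \<in> T \<Longrightarrow> \<rho> x = 1"
    "closed K" "K \<subseteq> U" "\<And>x. x \<notin> K \<Longrightarrow> \<rho> x = 0"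
    by (rule bump_function[OF oU p]) auto
  \<comment> \<open>The cut-off coefficients are globally smooth, and with them the sections
    \<open>\<beta> i\<close> combine to \<open>\<rho>\<close> times \<open>\<sigma>\<close> on the
    whole manifold, not only on \<open>U\<close>.\<close>
  define f where "f i x = (if x \<in> U then \<rho> x * c i x else 0)" for i x
  have sf: "smooth_fun_on A UNIV (f i)" if "i \<in> I" for i
    unfolding f_def[abs_def] by (rule cutoff_smooth_fun[OF \<rho>(1) oU \<rho>(6-8) c(1)[OF that]])
  have Qsum: "Q (\<lambda>x. \<Sum>i\<in>H. f i x *\<^sub>R \<beta> i x) \<and> (\<lambda>x. \<Sum>i\<in>H. f i x *\<^sub>R \<beta> i x) \<in> sections A E" if "H \<subseteq> I" for H
    using finite_subset[OF that fI] that
  proof (induction H rule: finite_induct)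
    case empty
    then show ?case using zero jet_zero(2) by simp
  next
    case (insert i H)
    have i: "i \<in> I" using insert.prems by simp
    have s: "(\<lambda>x. f i x *\<^sub>R \<beta> i x) \<in> sections A E" by (rule sections_scale[OF sf[OF i] \<beta>(1)[OF i]])
    have IH: "Q (\<lambda>x. \<Sum>i\<in>H. f i x *\<^sub>R \<beta> i x)" "(\<lambda>x. \<Sum>i\<in>H. f i x *\<^sub>R \<beta> i x) \<in> sections A E"
      using insert.IH insert.prems by auto
    have eq: "(\<lambda>x. \<Sum>i\<in>insert i H. f i x *\<^sub>R \<beta> i x) = (\<lambda>x. f i x *\<^sub>R \<beta> i x + (\<Sum>i\<in>H. f i x *\<^sub>R \<beta> i x))"
      using insert.hyps by simp
    show ?case unfolding eq
      using add[OF s IH(2) scale[OF sf[OF i] \<beta>(1)[OF i] \<beta>(2)[OF i] gen[OF i]] IH(1)] sections_add[OF s IH(2)]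
      by blast
  qed
  have "(\<Sum>i\<in>I. f i x *\<^sub>R \<beta> i x) = \<rho> x *\<^sub>R \<sigma> x" for x
  proof (cases "x \<in> U")
    case True
    then show ?thesis using c(2)[OF True] by (simp add: f_def scaleR_sum_right)
  next
    case False
    then have "x \<notin> K" using \<rho>(7) by auto
    then show ?thesis using False \<rho>(8) by (simp add: f_def)
  qed
  then have "Q (\<lambda>x. \<rho> x *\<^sub>R \<sigma> x)" using Qsum[of I] by simp
  then show ?thesis using cancel[OF \<rho>(1) _ \<sigma>(1) \<sigma>(2)] \<rho>(3,5) by blast
qed

end

section \<open>Brackets and local generators\<close>

locale lie_bundle = smooth_bundle A L
  for A :: "('m::{t2_space,second_countable_topology}, 'e::real_inner) chart set"
    and L :: "('m, 'v::real_vector) lie_algebroid" +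
  assumes lie: "lie_algebroid A L"
begin

lemma bracket_section: "X \<in> sections A L \<Longrightarrow> Y \<in> sections A L \<Longrightarrow> bracket L X Y \<in> sections A L"
  using lie unfolding lie_algebroid_def by blast

lemma bracket_add_left:
  assumes "X \<in> sections A L" "Y \<in> sections A L" "Z \<in> sections A L"
  shows "bracket L (\<lambda>x. X x + Y x) Z p = bracket L X Z p + bracket L Y Z p"
proof -
  have "bracket L (X + Y) Z = bracket L X Z + bracket L Y Z"
    using lie assms unfolding lie_algebroid_def by blast
  then show ?thesis by (simp add: plus_fun_def)
qed

lemma bracket_zero_left:
  assumes "Y \<in> sections A L"
  shows "bracket L (\<lambda>x. 0) Y p = 0"
proof -
  have "bracket L (0 *\<^sub>R (\<lambda>x. 0)) Y = 0 *\<^sub>R bracket L (\<lambda>x. 0) Y"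
    using lie assms jet_zero(2) unfolding lie_algebroid_def by blast
  then show ?thesis by (simp add: scaleR_fun_def)
qed

lemma bracket_anti:
  assumes "X \<in> sections A L" "Y \<in> sections A L"
  shows "bracket L X Y p = - bracket L Y X p"
proof -
  have "bracket L X Y = - bracket L Y X"
    using lie assms unfolding lie_algebroid_def by blast
  then show ?thesis by simp
qed

lemma leibniz_left:
  assumes "X \<in> sections A L" "Y \<in> sections A L" "smooth_fun_on A UNIV f"
  shows "bracket L (\<lambda>x. f x *\<^sub>R X x) Y p = f p *\<^sub>R bracket L X Y p - anchor L p (Y p) f *\<^sub>R X p"
proof -
  have "bracket L Y (\<lambda>x. f x *\<^sub>R X x) = (\<lambda>x. f x *\<^sub>R bracket L Y X x + anchor L x (Y x) f *\<^sub>R X x)"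
    using lie assms unfolding lie_algebroid_def by blast
  then show ?thesis
    using bracket_anti[OF sections_scale[OF assms(3,1)] assms(2), of p] bracket_anti[OF assms(1,2), of p] by simp
qed

text \<open>Multiplying the left section by a function multiplies the bracket at \<open>p\<close> by
  its value there, up to a multiple of the section at \<open>p\<close>, which lies in
  \<open>F p\<close>. Only the left slot is treated, with an arbitrary section \<open>Y\<close> on
  the right.\<close>

lemma bracket_in_left:
  assumes F: "\<And>x. subspace (F x)" and fr: "fam_frame F U I \<beta>"
    and \<beta>: "\<And>i. i \<in> I \<Longrightarrow> \<beta> i \<in> sections A L" "\<And>i x. i \<in> I \<Longrightarrow> \<beta> i x \<in> F x"
    and p: "p \<in> U" and Y: "Y \<in> sections A L"
    and gen: "\<And>i. i \<in> I \<Longrightarrow> bracket L (\<beta> i) Y p \<in> F p"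
    and X: "X \<in> sections A L" "\<And>x. X x \<in> F x"
  shows "bracket L X Y p \<in> F p"
proof (rule local_generation[where Q = "\<lambda>X. bracket L X Y p \<in> F p", OF fr \<beta> p gen _ _ _ _ X])
  show "bracket L (\<lambda>x. 0) Y p \<in> F p" by (simp add: bracket_zero_left[OF Y] subspace_0[OF F])
  show "bracket L (\<lambda>x. s x + t x) Y p \<in> F p"
    if "s \<in> sections A L" "t \<in> sections A L" "bracket L s Y p \<in> F p" "bracket L t Y p \<in> F p" for s t
    using that by (simp add: bracket_add_left[OF that(1,2) Y] subspace_add[OF F])
  show "bracket L (\<lambda>x. f x *\<^sub>R s x) Y p \<in> F p"
    if "smooth_fun_on A UNIV f" "s \<in> sections A L" "s p \<in> F p" "bracket L s Y p \<in> F p" for f s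
    unfolding leibniz_left[OF that(2) Y that(1)] by (intro subspace_diff[OF F] subspace_scale[OF F] that)
  show "bracket L s Y p \<in> F p"
    if "smooth_fun_on A UNIV f" "f p = 1" "s \<in> sections A L" "s p \<in> F p" "bracket L (\<lambda>x. f x *\<^sub>R s x) Y p \<in> F p"
    for f s
  proof -
    have "bracket L s Y p = bracket L (\<lambda>x. f x *\<^sub>R s x) Y p + anchor L p (Y p) f *\<^sub>R s p"
      by (simp add: leibniz_left[OF that(3) Y that(1)] that(2))
    also have "\<dots> \<in> F p" by (intro subspace_add[OF F] subspace_scale[OF F] that)
    finally show ?thesis .
  qed
qed auto

text \<open>The left-slot result is used once for each slot, with antisymmetry in between.\<close>

lemma bracket_closed:
  assumes F: "\<And>x. subspace (F x)" and fr: "fam_frame F U I \<beta>"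
    and \<beta>: "\<And>i. i \<in> I \<Longrightarrow> \<beta> i \<in> sections A L" "\<And>i x. i \<in> I \<Longrightarrow> \<beta> i x \<in> F x"
    and p: "p \<in> U" and gen: "\<And>i k. i \<in> I \<Longrightarrow> k \<in> I \<Longrightarrow> bracket L (\<beta> i) (\<beta> k) p \<in> F p"
    and X: "X \<in> sections A L" "\<And>x. X x \<in> F x" and Y: "Y \<in> sections A L" "\<And>x. Y x \<in> F x"
  shows "bracket L X Y p \<in> F p"
proof -
  have "bracket L (\<beta> i) X p \<in> F p" if "i \<in> I" for i
  proof -
    have "bracket L X (\<beta> i) p \<in> F p"
      by (rule bracket_in_left[OF F fr \<beta> p \<beta>(1)[OF that] gen[OF _ that] X])
    then show ?thesis by (simp add: bracket_anti[OF \<beta>(1)[OF that] X(1)] subspace_neg[OF F])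
  qed
  from bracket_in_left[OF F fr \<beta> p X(1) this Y]
  show ?thesis by (simp add: bracket_anti[OF X(1) Y(1)] subspace_neg[OF F])
qed

end

locale geometric_structure = lie_bundle A L + jet_bundle A L J
  for A :: "('m::{t2_space,second_countable_topology}, 'e::real_inner) chart set"
    and L :: "('m, 'v::real_vector) lie_algebroid"
    and J :: "('m, ('m, 'e, 'v) jet) lie_algebroid" +
  fixes g :: "'m \<Rightarrow> ('m, 'e, 'v) jet set"
  assumes jet: "jet_algebroid A L J" and sub_g: "subalgebroid A J g"
    and rank: "constant_rank (image_of g)"
begin

sublocale JL: lie_bundle A J
  by unfold_locales (use jet in \<open>simp add: jet_algebroid_def\<close>)

lemma anchor_J: "j \<in> jet_fib A L x \<Longrightarrow> anchor J x j = anchor L x (fst j)"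
  using jet by (simp add: jet_algebroid_def fib_J)

lemma bracket_J:
  "X \<in> sections A L \<Longrightarrow> Y \<in> sections A L \<Longrightarrow>
    bracket J (\<lambda>x. jet A L x X) (\<lambda>x. jet A L x Y) = (\<lambda>x. jet A L x (bracket L X Y))"
  using jet unfolding jet_algebroid_def by blast

lemma g_subbundle: "subbundle A J g"
  using sub_g by (simp add: subalgebroid_def)

lemma g_subspace: "subspace (g x)" and g_jet: "g x \<subseteq> jet_fib A L x"
  using g_subbundle by (auto simp: subbundle_def fib_J)

lemma g_closed:
  "\<sigma> \<in> sections A J \<Longrightarrow> \<tau> \<in> sections A J \<Longrightarrow> (\<And>x. \<sigma> x \<in> g x) \<Longrightarrow> (\<And>x. \<tau> x \<in> g x) \<Longrightarrow>
    bracket J \<sigma> \<tau> x \<in> g x"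
  using sub_g by (simp add: subalgebroid_def)

lemma g_frame_around:
  obtains U \<Psi> where "open U" "p \<in> U" "fam_frame g U \<Psi> (\<lambda>\<psi>. \<psi>)" "\<And>\<psi>. \<psi> \<in> \<Psi> \<Longrightarrow> smooth_section_on A J U \<psi>"
proof -
  have "p \<in> (\<Union>(U, \<Phi>)\<in>sub_frames A J g. U)" using g_subbundle by (simp add: subbundle_def)
  then obtain U \<Psi> where "(U, \<Psi>) \<in> sub_frames A J g" "p \<in> U" by auto
  then show ?thesis using that[of U \<Psi>] by (simp add: sub_frames_def is_frame_iff fam_frame_def)
qed

section \<open>Projecting the bracket of jets to values\<close>

text \<open>Prolongations generate the jets locally, and both sides obey the same Leibniz rule in
  \<open>\<sigma>\<close> because the anchor of a jet is the anchor of its value.\<close>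

lemma fst_bracket_prolongation:
  assumes \<tau>: "\<tau> \<in> sections A J" and p: "\<And>X. X \<in> sections A L \<Longrightarrow>
    fst (bracket J (\<lambda>x. jet A L x X) \<tau> p) = bracket L X (\<lambda>x. fst (\<tau> x)) p"
    and \<sigma>: "\<sigma> \<in> sections A J"
  shows "fst (bracket J \<sigma> \<tau> p) = bracket L (\<lambda>x. fst (\<sigma> x)) (\<lambda>x. fst (\<tau> x)) p"
proof -
  obtain T \<beta> and I :: "(('m \<Rightarrow> 'v) \<times> 'e option) set" where T: "open T" "p \<in> T"
    "fam_frame (jet_fib A L) T I (\<lambda>j x. jet A L x (\<beta> j))" "\<And>j. j \<in> I \<Longrightarrow> \<beta> j \<in> sections A L"
    by (rule prolongation_frame[of p]) blast
  have anch: "anchor J p (\<tau> p) = anchor L p (fst (\<tau> p))"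
    using anchor_J J.sections_fib[OF \<tau>] fib_J by simp
  note f\<tau> = sections_fst[OF \<tau>]
  show ?thesis
  proof (rule J.local_generation[where Q = "\<lambda>\<sigma>. fst (bracket J \<sigma> \<tau> p) = bracket L (\<lambda>x. fst (\<sigma> x)) (\<lambda>x. fst (\<tau> x)) p",
        OF T(3) prolongation_section[OF T(4)] _ T(2) _ _ _ _ _ \<sigma>])
    show "jet A L x (\<beta> i) \<in> jet_fib A L x" if "i \<in> I" for i x using T(4)[OF that] by (simp add: jet_fib_def)
    show "fst (bracket J (\<lambda>x. jet A L x (\<beta> i)) \<tau> p) = bracket L (\<lambda>x. fst (jet A L x (\<beta> i))) (\<lambda>x. fst (\<tau> x)) p"
      if "i \<in> I" for i using p[OF T(4)[OF that]] by simp
    show "fst (bracket J (\<lambda>x. 0) \<tau> p) = bracket L (\<lambda>x. fst (0 :: ('m, 'e, 'v) jet)) (\<lambda>x. fst (\<tau> x)) p"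
      by (simp add: bracket_zero_left[OF f\<tau>] JL.bracket_zero_left[OF \<tau>])
    show "fst (bracket J (\<lambda>x. s x + t x) \<tau> p) = bracket L (\<lambda>x. fst (s x + t x)) (\<lambda>x. fst (\<tau> x)) p"
      if "s \<in> sections A J" "t \<in> sections A J"
        "fst (bracket J s \<tau> p) = bracket L (\<lambda>x. fst (s x)) (\<lambda>x. fst (\<tau> x)) p"
        "fst (bracket J t \<tau> p) = bracket L (\<lambda>x. fst (t x)) (\<lambda>x. fst (\<tau> x)) p" for s t
      using that(3,4) bracket_add_left[OF sections_fst[OF that(1)] sections_fst[OF that(2)] f\<tau>, of p]
        JL.bracket_add_left[OF that(1,2) \<tau>, of p] by simp
    have sc: "fst (bracket J (\<lambda>x. f x *\<^sub>R s x) \<tau> p) = f p *\<^sub>R fst (bracket J s \<tau> p) - anchor L p (fst (\<tau> p)) f *\<^sub>R fst (s p)"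
      "bracket L (\<lambda>x. fst (f x *\<^sub>R s x)) (\<lambda>x. fst (\<tau> x)) p =
        f p *\<^sub>R bracket L (\<lambda>x. fst (s x)) (\<lambda>x. fst (\<tau> x)) p - anchor L p (fst (\<tau> p)) f *\<^sub>R fst (s p)"
      if "smooth_fun_on A UNIV f" "s \<in> sections A J" for f s
      using JL.leibniz_left[OF that(2) \<tau> that(1), of p] leibniz_left[OF sections_fst[OF that(2)] f\<tau> that(1), of p]
      by (simp_all add: anch)
    show "fst (bracket J (\<lambda>x. f x *\<^sub>R s x) \<tau> p) = bracket L (\<lambda>x. fst (f x *\<^sub>R s x)) (\<lambda>x. fst (\<tau> x)) p"
      if "smooth_fun_on A UNIV f" "s \<in> sections A J"
        "fst (bracket J s \<tau> p) = bracket L (\<lambda>x. fst (s x)) (\<lambda>x. fst (\<tau> x)) p" for f s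
      using that(3) by (simp only: sc[OF that(1,2)])
    show "fst (bracket J s \<tau> p) = bracket L (\<lambda>x. fst (s x)) (\<lambda>x. fst (\<tau> x)) p"
      if "smooth_fun_on A UNIV f" "f p = 1" "s \<in> sections A J"
        "fst (bracket J (\<lambda>x. f x *\<^sub>R s x) \<tau> p) = bracket L (\<lambda>x. fst (f x *\<^sub>R s x)) (\<lambda>x. fst (\<tau> x)) p" for f s
      using that(4) unfolding sc[OF that(1,3)] that(2) by simp
    show "\<sigma> x \<in> jet_fib A L x" for x using J.sections_fib[OF \<sigma>] by (simp add: fib_J)
  qed
qed

text \<open>Two reductions to prolongations, one for each argument, leave the defining identity
  \<open>bracket_J\<close>.\<close>

lemma fst_bracket:
  assumes \<sigma>: "\<sigma> \<in> sections A J" and \<tau>: "\<tau> \<in> sections A J"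
  shows "fst (bracket J \<sigma> \<tau> p) = bracket L (\<lambda>x. fst (\<sigma> x)) (\<lambda>x. fst (\<tau> x)) p"
proof (rule fst_bracket_prolongation[OF \<tau> _ \<sigma>])
  fix X assume X: "X \<in> sections A L"
  let ?X = "\<lambda>x. jet A L x X"
  note jX = prolongation_section[OF X]
  have "fst (bracket J \<tau> ?X p) = bracket L (\<lambda>x. fst (\<tau> x)) (\<lambda>x. fst (?X x)) p"
    by (rule fst_bracket_prolongation[OF jX _ \<tau>]) (simp add: bracket_J[OF _ X])
  then show "fst (bracket J ?X \<tau> p) = bracket L X (\<lambda>x. fst (\<tau> x)) p"
    using JL.bracket_anti[OF jX \<tau>, of p] bracket_anti[OF X sections_fst[OF \<tau>], of p] by simp
qed

section \<open>The image as a Lie algebroid\<close>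

lemma image_subspace: "subspace (image_of g x)"
  unfolding image_of_def by (intro linear_subspace_image linear_fst g_subspace)

lemma image_sub: "image_of g x \<subseteq> fib L x"
  using g_jet jet_fib_fst by (fastforce simp: image_of_def)

text \<open>The values of a frame of \<open>g\<close>, cut off to global sections, generate the
  image at \<open>p\<close>, and constant rank selects a frame among them. The lifts
  \<open>\<sigma> k\<close> are retained because brackets in the image are computed through
  them.\<close>

lemma image_frame_around:
  obtains T K and \<sigma> :: "('m \<Rightarrow> ('m, 'e, 'v) jet) \<Rightarrow> 'm \<Rightarrow> ('m, 'e, 'v) jet" where "open T" "p \<in> T"
    "fam_frame (image_of g) T K (\<lambda>k x. fst (\<sigma> k x))"
    "\<And>k. k \<in> K \<Longrightarrow> \<sigma> k \<in> sections A J" "\<And>k x. k \<in> K \<Longrightarrow> \<sigma> k x \<in> g x"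
proof -
  obtain U \<Psi> where U: "open U" "p \<in> U" "fam_frame g U \<Psi> (\<lambda>\<psi>. \<psi>)" "\<And>\<psi>. \<psi> \<in> \<Psi> \<Longrightarrow> smooth_section_on A J U \<psi>"
    by (rule g_frame_around[of p]) blast
  obtain T \<sigma> where T: "open T" "p \<in> T" "T \<subseteq> U" "fam_frame g T \<Psi> \<sigma>" "\<And>j. j \<in> \<Psi> \<Longrightarrow> \<sigma> j \<in> sections A J"
    "\<And>j x. j \<in> \<Psi> \<Longrightarrow> \<sigma> j x \<in> g x"
    by (rule J.fam_frame_globalize[OF U(3) g_subspace U(4,2)], assumption, rule that) (assumption | simp)+
  have f\<Psi>: "finite \<Psi>" using T(4) by (simp add: fam_frame_def)
  have gen: "image_of g p \<subseteq> span ((\<lambda>j. fst (\<sigma> j p)) ` \<Psi>)"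
  proof -
    have "g p = range (\<lambda>c. \<Sum>j\<in>\<Psi>. c j *\<^sub>R \<sigma> j p)" using T(2,4) by (simp add: fam_frame_def)
    then have "image_of g p = range (\<lambda>c. \<Sum>j\<in>\<Psi>. c j *\<^sub>R fst (\<sigma> j p))"
      by (simp add: image_of_def image_image fst_comb)
    moreover have "(\<Sum>j\<in>\<Psi>. c j *\<^sub>R fst (\<sigma> j p)) \<in> span ((\<lambda>j. fst (\<sigma> j p)) ` \<Psi>)" for c
      by (intro span_sum span_scale span_base) blast
    ultimately show ?thesis by (simp add: image_subset_iff)
  qed
  have sec: "smooth_section_on A L T (\<lambda>x. fst (\<sigma> j x))" if "j \<in> \<Psi>" for j
    by (rule sections_on[OF sections_fst[OF T(5)[OF that]]])
  have val: "fst (\<sigma> j x) \<in> image_of g x" if "j \<in> \<Psi>" for j x using T(6)[OF that] by (simp add: image_of_def)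
  obtain T' K where T': "open T'" "p \<in> T'" "T' \<subseteq> T" "K \<subseteq> \<Psi>" "fam_frame (image_of g) T' K (\<lambda>j x. fst (\<sigma> j x))"
    by (rule constant_rank_frame[where s = "\<lambda>j x. fst (\<sigma> j x)", OF image_subspace image_sub rank T(1,2) f\<Psi> sec val gen])
  show ?thesis by (rule that[OF T'(1,2,5)]) (use T'(4) T(5,6) in auto)
qed

lemma image_subbundle: "subbundle A L (image_of g)"
proof -
  have "p \<in> (\<Union>(U, \<Phi>)\<in>sub_frames A L (image_of g). U)" for p
  proof -
    obtain T K and \<sigma> :: "('m \<Rightarrow> ('m, 'e, 'v) jet) \<Rightarrow> 'm \<Rightarrow> ('m, 'e, 'v) jet" where T: "open T" "p \<in> T"
      "fam_frame (image_of g) T K (\<lambda>k x. fst (\<sigma> k x))"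
      "\<And>k. k \<in> K \<Longrightarrow> \<sigma> k \<in> sections A J" "\<And>k x. k \<in> K \<Longrightarrow> \<sigma> k x \<in> g x"
      by (rule image_frame_around[of p]) blast
    have "(T, (\<lambda>k x. fst (\<sigma> k x)) ` K) \<in> sub_frames A L (image_of g)"
      using fam_frame_is_frame[OF T(3)] sections_on[OF sections_fst[OF T(4)]] by (auto simp: sub_frames_def)
    then show ?thesis using T(2) by blast
  qed
  then show ?thesis using image_subspace image_sub rank by (auto simp: subbundle_def)
qed

abbreviation "L1 \<equiv> image_algebroid A L g"

lemma L1_simps [simp]: "fib L1 = image_of g" "frames L1 = sub_frames A L (image_of g)"
  "bracket L1 = bracket L" "anchor L1 = anchor L"
  by (simp_all add: image_algebroid_def restrict_algebroid_def)

sublocale SB: sub_bundle A L "image_of g" L1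
  by unfold_locales (simp_all add: image_subbundle)

lemma image_closed:
  assumes X: "X \<in> sections A L" "\<And>x. X x \<in> image_of g x" and Y: "Y \<in> sections A L" "\<And>x. Y x \<in> image_of g x"
  shows "bracket L X Y p \<in> image_of g p"
proof -
  obtain T K and \<sigma> :: "('m \<Rightarrow> ('m, 'e, 'v) jet) \<Rightarrow> 'm \<Rightarrow> ('m, 'e, 'v) jet" where T: "open T" "p \<in> T"
    "fam_frame (image_of g) T K (\<lambda>k x. fst (\<sigma> k x))"
    "\<And>k. k \<in> K \<Longrightarrow> \<sigma> k \<in> sections A J" "\<And>k x. k \<in> K \<Longrightarrow> \<sigma> k x \<in> g x"
    by (rule image_frame_around[of p]) blast
  show ?thesis
  proof (rule bracket_closed[OF image_subspace T(3) sections_fst[OF T(4)] _ T(2) _ X Y])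
    show "fst (\<sigma> k x) \<in> image_of g x" if "k \<in> K" for k x using T(5)[OF that] by (simp add: image_of_def)
    show "bracket L (\<lambda>x. fst (\<sigma> i x)) (\<lambda>x. fst (\<sigma> k x)) p \<in> image_of g p" if "i \<in> K" "k \<in> K" for i k
      unfolding fst_bracket[OF T(4)[OF that(1)] T(4)[OF that(2)], symmetric] image_of_def
      by (rule imageI, rule g_closed) (use T(4,5) that in auto)
  qed
qed

lemma sections_L1: "s \<in> sections A L1 \<Longrightarrow> s \<in> sections A L"
  by (simp add: SB.sub_sections_iff)

lemma bracket_L1:
  assumes "X \<in> sections A L1" "Y \<in> sections A L1"
  shows "bracket L X Y \<in> sections A L1"
  using assms bracket_section image_closed by (auto simp: SB.sub_sections_iff)

lemma L1_lie: "lie_algebroid A L1"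
proof -
  \<comment> \<open>Each \<open>lN\<close> starts at the N-th axiom after the vector bundle
    condition. The other axioms restrict directly to \<open>L1\<close>; closure under the bracket,
    the head of \<open>l5\<close>, is supplied by \<open>bracket_L1\<close> instead.\<close>
  note l1 = lie[unfolded lie_algebroid_def, THEN conjunct2]
  note l2 = l1[THEN conjunct2] note l3 = l2[THEN conjunct2] note l4 = l3[THEN conjunct2]
  note l5 = l4[THEN conjunct2] note l6 = l5[THEN conjunct2] note l7 = l6[THEN conjunct2]
  note l8 = l7[THEN conjunct2] note l9 = l8[THEN conjunct2] note l10 = l9[THEN conjunct2]
  show ?thesis
    unfolding lie_algebroid_def L1_simps
  proof (intro conjI)
    show "vector_bundle A L1" by (rule SB.sub_vector_bundle)
    show "\<forall>X\<in>sections A L1. \<forall>Y\<in>sections A L1. bracket L X Y \<in> sections A L1" using bracket_L1 by blast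
  qed (use l1[THEN conjunct1] image_sub in blast, use l2[THEN conjunct1] image_sub in blast,
      use l3[THEN conjunct1] image_sub in blast, use l4[THEN conjunct1] sections_L1 in blast,
      use l6[THEN conjunct1] sections_L1 in blast, use l7[THEN conjunct1] sections_L1 in blast,
      use l8[THEN conjunct1] sections_L1 in blast, use l9[THEN conjunct1] sections_L1 in blast,
      use l10 sections_L1 in blast)
qed

end

context geometric_structure
begin

section \<open>Jets of sections of the image inside the jets of \<open>L\<close>\<close>

abbreviation "S \<equiv> sub_jets A L L1"

text \<open>Obtained by applying \<open>sub_jet_zero_iff\<close> to a difference. The two directions
  express that the inclusion of jets of the image is well defined and injective.\<close>

lemma sub_jet_eq_iff:
  assumes s: "s \<in> sections A L1" and t: "t \<in> sections A L1"
  shows "jet A L1 x s = jet A L1 x t \<longleftrightarrow> jet A L x s = jet A L x t"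
proof -
  have t': "(\<lambda>z. (-1) *\<^sub>R t z) \<in> sections A L1" by (rule SB.E1.jet_scale(2)[OF t])
  have "jet A L1 x (\<lambda>z. s z + (-1) *\<^sub>R t z) = jet A L1 x s - jet A L1 x t"
    using SB.E1.jet_add(1)[OF s t', of x] SB.E1.jet_scale(1)[OF t, of x "-1"] by simp
  moreover have "jet A L x (\<lambda>z. s z + (-1) *\<^sub>R t z) = jet A L x s - jet A L x t"
    using jet_add(1)[OF sections_L1[OF s] sections_L1[OF t'], of x] jet_scale(1)[OF sections_L1[OF t], of x "-1"]
    by simp
  ultimately show ?thesis
    using SB.sub_jet_zero_iff[OF SB.E1.jet_add(2)[OF s t'], of x] by simp
qed

lemma sub_jets_jet: "S x \<subseteq> jet_fib A L x"
  using sections_L1 by (auto simp: sub_jets_def jet_fib_def)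

lemma sub_jets_subspace: "subspace (S x)"
proof (rule subspaceI)
  have "jet A L x (\<lambda>z. 0) \<in> S x" unfolding sub_jets_def by (rule imageI, rule SB.E1.jet_zero(2))
  then show "0 \<in> S x" by (simp only: jet_zero(1))
  show "j + k \<in> S x" if jk: "j \<in> S x" "k \<in> S x" for j k
  proof -
    obtain s t where st: "s \<in> sections A L1" "t \<in> sections A L1" "j = jet A L x s" "k = jet A L x t"
      using jk by (auto simp: sub_jets_def)
    then show ?thesis unfolding sub_jets_def
      by (intro image_eqI[of _ _ "\<lambda>z. s z + t z"]) (simp_all add: jet_add(1) sections_L1 SB.E1.jet_add(2))
  qed
  show "c *\<^sub>R j \<in> S x" if j: "j \<in> S x" for j c
  proof -
    obtain s where "s \<in> sections A L1" "j = jet A L x s" using j by (auto simp: sub_jets_def)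
    then show ?thesis unfolding sub_jets_def
      by (intro image_eqI[of _ _ "\<lambda>z. c *\<^sub>R s z"]) (simp_all add: jet_scale(1) sections_L1 SB.E1.jet_scale(2))
  qed
qed

text \<open>The same prolongations frame both bundles: independence passes from \<open>L1\<close> to
  \<open>L\<close> by \<open>sub_jet_zero_iff\<close>, spanning by
  \<open>sub_jet_eq_iff\<close>.\<close>

lemma sub_jets_frame_around:
  obtains T \<beta> and I :: "(('m \<Rightarrow> 'v) \<times> 'e option) set" where "open T" "p \<in> T"
    "fam_frame (jet_fib A L1) T I (\<lambda>i x. jet A L1 x (\<beta> i))" "fam_frame S T I (\<lambda>i x. jet A L x (\<beta> i))"
    "\<And>i. i \<in> I \<Longrightarrow> \<beta> i \<in> sections A L1"
proof -
  obtain T \<beta> and I :: "(('m \<Rightarrow> 'v) \<times> 'e option) set" where T: "open T" "p \<in> T"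
    "fam_frame (jet_fib A L1) T I (\<lambda>j x. jet A L1 x (\<beta> j))" "\<And>j. j \<in> I \<Longrightarrow> \<beta> j \<in> sections A L1"
    by (rule SB.E1.prolongation_frame[of p]) blast
  have fI: "finite I" using T(3) by (simp add: fam_frame_def)
  have c1: "jet A L1 x (\<lambda>z. \<Sum>i\<in>I. c i *\<^sub>R \<beta> i z) = (\<Sum>i\<in>I. c i *\<^sub>R jet A L1 x (\<beta> i))" for c x
    by (rule SB.E1.jet_comb_sections[OF T(4)])
  have c: "jet A L x (\<lambda>z. \<Sum>i\<in>I. c i *\<^sub>R \<beta> i z) = (\<Sum>i\<in>I. c i *\<^sub>R jet A L x (\<beta> i))" for c x
    by (rule jet_comb_sections[OF sections_L1[OF T(4)]])
  have s: "(\<lambda>z. \<Sum>i\<in>I. c i *\<^sub>R \<beta> i z) \<in> sections A L1" for c by (rule SB.E1.sections_comb[OF fI T(4)])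
  have "fam_frame S T I (\<lambda>i x. jet A L x (\<beta> i))" unfolding fam_frame_def
  proof (intro conjI ballI)
    fix x assume x: "x \<in> T"
    have i1: "indep_fam I (\<lambda>i. jet A L1 x (\<beta> i))" and r1: "jet_fib A L1 x = range (\<lambda>c. \<Sum>i\<in>I. c i *\<^sub>R jet A L1 x (\<beta> i))"
      using T(3) x by (auto simp: fam_frame_def)
    show "indep_fam I (\<lambda>i. jet A L x (\<beta> i))" unfolding indep_fam_def
    proof (intro allI impI ballI)
      fix d i assume d: "(\<Sum>i\<in>I. d i *\<^sub>R jet A L x (\<beta> i)) = 0" and i: "i \<in> I"
      have "(\<Sum>i\<in>I. d i *\<^sub>R jet A L1 x (\<beta> i)) = 0"
        using SB.sub_jet_zero_iff[OF s, of x d] d by (simp only: c c1)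
      then show "d i = 0" by (rule indep_famD[OF i1 _ i])
    qed
    show "S x = range (\<lambda>c. \<Sum>i\<in>I. c i *\<^sub>R jet A L x (\<beta> i))"
    proof
      show "range (\<lambda>c. \<Sum>i\<in>I. c i *\<^sub>R jet A L x (\<beta> i)) \<subseteq> S x"
        by (auto intro!: comb_in_subspace sub_jets_subspace) (auto simp: sub_jets_def T(4))
      show "S x \<subseteq> range (\<lambda>c. \<Sum>i\<in>I. c i *\<^sub>R jet A L x (\<beta> i))"
      proof
        fix j assume "j \<in> S x"
        then obtain t where t: "t \<in> sections A L1" "j = jet A L x t" by (auto simp: sub_jets_def)
        then have "jet A L1 x t \<in> jet_fib A L1 x" by (simp add: jet_fib_def)
        then obtain d where "jet A L1 x t = (\<Sum>i\<in>I. d i *\<^sub>R jet A L1 x (\<beta> i))" unfolding r1 by blast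
        then have "jet A L x t = jet A L x (\<lambda>z. \<Sum>i\<in>I. d i *\<^sub>R \<beta> i z)"
          using sub_jet_eq_iff[OF t(1) s, of x d] by (simp add: c1)
        then show "j \<in> range (\<lambda>c. \<Sum>i\<in>I. c i *\<^sub>R jet A L x (\<beta> i))" using t(2) by (simp only: c) blast
      qed
    qed
  qed (use T(1) fI in auto)
  then show ?thesis using that T by blast
qed

lemma sub_jets_closed:
  assumes \<sigma>: "\<sigma> \<in> sections A J" "\<And>x. \<sigma> x \<in> S x" and \<tau>: "\<tau> \<in> sections A J" "\<And>x. \<tau> x \<in> S x"
  shows "bracket J \<sigma> \<tau> p \<in> S p"
proof -
  obtain T \<beta> and I :: "(('m \<Rightarrow> 'v) \<times> 'e option) set" where T: "open T" "p \<in> T"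
    "fam_frame S T I (\<lambda>i x. jet A L x (\<beta> i))" "\<And>i. i \<in> I \<Longrightarrow> \<beta> i \<in> sections A L1"
    by (rule sub_jets_frame_around[of p]) blast
  show ?thesis
  proof (rule JL.bracket_closed[OF sub_jets_subspace T(3) prolongation_section[OF sections_L1[OF T(4)]] _ T(2) _ \<sigma> \<tau>])
    show "jet A L x (\<beta> i) \<in> S x" if "i \<in> I" for i x using T(4)[OF that] by (simp add: sub_jets_def)
    show "bracket J (\<lambda>x. jet A L x (\<beta> i)) (\<lambda>x. jet A L x (\<beta> k)) p \<in> S p" if "i \<in> I" "k \<in> I" for i k
      using bracket_L1[OF T(4)[OF that(1)] T(4)[OF that(2)]] sections_L1[OF T(4)] that
      by (simp add: bracket_J sub_jets_def)
  qed
qed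

section \<open>The elementary reduction\<close>

abbreviation "g1 \<equiv> elementary_reduction A L g"

lemma g1_eq: "g1 x = g x \<inter> S x"
  by (simp add: elementary_reduction_def)

lemma symmetries_g1: "symmetries A L g1 = symmetries A L g"
proof -
  have "jet A L x W \<in> S x" if W: "W \<in> sections A L" "\<forall>x. jet A L x W \<in> g x" for W x
  proof -
    have "fst (jet A L x W) \<in> image_of g x" for x using W(2) unfolding image_of_def by blast
    then have "W \<in> sections A L1" using W(1) by (simp add: SB.sub_sections_iff)
    then show ?thesis by (simp add: sub_jets_def)
  qed
  then show ?thesis unfolding symmetries_def g1_eq by blast
qed

lemma g1_subalgebroid:
  assumes rank1: "constant_rank g1"
  shows "subalgebroid A J g1"
  unfolding subalgebroid_def subbundle_def
proof (intro conjI allI ballI impI)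
  show "subspace (g1 x)" for x unfolding g1_eq by (intro subspace_inter g_subspace sub_jets_subspace)
  show "g1 x \<subseteq> fib J x" for x using g_jet by (auto simp: g1_eq fib_J)
  have cr: "constant_rank (\<lambda>x. g x \<inter> S x)" using rank1 by (simp add: g1_eq[symmetric])
  have "p \<in> (\<Union>(U, \<Phi>)\<in>sub_frames A J g1. U)" for p
  proof -
    obtain U \<Psi> where U: "open U" "p \<in> U" "fam_frame g U \<Psi> (\<lambda>\<psi>. \<psi>)" "\<And>\<psi>. \<psi> \<in> \<Psi> \<Longrightarrow> smooth_section_on A J U \<psi>"
      by (rule g_frame_around[of p]) blast
    obtain T \<beta> and I :: "(('m \<Rightarrow> 'v) \<times> 'e option) set" where T: "open T" "p \<in> T"
      "fam_frame S T I (\<lambda>i x. jet A L x (\<beta> i))" "\<And>i. i \<in> I \<Longrightarrow> \<beta> i \<in> sections A L1"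
      by (rule sub_jets_frame_around[of p]) blast
    have o: "open (U \<inter> T)" "p \<in> U \<inter> T" using U T by auto
    obtain T' H and u :: "('m \<Rightarrow> ('m, 'e, 'v) jet) \<Rightarrow> 'm \<Rightarrow> ('m, 'e, 'v) jet"
      where T': "open T'" "p \<in> T'" "fam_frame (\<lambda>x. g x \<inter> S x) T' H u"
      "\<And>i. i \<in> H \<Longrightarrow> smooth_section_on A J T' (u i)"
      by (rule J.intersection_frame[where s = "\<lambda>\<psi>. \<psi>" and t = "\<lambda>i x. jet A L x (\<beta> i)", OF o
            fam_frame_subset[OF U(3) o(1)] J.section_subset[OF U(4)]
            fam_frame_subset[OF T(3) o(1)] J.sections_on[OF prolongation_section[OF sections_L1[OF T(4)]]] cr]) auto
    have "(T', u ` H) \<in> sub_frames A J g1"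
      using fam_frame_is_frame[OF T'(3)] T'(4) by (auto simp: sub_frames_def g1_eq[symmetric])
    then show ?thesis using T'(2) by blast
  qed
  then show "(\<Union>(U, \<Phi>)\<in>sub_frames A J g1. U) = UNIV" by blast
  show "bracket J X Y x \<in> g1 x" if "X \<in> sections A J" "Y \<in> sections A J"
    "(\<forall>x. X x \<in> g1 x) \<and> (\<forall>x. Y x \<in> g1 x)" for X Y x
    using g_closed[OF that(1,2)] sub_jets_closed[OF that(1) _ that(2)] that(3) by (simp add: g1_eq)
qed (rule rank1)

lemma elementary_reduction_is_reduction:
  assumes "constant_rank g1"
  shows "is_reduction A L g g1"
  using g1_subalgebroid[OF assms] symmetries_g1 lie jet
  by (auto simp: is_reduction_def inf_geom_structure_def g1_eq)

text \<open>If the image is all of \<open>L\<close>, each section of \<open>L\<close> is a section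
  of the image, so \<open>sub_jets\<close> exhausts the jets.\<close>

lemma elementary_reduction_of_surjective:
  assumes "surjective_structure L g"
  shows "g1 = g"
proof -
  have i: "image_of g = fib L" using assms by (simp add: surjective_structure_def)
  have "jet_fib A L x \<subseteq> S x" for x
    using sections_fib by (auto simp: jet_fib_def sub_jets_def SB.sub_sections_iff i)
  then show ?thesis using g_jet by (fastforce simp: g1_eq fun_eq_iff)
qed

end

section \<open>The Lie algebroid of jets of the image\<close>

context geometric_structure
begin

text \<open>The sections chosen by \<open>SOME\<close> only serve to represent the jet \<open>j\<close>; by \<open>sub_jet_eq_iff\<close> the
  result does not depend on the choice.\<close>

definition iota :: "'m \<Rightarrow> ('m, 'e, 'v) jet \<Rightarrow> ('m, 'e, 'v) jet"
  where "iota x j = jet A L x (SOME s. s \<in> sections A L1 \<and> jet A L1 x s = j)"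

definition kappa :: "'m \<Rightarrow> ('m, 'e, 'v) jet \<Rightarrow> ('m, 'e, 'v) jet"
  where "kappa x j = jet A L1 x (SOME s. s \<in> sections A L1 \<and> jet A L x s = j)"

lemma iota_jet:
  assumes "s \<in> sections A L1"
  shows "iota x (jet A L1 x s) = jet A L x s"
proof -
  have "\<exists>t. t \<in> sections A L1 \<and> jet A L1 x t = jet A L1 x s" using assms by blast
  from someI_ex[OF this] show ?thesis unfolding iota_def using sub_jet_eq_iff[OF _ assms] by blast
qed

lemma kappa_jet:
  assumes "s \<in> sections A L1"
  shows "kappa x (jet A L x s) = jet A L1 x s"
proof -
  have "\<exists>t. t \<in> sections A L1 \<and> jet A L x t = jet A L x s" using assms by blast
  from someI_ex[OF this] show ?thesis unfolding kappa_def using sub_jet_eq_iff[OF _ assms] by blast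
qed

lemma jet_fib_L1E:
  assumes "j \<in> jet_fib A L1 x"
  obtains s where "s \<in> sections A L1" "j = jet A L1 x s"
  using assms by (auto simp: jet_fib_def)

lemma sub_jetsE:
  assumes "j \<in> S x"
  obtains s where "s \<in> sections A L1" "j = jet A L x s"
  using assms by (auto simp: sub_jets_def)

lemma iota_in: "j \<in> jet_fib A L1 x \<Longrightarrow> iota x j \<in> S x"
  by (erule jet_fib_L1E) (simp add: iota_jet sub_jets_def)

lemma kappa_in: "j \<in> S x \<Longrightarrow> kappa x j \<in> jet_fib A L1 x"
  by (erule sub_jetsE) (simp add: kappa_jet jet_fib_def)

lemma iota_kappa: "j \<in> S x \<Longrightarrow> iota x (kappa x j) = j"
  by (erule sub_jetsE) (simp add: kappa_jet iota_jet)

lemma kappa_iota: "j \<in> jet_fib A L1 x \<Longrightarrow> kappa x (iota x j) = j"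
  by (erule jet_fib_L1E) (simp add: kappa_jet iota_jet)

lemma fst_iota: "j \<in> jet_fib A L1 x \<Longrightarrow> fst (iota x j) = fst j"
  by (erule jet_fib_L1E) (simp add: iota_jet SB.E1.fst_jet)

lemma fst_kappa: "j \<in> S x \<Longrightarrow> fst (kappa x j) = fst j"
  by (erule sub_jetsE) (simp add: kappa_jet SB.E1.fst_jet)

lemma iota_comb:
  assumes "finite I" "\<And>i. i \<in> I \<Longrightarrow> j i \<in> jet_fib A L1 x"
  shows "iota x (\<Sum>i\<in>I. c i *\<^sub>R j i) = (\<Sum>i\<in>I. c i *\<^sub>R iota x (j i))"
proof -
  have "\<forall>i\<in>I. \<exists>s. s \<in> sections A L1 \<and> j i = jet A L1 x s" using assms(2) jet_fib_L1E by metis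
  from bchoice[OF this] obtain s where s: "\<And>i. i \<in> I \<Longrightarrow> s i \<in> sections A L1" "\<And>i. i \<in> I \<Longrightarrow> j i = jet A L1 x (s i)"
    by blast
  have "(\<Sum>i\<in>I. c i *\<^sub>R j i) = jet A L1 x (\<lambda>z. \<Sum>i\<in>I. c i *\<^sub>R s i z)"
    using SB.E1.jet_comb_sections[of I s x c] s by simp
  moreover have "(\<Sum>i\<in>I. c i *\<^sub>R iota x (j i)) = jet A L x (\<lambda>z. \<Sum>i\<in>I. c i *\<^sub>R s i z)"
    using jet_comb_sections[of I s x c] s sections_L1 by (simp add: iota_jet)
  ultimately show ?thesis using iota_jet[OF SB.E1.sections_comb[OF assms(1) s(1)]] by simp
qed

lemma kappa_comb:
  assumes "finite I" "\<And>i. i \<in> I \<Longrightarrow> j i \<in> S x"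
  shows "kappa x (\<Sum>i\<in>I. c i *\<^sub>R j i) = (\<Sum>i\<in>I. c i *\<^sub>R kappa x (j i))"
proof -
  have "iota x (\<Sum>i\<in>I. c i *\<^sub>R kappa x (j i)) = (\<Sum>i\<in>I. c i *\<^sub>R iota x (kappa x (j i)))"
    by (rule iota_comb[OF assms(1) kappa_in[OF assms(2)]])
  then have "(\<Sum>i\<in>I. c i *\<^sub>R j i) = iota x (\<Sum>i\<in>I. c i *\<^sub>R kappa x (j i))"
    by (simp add: iota_kappa[OF assms(2)])
  moreover have "(\<Sum>i\<in>I. c i *\<^sub>R kappa x (j i)) \<in> jet_fib A L1 x"
    by (rule comb_in_subspace[OF SB.E1.jet_fib_subspace kappa_in[OF assms(2)]])
  ultimately show ?thesis by (simp add: kappa_iota)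
qed

lemma iota_add:
  assumes "j \<in> jet_fib A L1 x" "k \<in> jet_fib A L1 x"
  shows "iota x (j + k) = iota x j + iota x k"
proof -
  have "iota x (\<Sum>b\<in>{True, False}. 1 *\<^sub>R (if b then j else k)) =
      (\<Sum>b\<in>{True, False}. 1 *\<^sub>R iota x (if b then j else k))"
    by (rule iota_comb) (use assms in auto)
  then show ?thesis by simp
qed

lemma iota_scale:
  assumes "j \<in> jet_fib A L1 x"
  shows "iota x (c *\<^sub>R j) = c *\<^sub>R iota x j"
proof -
  have "iota x (\<Sum>b\<in>{()}. c *\<^sub>R j) = (\<Sum>b\<in>{()}. c *\<^sub>R iota x j)"
    by (rule iota_comb) (use assms in auto)
  then show ?thesis by simp
qed

section \<open>The jet algebroid of the image\<close>

text \<open>The bracket is transported along \<open>iota\<close>; \<open>kappa\<close> may be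
  applied to the result because \<open>sub_jets\<close> is closed under the bracket of
  \<open>J\<close>. The frames are the ones demanded by \<open>jet_algebroid\<close> rather than
  transported ones, so compatibility with the smooth structure of \<open>J\<close> is proved
  separately.\<close>

definition J1 :: "('m, ('m, 'e, 'v) jet) lie_algebroid"
  where "J1 = \<lparr>fib = jet_fib A L1, frames = jet_frames A L1,
    bracket = (\<lambda>\<sigma> \<tau> x. kappa x (bracket J (\<lambda>y. iota y (\<sigma> y)) (\<lambda>y. iota y (\<tau> y)) x)),
    anchor = (\<lambda>x j. anchor L x (fst j))\<rparr>"

lemma J1_simps [simp]: "fib J1 = jet_fib A L1" "frames J1 = jet_frames A L1"
  "bracket J1 = (\<lambda>\<sigma> \<tau> x. kappa x (bracket J (\<lambda>y. iota y (\<sigma> y)) (\<lambda>y. iota y (\<tau> y)) x))"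
  "anchor J1 = (\<lambda>x j. anchor L x (fst j))"
  by (simp_all add: J1_def)

sublocale JB1: jet_bundle A L1 J1
  by unfold_locales simp_all

text \<open>A frame of prolongations in \<open>L1\<close> goes to the prolongations of the same
  sections in \<open>L\<close>, so a section keeps its smooth coefficients.\<close>

lemma iota_section:
  assumes U: "open U" and \<sigma>: "smooth_section_on A J1 U \<sigma>"
  shows "smooth_section_on A J U (\<lambda>x. iota x (\<sigma> x))"
proof (rule J.section_local)
  fix p assume p: "p \<in> U"
  obtain T \<beta> and I :: "(('m \<Rightarrow> 'v) \<times> 'e option) set" where T: "open T" "p \<in> T"
    "fam_frame (jet_fib A L1) T I (\<lambda>i x. jet A L1 x (\<beta> i))" "\<And>i. i \<in> I \<Longrightarrow> \<beta> i \<in> sections A L1"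
    by (rule sub_jets_frame_around[of p]) blast
  have o: "open (U \<inter> T)" "finite I" using U T by (auto simp: fam_frame_def)
  have v: "\<sigma> x \<in> jet_fib A L1 x" if "x \<in> U \<inter> T" for x using JB1.J.section_fib[OF \<sigma>] that by simp
  have "smooth_section_on A J (U \<inter> T) (\<lambda>x. iota x (\<sigma> x))"
  proof (rule JB1.J.fam_frame_coefficients[OF T(3) JB1.J.sections_on[OF JB1.prolongation_section[OF T(4)]]
        JB1.J.section_subset[OF \<sigma>] v o(1)])
    fix c assume c: "\<And>i. i \<in> I \<Longrightarrow> smooth_fun_on A (U \<inter> T) (c i)"
      "\<And>x. x \<in> U \<inter> T \<Longrightarrow> \<sigma> x = (\<Sum>i\<in>I. c i x *\<^sub>R jet A L1 x (\<beta> i))"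
    show "smooth_section_on A J (U \<inter> T) (\<lambda>x. iota x (\<sigma> x))"
    proof (rule J.section_cong[OF o(1)])
      show "smooth_section_on A J (U \<inter> T) (\<lambda>x. \<Sum>i\<in>I. c i x *\<^sub>R jet A L x (\<beta> i))"
        by (rule J.section_comb[OF o c(1) J.sections_on[OF prolongation_section[OF sections_L1[OF T(4)]]]])
      show "(\<Sum>i\<in>I. c i x *\<^sub>R jet A L x (\<beta> i)) = iota x (\<sigma> x)" if x: "x \<in> U \<inter> T" for x
      proof -
        have "iota x (\<sigma> x) = (\<Sum>i\<in>I. c i x *\<^sub>R iota x (jet A L1 x (\<beta> i)))"
          unfolding c(2)[OF x] by (rule iota_comb[OF o(2)]) (simp add: jet_fib_def T(4))
        then show ?thesis by (simp add: iota_jet[OF T(4)])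
      qed
    qed
  qed auto
  then show "\<exists>T. open T \<and> p \<in> T \<and> smooth_section_on A J T (\<lambda>x. iota x (\<sigma> x))" using o(1) p T(2) by blast
qed

lemma kappa_section:
  assumes U: "open U" and \<sigma>: "smooth_section_on A J U \<sigma>" "\<And>x. x \<in> U \<Longrightarrow> \<sigma> x \<in> S x"
  shows "smooth_section_on A J1 U (\<lambda>x. kappa x (\<sigma> x))"
proof (rule JB1.J.section_local)
  fix p assume p: "p \<in> U"
  obtain T \<beta> and I :: "(('m \<Rightarrow> 'v) \<times> 'e option) set" where T: "open T" "p \<in> T"
    "fam_frame S T I (\<lambda>i x. jet A L x (\<beta> i))" "\<And>i. i \<in> I \<Longrightarrow> \<beta> i \<in> sections A L1"
    by (rule sub_jets_frame_around[of p]) blast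
  have o: "open (U \<inter> T)" "finite I" using U T by (auto simp: fam_frame_def)
  have v: "\<sigma> x \<in> S x" if "x \<in> U \<inter> T" for x using \<sigma>(2) that by simp
  have "smooth_section_on A J1 (U \<inter> T) (\<lambda>x. kappa x (\<sigma> x))"
  proof (rule J.fam_frame_coefficients[OF T(3) J.sections_on[OF prolongation_section[OF sections_L1[OF T(4)]]]
        J.section_subset[OF \<sigma>(1)] v o(1)])
    fix c assume c: "\<And>i. i \<in> I \<Longrightarrow> smooth_fun_on A (U \<inter> T) (c i)"
      "\<And>x. x \<in> U \<inter> T \<Longrightarrow> \<sigma> x = (\<Sum>i\<in>I. c i x *\<^sub>R jet A L x (\<beta> i))"
    show "smooth_section_on A J1 (U \<inter> T) (\<lambda>x. kappa x (\<sigma> x))"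
    proof (rule JB1.J.section_cong[OF o(1)])
      show "smooth_section_on A J1 (U \<inter> T) (\<lambda>x. \<Sum>i\<in>I. c i x *\<^sub>R jet A L1 x (\<beta> i))"
        by (rule JB1.J.section_comb[OF o c(1) JB1.J.sections_on[OF JB1.prolongation_section[OF T(4)]]])
      show "(\<Sum>i\<in>I. c i x *\<^sub>R jet A L1 x (\<beta> i)) = kappa x (\<sigma> x)" if x: "x \<in> U \<inter> T" for x
      proof -
        have "kappa x (\<sigma> x) = (\<Sum>i\<in>I. c i x *\<^sub>R kappa x (jet A L x (\<beta> i)))"
          unfolding c(2)[OF x] by (rule kappa_comb[OF o(2)]) (simp add: sub_jets_def T(4))
        then show ?thesis by (simp add: kappa_jet[OF T(4)])
      qed
    qed
  qed auto
  then show "\<exists>T. open T \<and> p \<in> T \<and> smooth_section_on A J1 T (\<lambda>x. kappa x (\<sigma> x))" using o(1) p T(2) by blast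
qed

text \<open>\<open>iota\<close> on sections. Being injective and compatible with the operations, it
  allows identities in \<open>J1\<close> to be verified in \<open>J\<close>.\<close>

definition push :: "('m \<Rightarrow> ('m, 'e, 'v) jet) \<Rightarrow> 'm \<Rightarrow> ('m, 'e, 'v) jet"
  where "push \<sigma> = (\<lambda>x. iota x (\<sigma> x))"

lemma J1_fib: "\<sigma> \<in> sections A J1 \<Longrightarrow> \<sigma> x \<in> jet_fib A L1 x"
  using JB1.J.sections_fib by simp

lemma push_sections: "\<sigma> \<in> sections A J1 \<Longrightarrow> push \<sigma> \<in> sections A J"
  using iota_section[OF open_UNIV] by (simp add: sections_def push_def)

lemma push_in: "\<sigma> \<in> sections A J1 \<Longrightarrow> push \<sigma> x \<in> S x"
  by (simp add: push_def iota_in J1_fib)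

lemma push_inj:
  assumes "\<sigma> \<in> sections A J1" "\<tau> \<in> sections A J1" "push \<sigma> = push \<tau>"
  shows "\<sigma> = \<tau>"
proof
  fix x
  have "iota x (\<sigma> x) = iota x (\<tau> x)" using fun_cong[OF assms(3), of x] by (simp add: push_def)
  then show "\<sigma> x = \<tau> x" using kappa_iota J1_fib[OF assms(1)] J1_fib[OF assms(2)] by metis
qed

lemma bracket_J1: "bracket J1 \<sigma> \<tau> = (\<lambda>x. kappa x (bracket J (push \<sigma>) (push \<tau>) x))"
  by (simp add: push_def)

lemma bracket_J1_section:
  assumes "\<sigma> \<in> sections A J1" "\<tau> \<in> sections A J1"
  shows "bracket J1 \<sigma> \<tau> \<in> sections A J1"
proof -
  have "bracket J (push \<sigma>) (push \<tau>) \<in> sections A J"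
    by (rule JL.bracket_section[OF push_sections push_sections]) (use assms in auto)
  then have "smooth_section_on A J1 UNIV (\<lambda>x. kappa x (bracket J (push \<sigma>) (push \<tau>) x))"
    using assms by (intro kappa_section sub_jets_closed push_sections push_in) (auto simp: sections_def)
  then show ?thesis unfolding bracket_J1 by (simp add: sections_def)
qed

lemma push_bracket:
  assumes "\<sigma> \<in> sections A J1" "\<tau> \<in> sections A J1"
  shows "push (bracket J1 \<sigma> \<tau>) = bracket J (push \<sigma>) (push \<tau>)"
proof
  fix x
  have "bracket J (push \<sigma>) (push \<tau>) x \<in> S x"
    using assms by (intro sub_jets_closed push_sections push_in)
  then show "push (bracket J1 \<sigma> \<tau>) x = bracket J (push \<sigma>) (push \<tau>) x"
    unfolding bracket_J1 by (simp add: push_def iota_kappa)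
qed

lemma push_add: "\<sigma> \<in> sections A J1 \<Longrightarrow> \<tau> \<in> sections A J1 \<Longrightarrow> push (\<sigma> + \<tau>) = push \<sigma> + push \<tau>"
  by (simp add: push_def fun_eq_iff iota_add J1_fib)

lemma push_scale: "\<sigma> \<in> sections A J1 \<Longrightarrow> push (\<lambda>x. f x *\<^sub>R \<sigma> x) = (\<lambda>x. f x *\<^sub>R push \<sigma> x)"
  by (simp add: push_def fun_eq_iff iota_scale J1_fib)

lemma push_scaleR: "\<sigma> \<in> sections A J1 \<Longrightarrow> push (c *\<^sub>R \<sigma>) = c *\<^sub>R push \<sigma>"
  using push_scale[of \<sigma> "\<lambda>x. c"] by (simp add: scaleR_fun_def)

lemma push_uminus: "\<sigma> \<in> sections A J1 \<Longrightarrow> push (- \<sigma>) = - push \<sigma>"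
  using push_scaleR[of \<sigma> "-1"] by simp

lemma J1_add: "\<sigma> \<in> sections A J1 \<Longrightarrow> \<tau> \<in> sections A J1 \<Longrightarrow> \<sigma> + \<tau> \<in> sections A J1"
  using JB1.J.sections_add by (simp add: plus_fun_def)

lemma J1_scale: "smooth_fun_on A UNIV f \<Longrightarrow> \<sigma> \<in> sections A J1 \<Longrightarrow> (\<lambda>x. f x *\<^sub>R \<sigma> x) \<in> sections A J1"
  by (rule JB1.J.sections_scale)

lemma J1_scaleR: "\<sigma> \<in> sections A J1 \<Longrightarrow> c *\<^sub>R \<sigma> \<in> sections A J1"
  using J1_scale[OF smooth_fun_const[OF open_UNIV]] by (simp add: scaleR_fun_def)

lemma J1_zero: "0 \<in> sections A J1" "push 0 = 0"
  using JB1.J.jet_zero(2) push_scaleR[of 0 0] by (simp_all add: zero_fun_def)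

text \<open>The bracket identities hold after \<open>push\<close>, which is injective. The axioms on
  the anchor alone are those of \<open>L1\<close>, as the anchor of a jet is the anchor of its
  value.\<close>

lemma J1_lie: "lie_algebroid A J1"
proof -
  note l1 = JL.lie[unfolded lie_algebroid_def, THEN conjunct2]
  note l2 = l1[THEN conjunct2] note l3 = l2[THEN conjunct2] note l4 = l3[THEN conjunct2]
  note l5 = l4[THEN conjunct2] note l6 = l5[THEN conjunct2] note l7 = l6[THEN conjunct2]
  note l8 = l7[THEN conjunct2] note l9 = l8[THEN conjunct2] note l10 = l9[THEN conjunct2]
  note m1 = L1_lie[unfolded lie_algebroid_def L1_simps, THEN conjunct2]
  note m2 = m1[THEN conjunct2] note m3 = m2[THEN conjunct2] note m4 = m3[THEN conjunct2]
  note pb = push_bracket and bs = bracket_J1_section and ps = push_sections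
  have fst_in: "fst j \<in> image_of g x" if "j \<in> jet_fib A L1 x" for j x
    using SB.E1.jet_fib_fst[OF that] by simp
  show ?thesis
    unfolding lie_algebroid_def
  proof (intro conjI ballI allI impI)
    show "vector_bundle A J1" by (rule JB1.jet_vector_bundle)
    show "anchor J1 x u \<in> tangent_space A x" if "u \<in> fib J1 x" for x u
      using m1[THEN conjunct1] fst_in that by simp
    show "anchor J1 x (u + v) = anchor J1 x u + anchor J1 x v" if "u \<in> fib J1 x" "v \<in> fib J1 x" for x u v
      using m2[THEN conjunct1] fst_in that by simp
    show "anchor J1 x (c *\<^sub>R u) = c *\<^sub>R anchor J1 x u" if "u \<in> fib J1 x" for x u c
      using m3[THEN conjunct1] fst_in that by simp
    show "smooth_fun_on A UNIV (\<lambda>x. anchor J1 x (X x) f)" if "X \<in> sections A J1" "smooth_fun_on A UNIV f" for X f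
    proof -
      have "(\<lambda>x. fst (X x)) \<in> sections A L1" by (rule JB1.sections_fst[OF that(1)])
      then show ?thesis using m4[THEN conjunct1] that(2) by simp
    qed
    show "bracket J1 X Y \<in> sections A J1" if "X \<in> sections A J1" "Y \<in> sections A J1" for X Y
      by (rule bs[OF that])
    show "bracket J1 (X + Y) Z = bracket J1 X Z + bracket J1 Y Z"
      if X: "X \<in> sections A J1" and Y: "Y \<in> sections A J1" and Z: "Z \<in> sections A J1" for X Y Z
    proof (rule push_inj[OF bs[OF J1_add[OF X Y] Z] J1_add[OF bs[OF X Z] bs[OF Y Z]]])
      have "bracket J (push X + push Y) (push Z) = bracket J (push X) (push Z) + bracket J (push Y) (push Z)"
        using l6[THEN conjunct1] ps[OF X] ps[OF Y] ps[OF Z] by blast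
      then show "push (bracket J1 (X + Y) Z) = push (bracket J1 X Z + bracket J1 Y Z)"
        by (simp only: pb[OF J1_add[OF X Y] Z] push_add[OF X Y] push_add[OF bs[OF X Z] bs[OF Y Z]] pb[OF X Z] pb[OF Y Z])
    qed
    show "bracket J1 (c *\<^sub>R X) Y = c *\<^sub>R bracket J1 X Y"
      if X: "X \<in> sections A J1" and Y: "Y \<in> sections A J1" for X Y c
    proof (rule push_inj[OF bs[OF J1_scaleR[OF X] Y] J1_scaleR[OF bs[OF X Y]]])
      have "bracket J (c *\<^sub>R push X) (push Y) = c *\<^sub>R bracket J (push X) (push Y)"
        using l7[THEN conjunct1] ps[OF X] ps[OF Y] by blast
      then show "push (bracket J1 (c *\<^sub>R X) Y) = push (c *\<^sub>R bracket J1 X Y)"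
        by (simp only: pb[OF J1_scaleR[OF X] Y] push_scaleR[OF X] push_scaleR[OF bs[OF X Y]] pb[OF X Y])
    qed
    show "bracket J1 X Y = - bracket J1 Y X"
      if X: "X \<in> sections A J1" and Y: "Y \<in> sections A J1" for X Y
    proof (rule push_inj[OF bs[OF X Y]])
      show "- bracket J1 Y X \<in> sections A J1" using J1_scaleR[OF bs[OF Y X], of "-1"] by simp
      have "bracket J (push X) (push Y) = - bracket J (push Y) (push X)"
        using l8[THEN conjunct1] ps[OF X] ps[OF Y] by blast
      then show "push (bracket J1 X Y) = push (- bracket J1 Y X)"
        by (simp only: pb[OF X Y] push_uminus[OF bs[OF Y X]] pb[OF Y X])
    qed
    show "bracket J1 X (bracket J1 Y Z) + bracket J1 Y (bracket J1 Z X) + bracket J1 Z (bracket J1 X Y) = 0"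
      if X: "X \<in> sections A J1" and Y: "Y \<in> sections A J1" and Z: "Z \<in> sections A J1" for X Y Z
    proof (rule push_inj[OF _ J1_zero(1)])
      let ?a = "bracket J1 X (bracket J1 Y Z)" and ?b = "bracket J1 Y (bracket J1 Z X)"
        and ?c = "bracket J1 Z (bracket J1 X Y)"
      have a: "?a \<in> sections A J1" "?b \<in> sections A J1" "?c \<in> sections A J1"
        by (intro bs X Y Z)+
      show "?a + ?b + ?c \<in> sections A J1" by (intro J1_add a)
      have "bracket J (push X) (bracket J (push Y) (push Z)) + bracket J (push Y) (bracket J (push Z) (push X)) +
          bracket J (push Z) (bracket J (push X) (push Y)) = 0"
        using l9[THEN conjunct1] ps[OF X] ps[OF Y] ps[OF Z] by blast
      then show "push (?a + ?b + ?c) = push 0"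
        by (simp only: push_add[OF J1_add[OF a(1,2)] a(3)] push_add[OF a(1,2)] J1_zero(2)
            pb[OF X bs[OF Y Z]] pb[OF Y bs[OF Z X]] pb[OF Z bs[OF X Y]] pb[OF X Y] pb[OF Y Z] pb[OF Z X])
    qed
    show "bracket J1 X (\<lambda>x. f x *\<^sub>R Y x) =
        (\<lambda>x. f x *\<^sub>R bracket J1 X Y x + anchor J1 x (X x) f *\<^sub>R Y x)"
      if X: "X \<in> sections A J1" and Y: "Y \<in> sections A J1" and f: "smooth_fun_on A UNIV f" for X Y f
    proof -
      have sa: "smooth_fun_on A UNIV (\<lambda>x. anchor J1 x (X x) f)"
        using m4[THEN conjunct1] JB1.sections_fst[OF X] f by simp
      have eq: "(\<lambda>x. f x *\<^sub>R bracket J1 X Y x + anchor J1 x (X x) f *\<^sub>R Y x) =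
          (\<lambda>x. f x *\<^sub>R bracket J1 X Y x) + (\<lambda>x. anchor J1 x (X x) f *\<^sub>R Y x)"
        by (simp add: fun_eq_iff)
      note s1 = J1_scale[OF f bs[OF X Y]] and s2 = J1_scale[OF sa Y]
      show ?thesis unfolding eq
      proof (rule push_inj[OF bs[OF X J1_scale[OF f Y]] J1_add[OF s1 s2]])
        have an: "anchor J1 x (X x) f = anchor J x (push X x) f" for x
        proof -
          have "push X x \<in> jet_fib A L x" using sub_jets_jet push_in[OF X] by blast
          then show ?thesis using fst_iota[OF J1_fib[OF X], of x] by (simp add: anchor_J push_def)
        qed
        have "bracket J (push X) (\<lambda>x. f x *\<^sub>R push Y x) =
            (\<lambda>x. f x *\<^sub>R bracket J (push X) (push Y) x + anchor J x (push X x) f *\<^sub>R push Y x)"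
          using l10 ps[OF X] ps[OF Y] f by blast
        moreover have "push ((\<lambda>x. f x *\<^sub>R bracket J1 X Y x) + (\<lambda>x. anchor J1 x (X x) f *\<^sub>R Y x)) =
            (\<lambda>x. f x *\<^sub>R push (bracket J1 X Y) x) + (\<lambda>x. anchor J1 x (X x) f *\<^sub>R push Y x)"
          by (simp only: push_add[OF s1 s2] push_scale[OF bs[OF X Y]] push_scale[OF Y])
        ultimately show "push (bracket J1 X (\<lambda>x. f x *\<^sub>R Y x)) =
            push ((\<lambda>x. f x *\<^sub>R bracket J1 X Y x) + (\<lambda>x. anchor J1 x (X x) f *\<^sub>R Y x))"
          by (simp only: pb[OF X Y] pb[OF X J1_scale[OF f Y]] push_scale[OF Y] an plus_fun_def)
      qed
    qed
  qed
qed

lemma J1_jet_algebroid: "jet_algebroid A L1 J1"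
  unfolding jet_algebroid_def
proof (intro conjI ballI allI)
  show "lie_algebroid A J1" by (rule J1_lie)
  show "bracket J1 (\<lambda>x. jet A L1 x X) (\<lambda>x. jet A L1 x Y) = (\<lambda>x. jet A L1 x (bracket L1 X Y))"
    if "X \<in> sections A L1" "Y \<in> sections A L1" for X Y
    using that bracket_L1[OF that] sections_L1
    by (simp add: iota_jet bracket_J kappa_jet)
qed simp_all

section \<open>The structure regarded over its image\<close>

lemma pullback_eq:
  assumes "g x \<subseteq> S x"
  shows "pullback_to_sub A L L1 g x = kappa x ` g x"
proof
  show "pullback_to_sub A L L1 g x \<subseteq> kappa x ` g x"
  proof
    fix k assume "k \<in> pullback_to_sub A L L1 g x"
    then obtain s where "s \<in> sections A L1" "jet A L x s \<in> g x" "k = jet A L1 x s"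
      by (auto simp: pullback_to_sub_def)
    then show "k \<in> kappa x ` g x" by (intro image_eqI[of _ _ "jet A L x s"]) (simp_all add: kappa_jet)
  qed
  show "kappa x ` g x \<subseteq> pullback_to_sub A L L1 g x"
  proof
    fix k assume "k \<in> kappa x ` g x"
    then obtain j where j: "j \<in> g x" "k = kappa x j" by auto
    obtain s where "s \<in> sections A L1" "j = jet A L x s" by (rule sub_jetsE[of j x]) (use j assms in auto)
    then show "k \<in> pullback_to_sub A L L1 g x" using j by (auto simp: kappa_jet pullback_to_sub_def)
  qed
qed

context
  assumes gS: "\<And>x. g x \<subseteq> S x"
begin

abbreviation "h \<equiv> pullback_to_sub A L L1 g"

lemma h_eq: "h x = kappa x ` g x"
  by (rule pullback_eq[OF gS])

lemma h_iff: "k \<in> h x \<longleftrightarrow> k \<in> jet_fib A L1 x \<and> iota x k \<in> g x"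
proof
  assume "k \<in> h x"
  then show "k \<in> jet_fib A L1 x \<and> iota x k \<in> g x" using gS kappa_in iota_kappa by (fastforce simp: h_eq)
next
  assume "k \<in> jet_fib A L1 x \<and> iota x k \<in> g x"
  then show "k \<in> h x" unfolding h_eq by (metis image_eqI kappa_iota)
qed

text \<open>\<open>kappa\<close> is linear on \<open>sub_jets\<close> and inverted by
  \<open>iota\<close>, so it carries frames to frames with the same index set.\<close>

lemma h_frame:
  assumes U: "fam_frame g U I s"
  shows "fam_frame h U I (\<lambda>i x. kappa x (s i x))"
  unfolding fam_frame_def
proof (intro conjI ballI)
  show "open U" "finite I" using U by (auto simp: fam_frame_def)
  then have fI: "finite I" by simp
  fix x assume x: "x \<in> U"
  have i: "indep_fam I (\<lambda>i. s i x)" and r: "g x = range (\<lambda>c. \<Sum>i\<in>I. c i *\<^sub>R s i x)"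
    using U x by (auto simp: fam_frame_def)
  have sg: "s j x \<in> S x" if "j \<in> I" for j
  proof -
    \<comment> \<open>Kronecker coefficients exhibit a single frame vector as a combination, hence
      as an element of \<open>g x\<close>.\<close>
    have "s j x = (\<Sum>i\<in>I. (if i = j then 1 else 0) *\<^sub>R s i x)"
      using fI that by (simp add: if_distrib[of "\<lambda>c. c *\<^sub>R _"] cong: if_cong)
    then have "s j x \<in> g x" unfolding r by (rule range_eqI[where x = "\<lambda>i. if i = j then 1 else 0"])
    then show ?thesis using gS by blast
  qed
  have kc: "kappa x (\<Sum>i\<in>I. c i *\<^sub>R s i x) = (\<Sum>i\<in>I. c i *\<^sub>R kappa x (s i x))" for c
    by (rule kappa_comb[OF fI sg])
  show "h x = range (\<lambda>c. \<Sum>i\<in>I. c i *\<^sub>R kappa x (s i x))"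
    unfolding h_eq r by (simp add: image_image kc)
  show "indep_fam I (\<lambda>i. kappa x (s i x))" unfolding indep_fam_def
  proof (intro allI impI ballI)
    fix c j assume c: "(\<Sum>i\<in>I. c i *\<^sub>R kappa x (s i x)) = 0" and j: "j \<in> I"
    have "iota x (\<Sum>i\<in>I. c i *\<^sub>R kappa x (s i x)) = (\<Sum>i\<in>I. c i *\<^sub>R iota x (kappa x (s i x)))"
      by (rule iota_comb[OF fI kappa_in[OF sg]])
    then have "(\<Sum>i\<in>I. c i *\<^sub>R s i x) = iota x (\<Sum>i\<in>I. c i *\<^sub>R kappa x (s i x))"
      by (simp add: iota_kappa[OF sg])
    also have "\<dots> = 0" using iota_scale[OF subspace_0[OF SB.E1.jet_fib_subspace[of x]], of 0] by (simp add: c)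
    finally show "c j = 0" by (rule indep_famD[OF i _ j])
  qed
qed

lemma h_subspace: "subspace (h x)"
proof (rule subspaceI)
  have 0: "iota x 0 = 0" using iota_scale[OF subspace_0[OF SB.E1.jet_fib_subspace[of x]], of 0] by simp
  show "0 \<in> h x" using subspace_0[OF SB.E1.jet_fib_subspace[of x]] subspace_0[OF g_subspace[of x]]
    by (simp add: h_iff 0)
  show "j + k \<in> h x" if "j \<in> h x" "k \<in> h x" for j k
    using that subspace_add[OF SB.E1.jet_fib_subspace[of x]] subspace_add[OF g_subspace[of x]]
    by (simp add: h_iff iota_add)
  show "c *\<^sub>R j \<in> h x" if "j \<in> h x" for j c
    using that subspace_scale[OF SB.E1.jet_fib_subspace[of x]] subspace_scale[OF g_subspace[of x]]
    by (simp add: h_iff iota_scale)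
qed

text \<open>Frames of \<open>g\<close> and of its pullback share their index sets, which gives
  constant rank. The bracket of \<open>J1\<close> is computed in \<open>J\<close>, where closedness
  of \<open>g\<close> is available.\<close>

lemma h_subalgebroid: "subalgebroid A J1 h"
  unfolding subalgebroid_def subbundle_def
proof (intro conjI allI ballI impI)
  show "subspace (h x)" for x by (rule h_subspace)
  show "h x \<subseteq> fib J1 x" for x by (auto simp: h_iff)
  have fr: "\<exists>U \<Psi>. p \<in> U \<and> fam_frame g U \<Psi> (\<lambda>\<psi>. \<psi>) \<and> fam_frame h U \<Psi> (\<lambda>\<psi> x. kappa x (\<psi> x)) \<and>
      (\<forall>\<psi>\<in>\<Psi>. smooth_section_on A J1 U (\<lambda>x. kappa x (\<psi> x)))" for p
  proof -
    obtain U \<Psi> where U: "open U" "p \<in> U" "fam_frame g U \<Psi> (\<lambda>\<psi>. \<psi>)" "\<And>\<psi>. \<psi> \<in> \<Psi> \<Longrightarrow> smooth_section_on A J U \<psi>"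
      by (rule g_frame_around[of p]) blast
    have "\<psi> x \<in> S x" if "\<psi> \<in> \<Psi>" "x \<in> U" for \<psi> x
    proof -
      have "is_frame g U \<Psi>" using U(3) by (simp add: is_frame_iff)
      then have "\<psi> x \<in> g x" using that span_base[of "\<psi> x" "(\<lambda>b. b x) ` \<Psi>"] by (auto simp: is_frame_def)
      then show ?thesis using gS by blast
    qed
    then have "\<forall>\<psi>\<in>\<Psi>. smooth_section_on A J1 U (\<lambda>x. kappa x (\<psi> x))"
      using kappa_section[OF U(1) U(4)] by blast
    then show ?thesis using U(2,3) h_frame[OF U(3)] by blast
  qed
  have "dim (h p) = dim (g p)" for p
  proof -
    obtain U \<Psi> where U: "p \<in> U" "fam_frame g U \<Psi> (\<lambda>\<psi>. \<psi>)" "fam_frame h U \<Psi> (\<lambda>\<psi> x. kappa x (\<psi> x))"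
      using fr by blast
    show ?thesis using fam_frame_dim[OF U(2,1)] fam_frame_dim[OF U(3,1)] by simp
  qed
  then show "constant_rank h" using g_subbundle by (simp add: subbundle_def constant_rank_def)
  have "p \<in> (\<Union>(U, \<Phi>)\<in>sub_frames A J1 h. U)" for p
  proof -
    obtain U \<Psi> where U: "p \<in> U" "fam_frame h U \<Psi> (\<lambda>\<psi> x. kappa x (\<psi> x))"
      "\<forall>\<psi>\<in>\<Psi>. smooth_section_on A J1 U (\<lambda>x. kappa x (\<psi> x))" using fr by blast
    then have "(U, (\<lambda>\<psi> x. kappa x (\<psi> x)) ` \<Psi>) \<in> sub_frames A J1 h"
      using fam_frame_is_frame[OF U(2)] by (auto simp: sub_frames_def)
    then show ?thesis using U(1) by blast
  qed
  then show "(\<Union>(U, \<Phi>)\<in>sub_frames A J1 h. U) = UNIV" by blast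
  show "bracket J1 X Y x \<in> h x" if XY: "X \<in> sections A J1" "Y \<in> sections A J1"
    "(\<forall>x. X x \<in> h x) \<and> (\<forall>x. Y x \<in> h x)" for X Y x
  proof -
    have "bracket J (push X) (push Y) x \<in> g x"
      by (rule g_closed[OF push_sections[OF XY(1)] push_sections[OF XY(2)]]) (use XY(3) in \<open>auto simp: push_def h_iff\<close>)
    then show ?thesis unfolding bracket_J1 h_eq by blast
  qed
qed

text \<open>\<open>kappa\<close> leaves the value of a jet unchanged. As \<open>image_of g\<close>
  is the fibre of \<open>L1\<close> by construction, this amounts to surjectivity over the
  image.\<close>

lemma h_image: "image_of h = image_of g"
proof
  fix x
  have "fst (kappa x j) = fst j" if "j \<in> g x" for j using fst_kappa gS that by blast
  then show "image_of h x = image_of g x" unfolding image_of_def h_eq image_image by (rule image_cong[OF refl])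
qed

end

lemma elementary_reduction_fixed:
  assumes "g1 = g"
  shows "(\<forall>x. g x \<subseteq> S x) \<and> inf_geom_structure A L1 (pullback_to_sub A L L1 g) \<and>
    surjective_structure L1 (pullback_to_sub A L L1 g)"
proof -
  have gS: "g x \<subseteq> S x" for x using g1_eq[of x] assms by auto
  show ?thesis
    using gS L1_lie J1_jet_algebroid h_subalgebroid[OF gS] h_image[OF gS]
    by (auto simp: inf_geom_structure_def surjective_structure_def)
qed

end

theorem proposition2p4:
  fixes A :: "('m::{t2_space,second_countable_topology}, 'e::real_inner) chart set"
    and L :: "('m, 'v::real_vector) lie_algebroid"
    and g :: "'m \<Rightarrow> ('m, 'e, 'v) jet set"
  assumes "lie_algebroid A L"
    and "inf_geom_structure A L g"
    and "constant_rank (image_of g)"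
  shows
    "(constant_rank (elementary_reduction A L g) \<longrightarrow>
        is_reduction A L g (elementary_reduction A L g)) \<and>
     (surjective_structure L g \<longrightarrow> elementary_reduction A L g = g) \<and>
     (elementary_reduction A L g = g \<longrightarrow>
        (\<forall>x. g x \<subseteq> sub_jets A L (image_algebroid A L g) x) \<and>
        inf_geom_structure A (image_algebroid A L g)
          (pullback_to_sub A L (image_algebroid A L g) g) \<and>
        surjective_structure (image_algebroid A L g)
          (pullback_to_sub A L (image_algebroid A L g) g))"
proof -
  \<comment> \<open>The jet algebroid that witnesses the hypothesis on \<open>g\<close> also serves
    as witness for the reduction; only the structure over the image calls for a new one.\<close>
  obtain J where J: "jet_algebroid A L J" "subalgebroid A J g"
    using assms(2) by (auto simp: inf_geom_structure_def)
  have vb: "vector_bundle A L" using assms(1) unfolding lie_algebroid_def by (rule conjunct1)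
  have atlas: "smooth_atlas A" using vb unfolding vector_bundle_def by (rule conjunct1)
  have fib_J: "fib J = jet_fib A L" and frames_J: "frames J = jet_frames A L"
    using J(1) unfolding jet_algebroid_def by simp_all
  interpret geometric_structure A L J g
    by unfold_locales (fact atlas vb assms fib_J frames_J J)+
  show ?thesis using elementary_reduction_is_reduction elementary_reduction_of_surjective elementary_reduction_fixed
    by blast
qed

end
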